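(* In the multivariate partially linear model described in the context, under assumptions (B1)–(B3), the estimator $$\hat\beta=\big((X-Z\hat\Delta)^\top(X-Z\hat\Delta)\big)^{-1}(X-Z\hat\Delta)^\top(Y-Z\hat\theta)$$ satisfies $\sqrt n(\hat\beta-\beta)\xrightarrow{d}\mathcal N_q\big(0_q,\sigma_\epsilon^2\Sigma_H^{-1}\big)$.
   Context: Asymptotics are as $n\to\infty$; $p=p_n$ and other quantities may depend on $n$; $q$ is fixed. Notation: for $u\in\mathbb N$, $\mathcal M_u=\{m\subseteq\{1,\dots,p\}:|m|=u\}$; $Z_m$ is the submatrix of $Z\in\mathbb R^{n\times p}$ with columns in $m$, $P_m$ the orthogonal projection onto its column space, $P_m^\perp=I_n-P_m$. A (possibly random) sequence $v\in\mathbb R^n$ is weakly sparse relative to $Z$ (in probability) with sparsity $s$ at rate $k$ if there are sets $S\in\mathcal M_s$ with $\|P_S^\perp v\|^2=o_p(k)$. A mean-zero random variable/vector $\xi$ is sub-Gaussian with parameter $K$ if $\mathbb E\exp(\lambda^\top\xi)\le\exp(K^2\|\lambda\|^2/2)$ for all $\lambda$. Exponential weights: $w_m(V;u,\alpha)=\exp(-\|P_m^\perp V\|^2/\alpha)/\sum_{k\in\mathcal M_u}\exp(-\|P_k^\perp V\|^2/\alpha)$, $\hat f(V;u,\alpha)=\sum_{m\in\mathcal M_u}w_m(V;u,\alpha)P_mV$. Model: $Y=X\beta+\mu+\epsilon$, $X=N+H$, with $X,N,H\in\mathbb R^{n\times q}$ (columns $X_j,N_j,H_j$, rows $H^{(i)}$),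 $Y,\mu,\epsilon\in\mathbb R^n$, $\beta\in\mathbb R^q$ fixed; $(Y,X,Z)$ observed. $\sigma_\epsilon^2=\mathrm{Var}(\epsilon_1)$, $\Sigma_H=\mathrm{Var}(H^{(1)})$. (B1) $\|\mu\|^2$ and $\|N_j\|^2$, $1\le j\le q$, are uniformly $O_p(n)$. (B2) The rows of $H$ are i.i.d., the entries of $\epsilon$ are i.i.d., $H$ and $\epsilon$ are independent of each other and of $(Z,\mu,N)$; the entries of column $j$ of $H$ are sub-Gaussian with parameter $K_{\eta,j}$, those of $\epsilon$ sub-Gaussian with parameter $K_\epsilon$; $\Sigma_H$ is invertible. (B3) $\mu$, each $N_j$, and $N\beta+\mu$ are weakly sparse relative to $Z$ at rate $\sqrt n$ with sparsities $s_\gamma$, $s_{\delta,j}$, $s_\theta$; chosen integers satisfy $u_\gamma\ge s_\gamma$, $u_{\delta,j}\ge s_{\delta,j}$, $u_\theta\ge s_\theta$ for all large $n$, and $\max(u_\gamma,\max_ju_{\delta,j},u_\theta)=o(\sqrt n/\log p)$. Estimators: $Z\hat\theta=\hat f(Y;u_\theta,\alpha_Y)$ with fixed $\alpha_Y>4K_Y^2$, where $K_Y$ is a (fixed) sub-Gaussian parameter of the vector $H\beta+\epsilon$; $\hat\Delta\in\mathbb R^{p\times q}$ has columns $\hat\delta_j$ with $Z\hat\delta_j=\hat f(X_j;u_{\delta,j},\alpha_{X,j})$, fixed $\alpha_{X,j}>4K_{\eta,j}^2$. *)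

theory Defs
  imports "HOL-Probability.Probability"
begin

text \<open>Vectors in R^n are represented as functions nat => real; only the entries
  with index i < n are relevant.  An n x p matrix Z is a function
  nat => nat => real (Z i j = entry in row i, column j), columns indexed by {..<p}.\<close>

definition sqn :: "nat \<Rightarrow> (nat \<Rightarrow> real) \<Rightarrow> real" where
  "sqn n v = (\<Sum>i<n. (v i)\<^sup>2)"

text \<open>Orthogonal projection P_m v of v onto the span of the columns Z_j, j in m:
  the fitted vector of any solution c of the normal equations (it is unique).\<close>
definition proj :: "nat \<Rightarrow> (nat \<Rightarrow> nat \<Rightarrow> real) \<Rightarrow> nat set \<Rightarrow> (nat \<Rightarrow> real) \<Rightarrow> nat \<Rightarrow> real" where
  "proj n Z m v =
     (let c = (SOME c. \<forall>j\<in>m. (\<Sum>i<n. (v i - (\<Sum>k\<in>m. c k * Z i k)) * Z i j) = 0)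
      in (\<lambda>i. if i < n then (\<Sum>k\<in>m. c k * Z i k) else 0))"

definition resid :: "nat \<Rightarrow> (nat \<Rightarrow> nat \<Rightarrow> real) \<Rightarrow> nat set \<Rightarrow> (nat \<Rightarrow> real) \<Rightarrow> nat \<Rightarrow> real" where
  "resid n Z m v = (\<lambda>i. if i < n then v i - proj n Z m v i else 0)"

definition subsets_of_size :: "nat \<Rightarrow> nat \<Rightarrow> nat set set" where
  "subsets_of_size p u = {m. m \<subseteq> {..<p} \<and> card m = u}"

definition ew_weight :: "nat \<Rightarrow> nat \<Rightarrow> (nat \<Rightarrow> nat \<Rightarrow> real) \<Rightarrow> (nat \<Rightarrow> real) \<Rightarrow> nat \<Rightarrow> real \<Rightarrow> nat set \<Rightarrow> real" where
  "ew_weight n p Z V u \<alpha> m =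
     exp (- sqn n (resid n Z m V) / \<alpha>) /
     (\<Sum>k\<in>subsets_of_size p u. exp (- sqn n (resid n Z k V) / \<alpha>))"

definition fhat :: "nat \<Rightarrow> nat \<Rightarrow> (nat \<Rightarrow> nat \<Rightarrow> real) \<Rightarrow> (nat \<Rightarrow> real) \<Rightarrow> nat \<Rightarrow> real \<Rightarrow> nat \<Rightarrow> real" where
  "fhat n p Z V u \<alpha> = (\<lambda>i. \<Sum>m\<in>subsets_of_size p u. ew_weight n p Z V u \<alpha> m * proj n Z m V i)"

text \<open>The estimator beta-hat = ((X - Z Delta)^T (X - Z Delta))^{-1} (X - Z Delta)^T (Y - Z theta),
  where Z theta = fhat(Y; u_theta, alpha_Y) and Z delta_j = fhat(X_j; u_delta_j, alpha_X_j).
  X is given by its rows X i :: real^'q.  Convention: 0 if the Gram matrix is singular.\<close>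
definition betahat ::
  "nat \<Rightarrow> nat \<Rightarrow> (nat \<Rightarrow> nat \<Rightarrow> real) \<Rightarrow> (nat \<Rightarrow> real) \<Rightarrow> (nat \<Rightarrow> real^'q) \<Rightarrow>
   nat \<Rightarrow> real \<Rightarrow> ('q \<Rightarrow> nat) \<Rightarrow> ('q \<Rightarrow> real) \<Rightarrow> real^'q::finite" where
  "betahat n p Z Y X u\<theta> \<alpha>Y u\<delta> \<alpha>X =
     (let Xt = (\<lambda>i j. X i $ j - fhat n p Z (\<lambda>i. X i $ j) (u\<delta> j) (\<alpha>X j) i);
          Yt = (\<lambda>i. Y i - fhat n p Z Y u\<theta> \<alpha>Y i);
          G = (\<chi> j k. \<Sum>i<n. Xt i j * Xt i k);
          b = (\<chi> j. \<Sum>i<n. Xt i j * Yt i)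
      in if invertible G then matrix_inv G *v b else 0)"

definition bigOp :: "(nat \<Rightarrow> 'a measure) \<Rightarrow> (nat \<Rightarrow> 'a \<Rightarrow> real) \<Rightarrow> (nat \<Rightarrow> real) \<Rightarrow> bool" where
  "bigOp M T r \<longleftrightarrow> (\<forall>e>0. \<exists>C. eventually
      (\<lambda>n. measure (M n) {\<omega>\<in>space (M n). \<bar>T n \<omega>\<bar> > C * r n} \<le> e) sequentially)"

definition smallOp :: "(nat \<Rightarrow> 'a measure) \<Rightarrow> (nat \<Rightarrow> 'a \<Rightarrow> real) \<Rightarrow> (nat \<Rightarrow> real) \<Rightarrow> bool" where
  "smallOp M T r \<longleftrightarrow> (\<forall>\<delta>>0.
      (\<lambda>n. measure (M n) {\<omega>\<in>space (M n). \<bar>T n \<omega>\<bar> > \<delta> * r n}) \<longlonglongrightarrow> 0)"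

definition weakly_sparse ::
  "(nat \<Rightarrow> 'a measure) \<Rightarrow> (nat \<Rightarrow> nat) \<Rightarrow> (nat \<Rightarrow> 'a \<Rightarrow> nat \<Rightarrow> nat \<Rightarrow> real) \<Rightarrow>
   (nat \<Rightarrow> 'a \<Rightarrow> nat \<Rightarrow> real) \<Rightarrow> (nat \<Rightarrow> nat) \<Rightarrow> (nat \<Rightarrow> real) \<Rightarrow> bool" where
  "weakly_sparse M p Z v s r \<longleftrightarrow>
     (\<exists>S :: nat \<Rightarrow> 'a \<Rightarrow> nat set.
        (\<forall>n. \<forall>\<omega>\<in>space (M n). S n \<omega> \<in> subsets_of_size (p n) (s n)) \<and>
        (\<forall>n m. {\<omega>\<in>space (M n). S n \<omega> = m} \<in> sets (M n)) \<and>
        smallOp M (\<lambda>n \<omega>. sqn n (resid n (Z n \<omega>) (S n \<omega>) (v n \<omega>))) r)"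

definition subgaussian :: "'a measure \<Rightarrow> ('a \<Rightarrow> real) \<Rightarrow> real \<Rightarrow> bool" where
  "subgaussian M \<xi> K \<longleftrightarrow> integrable M \<xi> \<and> (\<integral>\<omega>. \<xi> \<omega> \<partial>M) = 0 \<and>
     (\<forall>l::real. integrable M (\<lambda>\<omega>. exp (l * \<xi> \<omega>)) \<and>
        (\<integral>\<omega>. exp (l * \<xi> \<omega>) \<partial>M) \<le> exp (K\<^sup>2 * l\<^sup>2 / 2))"

definition subgaussian_vec :: "'a measure \<Rightarrow> nat \<Rightarrow> ('a \<Rightarrow> nat \<Rightarrow> real) \<Rightarrow> real \<Rightarrow> bool" where
  "subgaussian_vec M n \<xi> K \<longleftrightarrow>
     (\<forall>i<n. integrable M (\<lambda>\<omega>. \<xi> \<omega> i) \<and> (\<integral>\<omega>. \<xi> \<omega> i \<partial>M) = 0) \<and>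
     (\<forall>l::nat \<Rightarrow> real. integrable M (\<lambda>\<omega>. exp (\<Sum>i<n. l i * \<xi> \<omega> i)) \<and>
        (\<integral>\<omega>. exp (\<Sum>i<n. l i * \<xi> \<omega> i) \<partial>M) \<le> exp (K\<^sup>2 * (\<Sum>i<n. (l i)\<^sup>2) / 2))"

definition gen_sigma :: "'a measure \<Rightarrow> ('a \<Rightarrow> real) set \<Rightarrow> 'a set set" where
  "gen_sigma M F = sigma_sets (space M) (\<Union>f\<in>F. {f -` A \<inter> space M | A. A \<in> sets borel})"

definition is_mvnormal :: "(real^'q::finite) measure \<Rightarrow> real^'q^'q \<Rightarrow> bool" where
  "is_mvnormal L S \<longleftrightarrow> prob_space L \<and> sets L = sets borel \<and>
     (\<forall>t. (\<integral>x. cis (t \<bullet> x) \<partial>L) = complex_of_real (exp (- (t \<bullet> (S *v t)) / 2)))"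

definition conv_in_distr :: "(nat \<Rightarrow> 'a measure) \<Rightarrow> (nat \<Rightarrow> 'a \<Rightarrow> 'b::euclidean_space) \<Rightarrow> 'b measure \<Rightarrow> bool" where
  "conv_in_distr M T L \<longleftrightarrow> (\<forall>n. T n \<in> borel_measurable (M n)) \<and>
     (\<forall>g :: 'b \<Rightarrow> real. continuous_on UNIV g \<and> bounded (range g) \<longrightarrow>
        (\<lambda>n. \<integral>\<omega>. g (T n \<omega>) \<partial>M n) \<longlonglongrightarrow> (\<integral>x. g x \<partial>L))"

end

theory Submission
  imports Defs "HOL-Real_Asymp.Real_Asymp"
begin

text \<open>
  Write \<open>f\<close> for the signal and \<open>\<xi>\<close> for the noise of one of the regressions on \<open>Z\<close>. The Gibbs variational inequality
  bounds the error of the exponentially weighted fit by the sparse approximation error of \<open>f\<close>, by \<open>u log p\<close>, and by the largest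
  energy of the projections of \<open>\<xi>\<close> onto the spans of \<open>f\<close> and \<open>u\<close> columns of \<open>Z\<close>. Linearising the energy by Gaussian
  variables bounds its exponential moment, so a union bound gives \<open>O(u log p) = o(sqrt n)\<close> for sub-Gaussian noise independent
  of the design. The same energies bound the inner product of the fitting error with any noise vector, even one on which the fit
  depends. Hence \<open>sqrt n (betahat - \<beta>)\<close> differs from \<open>\<Sigma>\<^sub>H\<inverse> n\<^bsup>-1/2\<^esup> H\<^sup>T \<epsilon>\<close> by \<open>o\<^sub>p(1)\<close>. The characteristic function of
  the latter converges to the Gaussian one, and a multivariate continuity theorem concludes; it approximates bounded continuous
  functions by trigonometric polynomials.
\<close>

subsection \<open>Orthogonal projections onto spans of columns\<close>

text \<open>The weights are computed from the very noise with which the fitting errors are later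
  paired. A maximum over all models removes the weights from every bound. Why
  \<open>o(sqrt n)\<close> suffices: let \<open>d k\<close> and \<open>e\<close> be the errors of
  the fits of the \<open>k\<close>-th column of \<open>X\<close> and of \<open>Y\<close>. The
  residual of \<open>Y\<close> equals the residual matrix of \<open>X\<close> times
  \<open>\<beta>\<close> plus \<open>\<rho>\<close>, and \<open>\<rho>\<close> is
  \<open>\<epsilon>\<close> minus \<open>e\<close> plus a combination of the \<open>d k\<close>.
  Pairing \<open>\<rho>\<close> with a residual column of \<open>X\<close> gives the score entry of
  \<open>H\<^sup>T \<epsilon>\<close> and, besides it, only two kinds of terms: a fitting error
  against a noise vector, controlled by energies, and two fitting errors against each other,
  controlled by Cauchy--Schwarz. Both are \<open>o(sqrt n)\<close>. The scale
  \<open>\<kappa> * K\<^sup>2 = 1 / 4\<close> in the exponential moment leaves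
  \<open>exp (g\<^sup>2 / 4)\<close> after each Gaussian linearisation. This is still integrable
  against the standard normal density and costs a factor \<open>sqrt 2\<close> per direction, so a
  model of size \<open>u\<close> contributes only \<open>exp (O(u))\<close>, which the union bound
  can afford.\<close>

definition inn :: "nat \<Rightarrow> (nat \<Rightarrow> real) \<Rightarrow> (nat \<Rightarrow> real) \<Rightarrow> real" where
  "inn n a b = (\<Sum>i<n. a i * b i)"

lemma inn_commute: "inn n a b = inn n b a"
  by (simp add: inn_def mult.commute)

lemma inn_add_left: "inn n (\<lambda>i. a i + b i) c = inn n a c + inn n b c"
  by (simp add: inn_def distrib_right sum.distrib)

lemma inn_diff_left: "inn n (\<lambda>i. a i - b i) c = inn n a c - inn n b c"
  by (simp add: inn_def left_diff_distrib sum_subtractf)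

lemma inn_scale_left: "inn n (\<lambda>i. t * a i) c = t * inn n a c"
  by (simp add: inn_def sum_distrib_left mult.assoc)

lemma inn_sum_left: "inn n (\<lambda>i. \<Sum>k\<in>m. a k i) c = (\<Sum>k\<in>m. inn n (a k) c)"
  unfolding inn_def by (simp add: sum_distrib_right) (rule sum.swap)

lemma inn_add_right: "inn n c (\<lambda>i. a i + b i) = inn n c a + inn n c b"
  by (simp add: inn_def distrib_left sum.distrib)

lemma inn_diff_right: "inn n c (\<lambda>i. a i - b i) = inn n c a - inn n c b"
  by (simp add: inn_def right_diff_distrib sum_subtractf)

lemma inn_scale_right: "inn n c (\<lambda>i. t * a i) = t * inn n c a"
  by (simp add: inn_def sum_distrib_left mult.assoc mult.left_commute)

lemma inn_sum_right: "inn n c (\<lambda>i. \<Sum>k\<in>m. a k i) = (\<Sum>k\<in>m. inn n c (a k))"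
  unfolding inn_def by (simp add: sum_distrib_left) (rule sum.swap)

lemma inn_zero [simp]: "inn n (\<lambda>i. 0) a = 0" "inn n a (\<lambda>i. 0) = 0"
  by (simp_all add: inn_def)

lemmas inn_linear = inn_add_left inn_diff_left inn_scale_left inn_sum_left
  inn_add_right inn_diff_right inn_scale_right inn_sum_right

lemma inn_self: "inn n a a = sqn n a"
  by (simp add: inn_def sqn_def power2_eq_square)

lemma inn_cong: "(\<And>i. i < n \<Longrightarrow> a i = a' i) \<Longrightarrow> (\<And>i. i < n \<Longrightarrow> b i = b' i) \<Longrightarrow> inn n a b = inn n a' b'"
  by (simp add: inn_def)

lemma sqn_cong: "(\<And>i. i < n \<Longrightarrow> a i = a' i) \<Longrightarrow> sqn n a = sqn n a'"
  by (simp add: sqn_def)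

lemma sqn_nonneg [simp]: "0 \<le> sqn n a"
  by (simp add: sqn_def sum_nonneg)

lemma sqn_eq_0D: "sqn n a = 0 \<Longrightarrow> i < n \<Longrightarrow> a i = 0"
  by (simp add: sqn_def sum_nonneg_eq_0_iff)

lemma sqn_add: "sqn n (\<lambda>i. a i + b i) = sqn n a + 2 * inn n a b + sqn n b"
  by (simp add: inn_self[symmetric] inn_linear inn_commute[of n b a])

lemma sqn_diff: "sqn n (\<lambda>i. a i - b i) = sqn n a - 2 * inn n a b + sqn n b"
  by (simp add: inn_self[symmetric] inn_linear inn_commute[of n b a])

lemma sqn_scale: "sqn n (\<lambda>i. t * a i) = t\<^sup>2 * sqn n a"
  by (simp add: inn_self[symmetric] inn_linear power2_eq_square)

lemma inn_sq_le: "(inn n a b)\<^sup>2 \<le> sqn n a * sqn n b"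
  unfolding inn_def sqn_def by (rule Cauchy_Schwarz_ineq_sum)

lemma abs_inn_le: "\<bar>inn n a b\<bar> \<le> sqrt (sqn n a) * sqrt (sqn n b)"
  using inn_sq_le[of n a b] by (simp add: real_le_rsqrt real_sqrt_mult[symmetric] abs_le_square_iff)

text \<open>By the parallelogram identity the gap is the squared norm of the difference.\<close>

lemma sqn_add_le: "sqn n (\<lambda>i. a i + b i) \<le> 2 * sqn n a + 2 * sqn n b"
  using sqn_nonneg[of n "\<lambda>i. a i - b i"] unfolding sqn_diff sqn_add by simp

definition in_span :: "nat \<Rightarrow> (nat \<Rightarrow> nat \<Rightarrow> real) \<Rightarrow> nat set \<Rightarrow> (nat \<Rightarrow> real) \<Rightarrow> bool" where
  "in_span n Z m v \<longleftrightarrow> (\<exists>c. \<forall>i<n. v i = (\<Sum>k\<in>m. c k * Z i k))"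

lemma in_span_orth:
  assumes "in_span n Z m v" "\<And>k. k \<in> m \<Longrightarrow> inn n w (\<lambda>i. Z i k) = 0"
  shows "inn n w v = 0"
proof -
  obtain c where "\<And>i. i < n \<Longrightarrow> v i = (\<Sum>k\<in>m. c k * Z i k)" using assms(1) unfolding in_span_def by auto
  then have "inn n w v = inn n w (\<lambda>i. \<Sum>k\<in>m. c k * Z i k)" by (intro inn_cong) auto
  also have "\<dots> = 0" by (simp add: inn_linear assms(2))
  finally show ?thesis .
qed

lemma in_span_cong: "in_span n Z m v \<Longrightarrow> (\<And>i. i < n \<Longrightarrow> v i = w i) \<Longrightarrow> in_span n Z m w"
  unfolding in_span_def by (elim exE, rule_tac x=c in exI) auto

lemma in_span_add: "in_span n Z m v \<Longrightarrow> in_span n Z m w \<Longrightarrow> in_span n Z m (\<lambda>i. v i + w i)"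
  unfolding in_span_def
  by (elim exE, rule_tac x="\<lambda>k. c k + ca k" in exI) (auto simp: distrib_right sum.distrib)

lemma in_span_scale: "in_span n Z m v \<Longrightarrow> in_span n Z m (\<lambda>i. t * v i)"
  unfolding in_span_def
  by (elim exE, rule_tac x="\<lambda>k. t * c k" in exI) (auto simp: sum_distrib_left mult.assoc)

lemma in_span_diff: "in_span n Z m v \<Longrightarrow> in_span n Z m w \<Longrightarrow> in_span n Z m (\<lambda>i. v i - w i)"
  using in_span_add[OF _ in_span_scale[of n Z m w "-1"]] by simp

lemma in_span_mono:
  assumes "in_span n Z m v" "m \<subseteq> m'" "finite m'"
  shows "in_span n Z m' v"
proof -
  obtain c where c: "\<And>i. i < n \<Longrightarrow> v i = (\<Sum>k\<in>m. c k * Z i k)" using assms(1) unfolding in_span_def by auto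
  have "(\<Sum>k\<in>m'. (if k \<in> m then c k else 0) * Z i k) = (\<Sum>k\<in>m. c k * Z i k)" for i
    by (rule sum.mono_neutral_cong_right) (use assms in auto)
  then show ?thesis unfolding in_span_def using c by (intro exI[of _ "\<lambda>k. if k \<in> m then c k else 0"]) auto
qed

lemma in_span_col: "finite m \<Longrightarrow> k \<in> m \<Longrightarrow> in_span n Z m (\<lambda>i. Z i k)"
  unfolding in_span_def
  by (rule exI[of _ "\<lambda>j. if j = k then 1 else 0"]) (simp add: if_distrib[of "\<lambda>x. x * _"] sum.delta cong: if_cong)

text \<open>Gram--Schmidt by induction on the columns: \<open>v\<close> and the new column are both
  projected onto the old span, and the projection of \<open>v\<close> is corrected along the
  residual \<open>r\<close> of the new column.\<close>

lemma orth_proj_exists: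
  assumes "finite m"
  shows "\<exists>w. in_span n Z m w \<and> (\<forall>j\<in>m. inn n (\<lambda>i. v i - w i) (\<lambda>i. Z i j) = 0)"
  using assms
proof (induction m arbitrary: v rule: finite_induct)
  case empty
  then show ?case unfolding in_span_def by (intro exI[of _ "\<lambda>i. 0"]) auto
next
  case (insert x m)
  from insert.IH[of v] obtain w where w: "in_span n Z m w" "\<And>j. j \<in> m \<Longrightarrow> inn n (\<lambda>i. v i - w i) (\<lambda>i. Z i j) = 0" by blast
  from insert.IH[of "\<lambda>i. Z i x"] obtain y where y: "in_span n Z m y"
    "\<And>j. j \<in> m \<Longrightarrow> inn n (\<lambda>i. Z i x - y i) (\<lambda>i. Z i j) = 0" by blast
  define r where "r = (\<lambda>i. Z i x - y i)"
  define a where "a = inn n v r / sqn n r"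
  have fin: "finite (insert x m)" using insert by simp
  have span: "in_span n Z (insert x m) w" "in_span n Z (insert x m) y"
    using w(1) y(1) fin by (auto intro: in_span_mono)
  have rspan: "in_span n Z (insert x m) r"
    unfolding r_def by (intro in_span_diff span in_span_col fin) simp
  have wr: "inn n r w = 0" by (rule in_span_orth[OF w(1)]) (simp add: r_def y)
  \<comment> \<open>This includes a column that depends on the earlier ones: then \<open>r\<close>
    vanishes on \<open>{..<n}\<close> and both sides are 0.\<close>
  have ar: "a * sqn n r = inn n v r"
  proof (cases "sqn n r = 0")
    case True
    then have "r i = 0" if "i < n" for i using that by (rule sqn_eq_0D)
    then have "inn n v r = inn n v (\<lambda>i. 0 * r i)" by (intro inn_cong) auto
    then show ?thesis using True by (simp add: inn_linear)
  qed (simp add: a_def)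
  let ?w = "\<lambda>i. w i + a * r i"
  have eq: "inn n (\<lambda>i. v i - ?w i) u = inn n (\<lambda>i. v i - w i) u - a * inn n r u" for u
    by (simp add: inn_linear)
  have om: "inn n (\<lambda>i. v i - ?w i) (\<lambda>i. Z i j) = 0" if "j \<in> m" for j
    unfolding eq using w(2)[OF that] y(2)[OF that] by (simp add: r_def)
  have "inn n (\<lambda>i. v i - ?w i) (\<lambda>i. Z i x) = inn n (\<lambda>i. v i - ?w i) (\<lambda>i. r i + y i)"
    by (simp add: r_def)
  also have "\<dots> = inn n (\<lambda>i. v i - ?w i) r + inn n (\<lambda>i. v i - ?w i) y" by (rule inn_add_right)
  also have "inn n (\<lambda>i. v i - ?w i) y = 0" by (rule in_span_orth[OF y(1)]) (rule om)
  also have "inn n (\<lambda>i. v i - ?w i) r = 0"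
    unfolding eq using wr ar by (simp add: inn_linear inn_self inn_commute)
  finally show ?case using om rspan span by (intro exI[of _ ?w]) (auto intro: in_span_add in_span_scale)
qed

text \<open>The difference of two candidates lies in the span and is orthogonal to it, so its
  squared norm is 0.\<close>

lemma orth_proj_unique:
  assumes "in_span n Z m w" "in_span n Z m w'"
    and "\<And>j. j \<in> m \<Longrightarrow> inn n (\<lambda>i. v i - w i) (\<lambda>i. Z i j) = 0"
    and "\<And>j. j \<in> m \<Longrightarrow> inn n (\<lambda>i. v i - w' i) (\<lambda>i. Z i j) = 0"
    and "i < n"
  shows "w i = w' i"
proof -
  have s: "in_span n Z m (\<lambda>i. w i - w' i)" using assms by (intro in_span_diff)
  have "inn n (\<lambda>i. v i - w i) (\<lambda>i. w i - w' i) = 0" "inn n (\<lambda>i. v i - w' i) (\<lambda>i. w i - w' i) = 0"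
    by (rule in_span_orth[OF s], simp add: assms)+
  then have "sqn n (\<lambda>i. w i - w' i) = 0"
    by (simp add: inn_self[symmetric] inn_linear)
  from sqn_eq_0D[OF this \<open>i < n\<close>] show ?thesis by simp
qed

lemma proj_in_span: "in_span n Z m (proj n Z m v)"
  unfolding in_span_def proj_def Let_def by auto

text \<open>Existence makes the \<open>SOME\<close> in \<open>proj\<close> an actual solution of the
  normal equations. With dependent columns the coefficients are arbitrary, but the fitted vector is
  not.\<close>

lemma proj_orth:
  assumes "finite m" "j \<in> m"
  shows "inn n (\<lambda>i. v i - proj n Z m v i) (\<lambda>i. Z i j) = 0"
proof -
  let ?P = "\<lambda>c. \<forall>j\<in>m. (\<Sum>i<n. (v i - (\<Sum>k\<in>m. c k * Z i k)) * Z i j) = 0"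
  obtain w c where w: "\<And>i. i < n \<Longrightarrow> w i = (\<Sum>k\<in>m. c k * Z i k)" "\<And>j. j \<in> m \<Longrightarrow> inn n (\<lambda>i. v i - w i) (\<lambda>i. Z i j) = 0"
    using orth_proj_exists[OF assms(1), of n Z v] unfolding in_span_def by blast
  have "?P c" using w by (simp add: inn_def)
  then have "?P (SOME c. ?P c)" by (rule someI[of ?P])
  then show ?thesis using assms(2) by (simp add: proj_def Let_def inn_def)
qed

lemma proj_unique:
  assumes "finite m" "in_span n Z m w" "\<And>j. j \<in> m \<Longrightarrow> inn n (\<lambda>i. v i - w i) (\<lambda>i. Z i j) = 0" "i < n"
  shows "proj n Z m v i = w i"
  by (rule orth_proj_unique[OF proj_in_span assms(2) proj_orth assms(3)]) (use assms in auto)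

lemma proj_outside: "\<not> i < n \<Longrightarrow> proj n Z m v i = 0"
  by (simp add: proj_def Let_def)

lemma proj_eqI:
  assumes "finite m" "in_span n Z m w" "\<And>j. j \<in> m \<Longrightarrow> inn n (\<lambda>i. v i - w i) (\<lambda>i. Z i j) = 0"
    and "\<And>i. \<not> i < n \<Longrightarrow> w i = 0"
  shows "proj n Z m v = w"
  using assms(4) by (intro ext) (metis proj_unique[OF assms(1-3)] proj_outside)

text \<open>The two choice predicates coincide, so \<open>SOME\<close> returns the same coefficients
  even when the solution is not unique.\<close>

lemma proj_cong:
  assumes "\<And>i k. i < n \<Longrightarrow> k \<in> m \<Longrightarrow> Z i k = Z' i k" "\<And>i. i < n \<Longrightarrow> v i = v' i"
  shows "proj n Z m v = proj n Z' m v'"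
proof -
  have "(\<Sum>i<n. (v i - (\<Sum>k\<in>m. c k * Z i k)) * Z i j) = (\<Sum>i<n. (v' i - (\<Sum>k\<in>m. c k * Z' i k)) * Z' i j)"
    if "j \<in> m" for c j
    by (intro sum.cong refl) (simp add: assms that cong: sum.cong)
  then show ?thesis unfolding proj_def Let_def
    by (intro ext) (simp add: assms cong: ball_cong if_cong)
qed

lemma resid_cong:
  assumes "\<And>i k. i < n \<Longrightarrow> k \<in> m \<Longrightarrow> Z i k = Z' i k" "\<And>i. i < n \<Longrightarrow> v i = v' i"
  shows "resid n Z m v = resid n Z' m v'"
proof -
  have "proj n Z m v = proj n Z' m v'" using assms by (rule proj_cong)
  then show ?thesis using assms(2) by (auto simp: resid_def)
qed

lemma proj_empty: "proj n Z {} v i = 0"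
  by (simp add: proj_def)

lemma inn_resid: "inn n (resid n Z m v) w = inn n (\<lambda>i. v i - proj n Z m v i) w"
  by (rule inn_cong) (auto simp: resid_def)

lemma resid_orth_span:
  "finite m \<Longrightarrow> in_span n Z m w \<Longrightarrow> inn n (resid n Z m v) w = 0"
  unfolding inn_resid by (rule in_span_orth) (auto intro: proj_orth)

lemma proj_linear:
  assumes "finite m"
  shows "proj n Z m (\<lambda>i. a * v i + b * w i) = (\<lambda>i. a * proj n Z m v i + b * proj n Z m w i)"
proof (rule proj_eqI[OF assms])
  fix j assume j: "j \<in> m"
  have "inn n (\<lambda>i. v i - proj n Z m v i) (\<lambda>i. Z i j) = 0" "inn n (\<lambda>i. w i - proj n Z m w i) (\<lambda>i. Z i j) = 0"
    using assms j by (auto intro: proj_orth)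
  then show "inn n (\<lambda>i. a * v i + b * w i - (a * proj n Z m v i + b * proj n Z m w i)) (\<lambda>i. Z i j) = 0"
    by (simp add: inn_linear)
qed (intro in_span_add in_span_scale proj_in_span, simp add: proj_outside)

lemma proj_add:
  assumes "finite m"
  shows "proj n Z m (\<lambda>i. v i + w i) = (\<lambda>i. proj n Z m v i + proj n Z m w i)"
  using proj_linear[OF assms, of n Z 1 v 1 w] by simp

lemma proj_scale:
  assumes "finite m"
  shows "proj n Z m (\<lambda>i. a * v i) = (\<lambda>i. a * proj n Z m v i)"
  using proj_linear[OF assms, of n Z a v 0 v] by simp

lemma resid_add:
  assumes "finite m"
  shows "resid n Z m (\<lambda>i. v i + w i) = (\<lambda>i. resid n Z m v i + resid n Z m w i)"
  unfolding resid_def proj_add[OF assms] by auto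

lemma inn_proj_self: "finite m \<Longrightarrow> in_span n Z m w \<Longrightarrow> inn n w (proj n Z m v) = inn n w v"
  using resid_orth_span[of m n Z w v] by (simp add: inn_resid inn_linear inn_commute[of n w])

lemma sqn_resid: "finite m \<Longrightarrow> sqn n (resid n Z m v) = sqn n v - sqn n (proj n Z m v)"
proof -
  assume "finite m"
  then have "inn n (proj n Z m v) (proj n Z m v) = inn n (proj n Z m v) v" by (intro inn_proj_self proj_in_span)
  moreover have "sqn n (resid n Z m v) = sqn n (\<lambda>i. v i - proj n Z m v i)" by (rule sqn_cong) (simp add: resid_def)
  ultimately show ?thesis by (simp add: sqn_diff inn_self inn_commute)
qed

text \<open>One Gram--Schmidt step; for a column already in the span the quotient is \<open>0 / 0 = 0\<close>.\<close>
lemma proj_insert: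
  fixes Z :: "nat \<Rightarrow> nat \<Rightarrow> real" and n x :: nat
  assumes "finite m"
  defines "r \<equiv> resid n Z m (\<lambda>i. Z i x)"
  shows "proj n Z (insert x m) v = (\<lambda>i. proj n Z m v i + inn n v r / sqn n r * r i)"
proof (rule proj_eqI)
  let ?a = "inn n v r / sqn n r"
  show fin: "finite (insert x m)" using assms by simp
  have span: "in_span n Z (insert x m) (proj n Z m u)" for u
    by (rule in_span_mono[OF proj_in_span]) (use fin in auto)
  have rspan: "in_span n Z (insert x m) r"
    by (rule in_span_cong[of _ _ _ "\<lambda>i. Z i x - proj n Z m (\<lambda>i. Z i x) i"], intro in_span_diff span in_span_col fin)
       (auto simp: r_def resid_def)
  show "in_span n Z (insert x m) (\<lambda>i. proj n Z m v i + ?a * r i)"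
    by (intro in_span_add in_span_scale span rspan)
  have ro: "inn n r w = 0" if "in_span n Z m w" for w
    unfolding r_def using that assms by (intro resid_orth_span)
  have ar: "?a * sqn n r = inn n v r"
  proof (cases "sqn n r = 0")
    case True
    then have "r i = 0" if "i < n" for i using that by (rule sqn_eq_0D)
    then have "inn n v r = inn n v (\<lambda>i. 0 * r i)" by (intro inn_cong) auto
    then show ?thesis using True by (simp add: inn_linear)
  qed simp
  have om: "inn n (\<lambda>i. v i - (proj n Z m v i + ?a * r i)) (\<lambda>i. Z i j) = 0" if "j \<in> m" for j
    using proj_orth[OF assms(1) that, of n v Z] ro[OF in_span_col[OF assms(1) that]]
    unfolding inn_linear by simp
  fix j assume "j \<in> insert x m"
  then consider "j \<in> m" | "j = x" by auto
  then show "inn n (\<lambda>i. v i - (proj n Z m v i + ?a * r i)) (\<lambda>i. Z i j) = 0"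
  proof cases
    case 2
    have "inn n (\<lambda>i. v i - (proj n Z m v i + ?a * r i)) (\<lambda>i. Z i x) =
      inn n (\<lambda>i. v i - (proj n Z m v i + ?a * r i)) (\<lambda>i. r i + proj n Z m (\<lambda>i. Z i x) i)"
      by (rule inn_cong) (auto simp: r_def resid_def)
    also have "\<dots> = inn n (\<lambda>i. v i - (proj n Z m v i + ?a * r i)) r"
      using in_span_orth[OF proj_in_span[of n Z m "\<lambda>i. Z i x"] om] by (simp only: inn_add_right)
    also have "\<dots> = inn n v r - inn n (proj n Z m v) r - ?a * sqn n r"
      unfolding inn_linear inn_self by simp
    also have "inn n (proj n Z m v) r = 0" using ro[OF proj_in_span] by (simp add: inn_commute)
    finally show ?thesis using ar 2 by simp
  qed (rule om)
qed (auto simp: proj_outside r_def resid_def)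

text \<open>Pythagoras, since \<open>r\<close> is orthogonal to the old span. Monotonicity in the
  model and the Gaussian linearisation of one direction at a time both rest on this
  identity.\<close>

lemma sqn_proj_insert:
  fixes Z :: "nat \<Rightarrow> nat \<Rightarrow> real" and n x :: nat
  assumes "finite m"
  defines "r \<equiv> resid n Z m (\<lambda>i. Z i x)"
  shows "sqn n (proj n Z (insert x m) v) = sqn n (proj n Z m v) + (inn n v r)\<^sup>2 / sqn n r"
proof -
  have "inn n (proj n Z m v) r = 0"
    using resid_orth_span[OF assms(1) proj_in_span] by (simp add: r_def inn_commute)
  then have eq: "sqn n (\<lambda>i. proj n Z m v i + a * r i) = sqn n (proj n Z m v) + a\<^sup>2 * sqn n r" for a
    unfolding sqn_add sqn_scale inn_scale_right by simp
  show ?thesis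
    unfolding proj_insert[OF assms(1)] r_def[symmetric] eq by (simp add: power2_eq_square)
qed

lemma sqn_proj_mono:
  assumes "m \<subseteq> m'" "finite m'"
  shows "sqn n (proj n Z m v) \<le> sqn n (proj n Z m' v)"
proof -
  have "sqn n (proj n Z m v) \<le> sqn n (proj n Z (m \<union> F) v)" if "finite F" for F
    using that
  proof (induction F rule: finite_induct)
    case (insert x F)
    then show ?case using assms by (simp add: sqn_proj_insert finite_subset add_increasing2)
  qed simp
  from this[of m'] show ?thesis using assms by (simp add: Un_absorb1)
qed

lemma sqn_resid_mono:
  assumes "m \<subseteq> m'" "finite m'"
  shows "sqn n (resid n Z m' v) \<le> sqn n (resid n Z m v)"
  using sqn_proj_mono[OF assms, of n Z v] assms by (simp add: sqn_resid finite_subset)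

lemma measurable_inn:
  assumes "\<And>i. i < n \<Longrightarrow> (\<lambda>\<omega>. a \<omega> i) \<in> borel_measurable M" "\<And>i. i < n \<Longrightarrow> (\<lambda>\<omega>. b \<omega> i) \<in> borel_measurable M"
  shows "(\<lambda>\<omega>. inn n (a \<omega>) (b \<omega>)) \<in> borel_measurable M"
  unfolding inn_def using assms by (intro borel_measurable_sum borel_measurable_times) auto

lemma measurable_sqn:
  assumes "\<And>i. i < n \<Longrightarrow> (\<lambda>\<omega>. a \<omega> i) \<in> borel_measurable M"
  shows "(\<lambda>\<omega>. sqn n (a \<omega>)) \<in> borel_measurable M"
  unfolding inn_self[symmetric] using assms by (intro measurable_inn)

text \<open>The choice operator hides the dependence on the data; the recursion
  \<open>proj_insert\<close> rebuilds the projection from sums, products and quotients of measurable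
  functions.\<close>

lemma measurable_proj:
  assumes "finite m" "\<And>i k. i < n \<Longrightarrow> k \<in> m \<Longrightarrow> (\<lambda>\<omega>. Z \<omega> i k) \<in> borel_measurable M"
    and "\<And>i. i < n \<Longrightarrow> (\<lambda>\<omega>. v \<omega> i) \<in> borel_measurable M"
  shows "(\<lambda>\<omega>. proj n (Z \<omega>) m (v \<omega>) i) \<in> borel_measurable M"
  using assms
proof (induction m arbitrary: v i rule: finite_induct)
  case (insert x m)
  have p: "(\<lambda>\<omega>. proj n (Z \<omega>) m (v \<omega>) i) \<in> borel_measurable M"
    if "\<And>i. i < n \<Longrightarrow> (\<lambda>\<omega>. v \<omega> i) \<in> borel_measurable M" for v i
    using insert that by auto
  have r: "(\<lambda>\<omega>. resid n (Z \<omega>) m (\<lambda>i. Z \<omega> i x) i) \<in> borel_measurable M" for i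
    unfolding resid_def using p[of "\<lambda>\<omega> i. Z \<omega> i x" i] insert.prems(1) by (cases "i < n") auto
  show ?case unfolding proj_insert[OF insert.hyps(1)]
    by (intro borel_measurable_add borel_measurable_times borel_measurable_divide measurable_inn measurable_sqn p r insert.prems) auto
qed (simp add: proj_empty)

lemma measurable_resid:
  assumes "finite m" "\<And>i k. i < n \<Longrightarrow> k \<in> m \<Longrightarrow> (\<lambda>\<omega>. Z \<omega> i k) \<in> borel_measurable M"
    and "\<And>i. i < n \<Longrightarrow> (\<lambda>\<omega>. v \<omega> i) \<in> borel_measurable M"
  shows "(\<lambda>\<omega>. resid n (Z \<omega>) m (v \<omega>) i) \<in> borel_measurable M"
  unfolding resid_def using measurable_proj[OF assms] assms(3) by (cases "i < n") auto

subsection \<open>Deterministic error bounds for exponential weights\<close>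

text \<open>The design \<open>Z\<close> extended by the signal \<open>f\<close> as an extra column with index \<open>p\<close>: the span of
  \<open>f\<close> and the columns in \<open>m\<close> contains both the fits and the residual of \<open>f\<close>, so that one quadratic form
  controls every noise term of the model \<open>m\<close>.\<close>
definition ext_design :: "nat \<Rightarrow> (nat \<Rightarrow> nat \<Rightarrow> real) \<Rightarrow> (nat \<Rightarrow> real) \<Rightarrow> nat \<Rightarrow> nat \<Rightarrow> real" where
  "ext_design p Z f = (\<lambda>i k. if k = p then f i else Z i k)"

definition energy :: "nat \<Rightarrow> nat \<Rightarrow> (nat \<Rightarrow> nat \<Rightarrow> real) \<Rightarrow> (nat \<Rightarrow> real) \<Rightarrow> nat set \<Rightarrow> (nat \<Rightarrow> real) \<Rightarrow> real" where
  "energy n p Z f m \<xi> = sqn n (proj n (ext_design p Z f) (insert p m) \<xi>)"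

lemma energy_nonneg [simp]: "0 \<le> energy n p Z f m \<xi>"
  by (simp add: energy_def)

lemma finite_subsets_of_size [simp]: "finite (subsets_of_size p u)"
  unfolding subsets_of_size_def by (rule finite_subset[of _ "Pow {..<p}"]) auto

lemma subsets_of_sizeD:
  assumes "m \<in> subsets_of_size p u"
  shows "finite m" "m \<subseteq> {..<p}" "card m = u" "p \<notin> m"
  using assms by (auto simp: subsets_of_size_def intro: finite_subset)

lemma card_subsets_of_size: "card (subsets_of_size p u) = p choose u"
  unfolding subsets_of_size_def using n_subsets[of "{..<p}" u] by simp

text \<open>Turns the sparse approximation set of size \<open>s\<close> into a competitor among the
  models of size \<open>u\<close>; enlarging the set can only shrink the residual.\<close>

lemma subsets_of_size_extend:
  assumes "S \<in> subsets_of_size p s" "s \<le> u" "u \<le> p"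
  obtains S' where "S' \<in> subsets_of_size p u" "S \<subseteq> S'"
proof -
  note S = subsets_of_sizeD[OF assms(1)]
  have "card ({..<p} - S) = p - s" using S by (simp add: card_Diff_subset)
  then have "u - s \<le> card ({..<p} - S)" using assms by simp
  then obtain T where "T \<subseteq> {..<p} - S" "card T = u - s" "finite T"
    by (rule obtain_subset_with_card_n)
  then have "S \<union> T \<in> subsets_of_size p u" using S assms card_Un_disjoint[of S T]
    by (auto simp: subsets_of_size_def)
  then show thesis by (rule that) auto
qed

lemma proj_ext_design:
  assumes "p \<notin> m"
  shows "proj n (ext_design p Z f) m v = proj n Z m v"
  by (rule proj_cong) (use assms in \<open>auto simp: ext_design_def\<close>)

lemma sqn_proj_le_energy:
  assumes "finite m" "p \<notin> m"
  shows "sqn n (proj n Z m \<xi>) \<le> energy n p Z f m \<xi>"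
  unfolding energy_def proj_ext_design[OF assms(2), of n Z f, symmetric]
  by (rule sqn_proj_mono) (use assms in auto)

text \<open>The extra column pays off here: the residual of \<open>f\<close> lies in the span of
  \<open>f\<close> and the columns in \<open>m\<close>, so \<open>\<xi>\<close> may be replaced by
  its projection before Cauchy--Schwarz.\<close>

lemma abs_inn_resid_le_energy:
  assumes "finite m" "p \<notin> m"
  shows "\<bar>inn n (resid n Z m f) \<xi>\<bar> \<le> sqrt (sqn n (resid n Z m f)) * sqrt (energy n p Z f m \<xi>)"
proof -
  let ?Z = "ext_design p Z f"
  have fin: "finite (insert p m)" using assms by simp
  have col: "(\<lambda>i. ?Z i p) = f" by (simp add: ext_design_def)
  have "in_span n ?Z (insert p m) (\<lambda>i. f i - proj n ?Z m f i)"
    using in_span_col[OF fin, of p n ?Z] in_span_mono[OF proj_in_span _ fin, of m n ?Z f]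
    by (intro in_span_diff) (auto simp: col)
  then have sp: "in_span n ?Z (insert p m) (resid n Z m f)"
    by (rule in_span_cong) (simp add: resid_def proj_ext_design[OF assms(2)])
  show ?thesis
    unfolding inn_proj_self[OF fin sp, of \<xi>, symmetric] energy_def by (rule abs_inn_le)
qed

text \<open>The projection is self-adjoint and idempotent, so it also acts on
  \<open>\<zeta>\<close>. The bound is pathwise and hence blind to any dependence between
  \<open>\<xi>\<close> and \<open>\<zeta>\<close>.\<close>

lemma abs_inn_proj_le_energy:
  assumes "finite m" "p \<notin> m"
  shows "\<bar>inn n (proj n Z m \<xi>) \<zeta>\<bar> \<le> sqrt (energy n p Z f m \<xi>) * sqrt (energy n p Z f m \<zeta>)"
proof -
  have "inn n (proj n Z m \<xi>) \<zeta> = inn n (proj n Z m \<xi>) (proj n Z m \<zeta>)"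
    using inn_proj_self[OF assms(1) proj_in_span] by simp
  also have "\<bar>\<dots>\<bar> \<le> sqrt (sqn n (proj n Z m \<xi>)) * sqrt (sqn n (proj n Z m \<zeta>))" by (rule abs_inn_le)
  also have "\<dots> \<le> sqrt (energy n p Z f m \<xi>) * sqrt (energy n p Z f m \<zeta>)"
    by (intro mult_mono real_sqrt_le_mono sqn_proj_le_energy assms) auto
  finally show ?thesis .
qed

text \<open>Solving the weight formula for \<open>R m\<close> writes the weighted mean of
  \<open>R\<close> as \<open>\<alpha>\<close> times the entropy of \<open>w\<close> minus
  \<open>\<alpha> * ln D\<close>. The entropy is at most that of the uniform law, and
  \<open>D\<close> is at least its summand at \<open>S\<close>.\<close>

lemma exp_weights_gibbs:
  fixes R :: "'i \<Rightarrow> real"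
  assumes fin: "finite I" and S: "S \<in> I" and a: "\<alpha> > 0"
  defines "w \<equiv> \<lambda>m. exp (- R m / \<alpha>) / (\<Sum>k\<in>I. exp (- R k / \<alpha>))"
  shows "(\<Sum>m\<in>I. w m * R m) \<le> R S + \<alpha> * ln (card I)"
proof -
  define D where "D = (\<Sum>k\<in>I. exp (- R k / \<alpha>))"
  have cI: "card I > 0" using fin S by (auto simp: card_gt_0_iff)
  have DS: "exp (- R S / \<alpha>) \<le> D" unfolding D_def by (rule member_le_sum[OF S]) (auto simp: fin)
  then have D0: "D > 0" by (smt (verit) exp_gt_zero)
  have wD: "w m = exp (- R m / \<alpha>) / D" for m by (simp only: w_def D_def)
  have w0: "w m > 0" for m using D0 by (simp add: wD)
  have wsum: "(\<Sum>m\<in>I. w m) = 1" using D0 unfolding wD sum_divide_distrib[symmetric] D_def[symmetric] by simp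
  have R: "R m = - \<alpha> * ln (w m) - \<alpha> * ln D" for m
    using D0 a by (simp add: wD ln_div field_simps)
  \<comment> \<open>The tangent bound \<open>ln x \<le> x - 1\<close> at
    \<open>x = 1 / (w m * card I)\<close>; summed over \<open>m\<close> it says that the divergence
    from the uniform law is nonnegative.\<close>
  have "- ln (w m) * w m \<le> w m * ln (card I) + 1 / card I - w m" for m
  proof -
    have "ln (1 / (w m * card I)) \<le> 1 / (w m * card I) - 1"
      using w0[of m] cI by (intro ln_le_minus_one) auto
    then have "- ln (w m) - ln (card I) \<le> 1 / (w m * card I) - 1"
      using w0[of m] cI by (simp add: ln_div ln_mult)
    from mult_left_mono[OF this less_imp_le[OF w0[of m]]]
    have "w m * (- ln (w m) - ln (card I)) \<le> w m * (1 / (w m * card I) - 1)" .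
    also have "\<dots> = 1 / card I - w m" using w0[of m] by (simp add: right_diff_distrib)
    finally show ?thesis by (simp add: algebra_simps)
  qed
  then have "(\<Sum>m\<in>I. - ln (w m) * w m) \<le> (\<Sum>m\<in>I. w m * ln (card I) + 1 / card I - w m)"
    by (intro sum_mono)
  also have "\<dots> = ln (card I)"
    using cI wsum by (simp add: sum.distrib sum_subtractf sum_distrib_right[symmetric])
  finally have ent: "(\<Sum>m\<in>I. - ln (w m) * w m) \<le> ln (card I)" .
  have "- R S / \<alpha> \<le> ln D" using DS D0 by (simp add: ln_ge_iff)
  then have lnD: "- \<alpha> * ln D \<le> R S" using a by (simp add: field_simps)
  have "(\<Sum>m\<in>I. w m * R m) = (\<Sum>m\<in>I. \<alpha> * (- ln (w m) * w m) + (- \<alpha> * ln D) * w m)"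
    by (intro sum.cong refl, subst R) (simp add: algebra_simps)
  also have "\<dots> = \<alpha> * (\<Sum>m\<in>I. - ln (w m) * w m) + (- \<alpha> * ln D) * (\<Sum>m\<in>I. w m)"
    by (simp only: sum.distrib sum_distrib_left)
  also have "\<dots> \<le> \<alpha> * ln (card I) + R S"
    using ent lnD a wsum by (intro add_mono mult_left_mono) auto
  finally show ?thesis by simp
qed

text \<open>AM-GM with a free parameter. The value \<open>c = 1/2\<close> will allow half of the
  weighted error to be absorbed on the left; \<open>c = 1\<close> serves the second noise
  vector.\<close>

lemma sum_weighted_sqrt_le:
  fixes w a :: "'i \<Rightarrow> real"
  assumes "finite I" "\<And>m. m \<in> I \<Longrightarrow> 0 \<le> w m" "(\<Sum>m\<in>I. w m) = 1" "\<And>m. m \<in> I \<Longrightarrow> 0 \<le> a m" "0 \<le> E" "c > 0"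
  shows "(\<Sum>m\<in>I. w m * (sqrt (a m) * sqrt E)) \<le> ((\<Sum>m\<in>I. w m * a m) * c + E / c) / 2"
proof -
  have "sqrt (a m) * sqrt E \<le> (a m * c + E / c) / 2" if "m \<in> I" for m
  proof -
    have "0 \<le> (sqrt (a m) * sqrt c - sqrt E / sqrt c)\<^sup>2" by simp
    also have "\<dots> = a m * c + E / c - 2 * (sqrt (a m) * sqrt E)"
      using \<open>c > 0\<close> assms(4)[OF that] assms(5) by (simp add: power2_diff power_mult_distrib power_divide)
    finally show ?thesis by simp
  qed
  then have "(\<Sum>m\<in>I. w m * (sqrt (a m) * sqrt E)) \<le> (\<Sum>m\<in>I. w m * ((a m * c + E / c) / 2))"
    using assms by (intro sum_mono mult_left_mono) auto
  also have "\<dots> = (\<Sum>m\<in>I. (w m * a m) * (c / 2) + w m * (E / c / 2))"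
    by (intro sum.cong refl) (simp add: field_simps)
  also have "\<dots> = (\<Sum>m\<in>I. w m * a m) * (c / 2) + (\<Sum>m\<in>I. w m) * (E / c / 2)"
    by (simp only: sum.distrib sum_distrib_right)
  finally show ?thesis using assms(3) by (simp add: field_simps)
qed

text \<open>Jensen's inequality in each coordinate, from Cauchy--Schwarz with each weight split into
  two square roots.\<close>

lemma sqn_weighted_sum_le:
  assumes "finite I" "\<And>m. m \<in> I \<Longrightarrow> 0 \<le> w m" "(\<Sum>m\<in>I. w m) = 1"
  shows "sqn n (\<lambda>i. \<Sum>m\<in>I. w m * g m i) \<le> (\<Sum>m\<in>I. w m * sqn n (g m))"
proof -
  have "(\<Sum>m\<in>I. w m * g m i)\<^sup>2 \<le> (\<Sum>m\<in>I. w m * (g m i)\<^sup>2)" for i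
  proof -
    have "(\<Sum>m\<in>I. w m * g m i)\<^sup>2 = (\<Sum>m\<in>I. sqrt (w m) * (sqrt (w m) * g m i))\<^sup>2"
      using assms by (intro arg_cong[where f="\<lambda>x. x\<^sup>2"] sum.cong) (auto simp flip: mult.assoc)
    also have "\<dots> \<le> (\<Sum>m\<in>I. (sqrt (w m))\<^sup>2) * (\<Sum>m\<in>I. (sqrt (w m) * g m i)\<^sup>2)"
      by (rule Cauchy_Schwarz_ineq_sum)
    also have "\<dots> = (\<Sum>m\<in>I. w m * (g m i)\<^sup>2)" using assms by (simp add: power_mult_distrib)
    finally show ?thesis .
  qed
  then have "sqn n (\<lambda>i. \<Sum>m\<in>I. w m * g m i) \<le> (\<Sum>i<n. \<Sum>m\<in>I. w m * (g m i)\<^sup>2)"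
    unfolding sqn_def by (intro sum_mono)
  also have "\<dots> = (\<Sum>m\<in>I. w m * sqn n (g m))"
    by (subst sum.swap) (simp add: sqn_def sum_distrib_left)
  finally show ?thesis .
qed

text \<open>Everything is expressed through the weighted approximation error \<open>A\<close>. Gibbs
  and absorption give \<open>A \<le> 4 B + 8 E + 2 \<alpha> L\<close>, where \<open>B\<close> is the
  squared residual of \<open>f\<close> on \<open>S\<close> and \<open>L = ln (p choose u)\<close>.
  The first bound is then \<open>2 E + 2 A\<close>; the second comes from
  \<open>(A + E') / 2 + (E + E') / 2\<close>, with \<open>9/2\<close> rounded up to 5.\<close>

lemma fhat_error:
  assumes V: "\<And>i. i < n \<Longrightarrow> V i = f i + \<xi> i"
    and S: "S \<in> subsets_of_size p s" "s \<le> u" "u \<le> p" and a: "\<alpha> > 0"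
    and E: "\<And>m. m \<in> subsets_of_size p u \<Longrightarrow> energy n p Z f m \<xi> \<le> E"
    and E': "\<And>m. m \<in> subsets_of_size p u \<Longrightarrow> energy n p Z f m \<zeta> \<le> E'"
  shows "sqn n (\<lambda>i. fhat n p Z V u \<alpha> i - f i) \<le> 8 * sqn n (resid n Z S f) + 18 * E + 4 * \<alpha> * ln (p choose u)"
    and "\<bar>inn n (\<lambda>i. fhat n p Z V u \<alpha> i - f i) \<zeta>\<bar> \<le> 2 * sqn n (resid n Z S f) + 5 * E + E' + \<alpha> * ln (p choose u)"
proof -
  let ?I = "subsets_of_size p u"
  obtain S' where S': "S' \<in> ?I" "S \<subseteq> S'" using subsets_of_size_extend[OF S] .
  define w where "w = ew_weight n p Z V u \<alpha>"
  define R where "R m = sqn n (resid n Z m V)" for m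
  define a where "a m = sqn n (resid n Z m f)" for m
  define A where "A = (\<Sum>m\<in>?I. w m * a m)"
  have fin: "finite ?I" by simp
  note mD = subsets_of_sizeD
  have w_eq: "w m = exp (- R m / \<alpha>) / (\<Sum>k\<in>?I. exp (- R k / \<alpha>))" for m
    by (simp add: w_def ew_weight_def R_def)
  have w0: "0 \<le> w m" for m unfolding w_eq by (simp add: sum_nonneg)
  have "(\<Sum>k\<in>?I. exp (- R k / \<alpha>)) > 0" using S' by (intro sum_pos) auto
  then have w1: "(\<Sum>m\<in>?I. w m) = 1" unfolding w_eq by (simp add: sum_divide_distrib[symmetric])
  have E0: "0 \<le> E" "0 \<le> E'" using order_trans[OF energy_nonneg E[OF S'(1)]] order_trans[OF energy_nonneg E'[OF S'(1)]] by simp_all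
  have aS: "a S' \<le> sqn n (resid n Z S f)"
    unfolding a_def by (rule sqn_resid_mono[OF S'(2)]) (rule mD[OF S'(1)])
  have a0: "0 \<le> a m" for m by (simp add: a_def)
  \<comment> \<open>The term \<open>sqn n \<xi>\<close>, which is of order \<open>n\<close>, is the
    same for every model. As the weights sum to one, it cancels when the weighted mean is compared
    with the competitor \<open>S'\<close>, and only projected noise remains.\<close>
  have R_eq: "R m = a m + 2 * inn n (resid n Z m f) \<xi> + sqn n \<xi> - sqn n (proj n Z m \<xi>)" if "m \<in> ?I" for m
  proof -
    have "resid n Z m V = resid n Z m (\<lambda>i. f i + \<xi> i)" by (rule resid_cong) (auto simp: V)
    also have "\<dots> = (\<lambda>i. resid n Z m f i + resid n Z m \<xi> i)" using mD[OF that] by (intro resid_add)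
    finally have "R m = a m + 2 * inn n (resid n Z m f) (resid n Z m \<xi>) + sqn n (resid n Z m \<xi>)"
      by (simp add: R_def a_def sqn_add)
    moreover have "inn n (resid n Z m f) (resid n Z m \<xi>) = inn n (resid n Z m f) (\<lambda>i. \<xi> i - proj n Z m \<xi> i)"
      by (rule inn_cong) (auto simp: resid_def)
    moreover have "inn n (resid n Z m f) (proj n Z m \<xi>) = 0"
      by (rule resid_orth_span) (use mD[OF that] in \<open>auto intro: proj_in_span\<close>)
    ultimately show ?thesis using sqn_resid[OF mD(1)[OF that], of n Z \<xi>] by (simp add: inn_linear)
  qed
  have cross: "\<bar>inn n (resid n Z m f) \<xi>\<bar> \<le> sqrt (a m) * sqrt E"
    "\<bar>inn n (resid n Z m f) \<zeta>\<bar> \<le> sqrt (a m) * sqrt E'" if "m \<in> ?I" for m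
  proof -
    note b = abs_inn_resid_le_energy[OF mD(1)[OF that] mD(4)[OF that], of n Z f]
    show "\<bar>inn n (resid n Z m f) \<xi>\<bar> \<le> sqrt (a m) * sqrt E"
      by (rule order_trans[OF b]) (auto simp: a_def intro!: mult_left_mono E that)
    show "\<bar>inn n (resid n Z m f) \<zeta>\<bar> \<le> sqrt (a m) * sqrt E'"
      by (rule order_trans[OF b]) (auto simp: a_def intro!: mult_left_mono E' that)
  qed
  have pE: "sqn n (proj n Z m \<xi>) \<le> E" if "m \<in> ?I" for m
    using sqn_proj_le_energy[OF mD(1)[OF that] mD(4)[OF that]] E[OF that] by (rule order_trans)
  have lo: "a m - 2 * (sqrt (a m) * sqrt E) + sqn n \<xi> - E \<le> R m" if "m \<in> ?I" for m
    unfolding R_eq[OF that] using cross(1)[OF that] pE[OF that] by linarith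
  have amgm: "2 * (sqrt x * sqrt E) \<le> x + E" if "0 \<le> x" for x
    using sum_squares_bound[of "sqrt x" "sqrt E"] that E0 by simp
  have "A - 2 * (\<Sum>m\<in>?I. w m * (sqrt (a m) * sqrt E)) + (sqn n \<xi> - E) * (\<Sum>m\<in>?I. w m)
      = (\<Sum>m\<in>?I. w m * (a m - 2 * (sqrt (a m) * sqrt E) + sqn n \<xi> - E))"
    by (simp add: A_def sum_distrib_left sum_subtractf sum.distrib algebra_simps)
  also have "\<dots> \<le> (\<Sum>m\<in>?I. w m * R m)"
    by (intro sum_mono mult_left_mono lo w0)
  also have "\<dots> \<le> R S' + \<alpha> * ln (p choose u)"
    using exp_weights_gibbs[OF fin S'(1) \<open>\<alpha> > 0\<close>, of R] by (simp add: w_eq card_subsets_of_size)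
  also have "R S' \<le> a S' + 2 * (sqrt (a S') * sqrt E) + sqn n \<xi>"
    unfolding R_eq[OF S'(1)] using cross(1)[OF S'(1)] sqn_nonneg[of n "proj n Z S' \<xi>"] by linarith
  finally have "A \<le> 2 * (\<Sum>m\<in>?I. w m * (sqrt (a m) * sqrt E)) + (a S' + 2 * (sqrt (a S') * sqrt E)) + E + \<alpha> * ln (p choose u)"
    using w1 by simp
  \<comment> \<open>Twice this bound is \<open>A / 2 + 2 * E\<close>, so half of \<open>A\<close>
    moves to the left side.\<close>
  moreover have "(\<Sum>m\<in>?I. w m * (sqrt (a m) * sqrt E)) \<le> (A * (1/2) + E / (1/2)) / 2"
    unfolding A_def by (rule sum_weighted_sqrt_le) (auto simp: w0 w1 a0 E0)
  ultimately have A_le: "A \<le> 4 * sqn n (resid n Z S f) + 8 * E + 2 * \<alpha> * ln (p choose u)"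
    using amgm[OF a0[of S']] aS by simp
  have err: "fhat n p Z V u \<alpha> i - f i = (\<Sum>m\<in>?I. w m * (proj n Z m \<xi> i - resid n Z m f i))" if "i < n" for i
  proof -
    have "proj n Z m V i - f i = proj n Z m \<xi> i - resid n Z m f i" if "m \<in> ?I" for m
    proof -
      have "proj n Z m V = proj n Z m (\<lambda>i. f i + \<xi> i)" by (rule proj_cong) (auto simp: V)
      then show ?thesis using proj_add[OF mD(1)[OF that], of n Z f \<xi>] \<open>i < n\<close> by (simp add: resid_def)
    qed
    then have "(\<Sum>m\<in>?I. w m * (proj n Z m \<xi> i - resid n Z m f i)) = (\<Sum>m\<in>?I. w m * (proj n Z m V i - f i))"
      by simp
    also have "\<dots> = fhat n p Z V u \<alpha> i - (\<Sum>m\<in>?I. w m) * f i"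
      by (simp add: fhat_def w_def right_diff_distrib sum_subtractf sum_distrib_right)
    finally show ?thesis using w1 by simp
  qed
  have "sqn n (\<lambda>i. fhat n p Z V u \<alpha> i - f i) = sqn n (\<lambda>i. \<Sum>m\<in>?I. w m * (proj n Z m \<xi> i - resid n Z m f i))"
    by (rule sqn_cong) (rule err)
  also have "\<dots> \<le> (\<Sum>m\<in>?I. w m * sqn n (\<lambda>i. proj n Z m \<xi> i - resid n Z m f i))"
    by (rule sqn_weighted_sum_le) (auto simp: w0 w1)
  also have "\<dots> \<le> (\<Sum>m\<in>?I. w m * (2 * E + 2 * a m))"
  proof (intro sum_mono mult_left_mono w0)
    fix m assume "m \<in> ?I"
    have "sqn n (\<lambda>i. proj n Z m \<xi> i - resid n Z m f i) \<le> 2 * sqn n (proj n Z m \<xi>) + 2 * a m"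
      using sqn_add_le[of n "proj n Z m \<xi>" "\<lambda>i. -1 * resid n Z m f i"] unfolding sqn_scale a_def by simp
    then show "sqn n (\<lambda>i. proj n Z m \<xi> i - resid n Z m f i) \<le> 2 * E + 2 * a m"
      using pE[OF \<open>m \<in> ?I\<close>] by linarith
  qed
  also have "\<dots> = (\<Sum>m\<in>?I. w m) * (2 * E) + 2 * A"
    by (simp add: A_def sum_distrib_left sum_distrib_right distrib_left sum.distrib mult.assoc mult.left_commute)
  finally show "sqn n (\<lambda>i. fhat n p Z V u \<alpha> i - f i) \<le> 8 * sqn n (resid n Z S f) + 18 * E + 4 * \<alpha> * ln (p choose u)"
    using A_le w1 by simp
  have "inn n (\<lambda>i. fhat n p Z V u \<alpha> i - f i) \<zeta> = inn n (\<lambda>i. \<Sum>m\<in>?I. w m * (proj n Z m \<xi> i - resid n Z m f i)) \<zeta>"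
    by (rule inn_cong) (auto simp: err)
  also have "\<dots> = (\<Sum>m\<in>?I. w m * (inn n (proj n Z m \<xi>) \<zeta> - inn n (resid n Z m f) \<zeta>))"
    by (simp only: inn_linear)
  finally have inn_eq: "inn n (\<lambda>i. fhat n p Z V u \<alpha> i - f i) \<zeta> = (\<Sum>m\<in>?I. w m * (inn n (proj n Z m \<xi>) \<zeta> - inn n (resid n Z m f) \<zeta>))" .
  have "\<bar>inn n (\<lambda>i. fhat n p Z V u \<alpha> i - f i) \<zeta>\<bar> \<le> (\<Sum>m\<in>?I. \<bar>w m * (inn n (proj n Z m \<xi>) \<zeta> - inn n (resid n Z m f) \<zeta>)\<bar>)"
    unfolding inn_eq by (rule sum_abs)
  also have "\<dots> \<le> (\<Sum>m\<in>?I. w m * (sqrt (a m) * sqrt E') + w m * ((E + E') / 2))"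
  proof (rule sum_mono)
    fix m assume m: "m \<in> ?I"
    have "\<bar>inn n (proj n Z m \<xi>) \<zeta>\<bar> \<le> sqrt (energy n p Z f m \<xi>) * sqrt (energy n p Z f m \<zeta>)"
      by (rule abs_inn_proj_le_energy) (use mD[OF m] in auto)
    also have "\<dots> \<le> (energy n p Z f m \<xi> + energy n p Z f m \<zeta>) / 2"
      using sum_squares_bound[of "sqrt (energy n p Z f m \<xi>)" "sqrt (energy n p Z f m \<zeta>)"] by simp
    also have "\<dots> \<le> (E + E') / 2" using E[OF m] E'[OF m] by simp
    finally have "\<bar>inn n (proj n Z m \<xi>) \<zeta> - inn n (resid n Z m f) \<zeta>\<bar> \<le> sqrt (a m) * sqrt E' + (E + E') / 2"
      using cross(2)[OF m] by linarith
    from mult_left_mono[OF this w0[of m]]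
    show "\<bar>w m * (inn n (proj n Z m \<xi>) \<zeta> - inn n (resid n Z m f) \<zeta>)\<bar> \<le> w m * (sqrt (a m) * sqrt E') + w m * ((E + E') / 2)"
      using w0[of m] by (simp add: abs_mult distrib_left)
  qed
  also have "\<dots> = (\<Sum>m\<in>?I. w m * (sqrt (a m) * sqrt E')) + (\<Sum>m\<in>?I. w m) * ((E + E') / 2)"
    by (simp only: sum.distrib sum_distrib_right)
  finally have inn_le: "\<bar>inn n (\<lambda>i. fhat n p Z V u \<alpha> i - f i) \<zeta>\<bar> \<le> \<dots>" .
  have "(\<Sum>m\<in>?I. w m * (sqrt (a m) * sqrt E')) \<le> (A * 1 + E' / 1) / 2"
    unfolding A_def by (rule sum_weighted_sqrt_le) (auto simp: w0 w1 a0 E0)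
  with inn_le show "\<bar>inn n (\<lambda>i. fhat n p Z V u \<alpha> i - f i) \<zeta>\<bar> \<le> 2 * sqn n (resid n Z S f) + 5 * E + E' + \<alpha> * ln (p choose u)"
    using A_le w1 E0 by (simp add: field_simps)
qed

text \<open>Reduces the energy of the noise of \<open>Y\<close> to energies of single columns of
  \<open>H\<close>; the factor \<open>card J\<close> is the Cauchy--Schwarz cost of squaring a
  sum.\<close>

lemma energy_sum_le:
  assumes "finite m" "finite J"
  shows "energy n p Z f m (\<lambda>i. \<Sum>j\<in>J. b j * g j i) \<le> real (card J) * (\<Sum>j\<in>J. (b j)\<^sup>2 * energy n p Z f m (g j))"
proof -
  let ?P = "proj n (ext_design p Z f) (insert p m)"
  have "?P (\<lambda>i. \<Sum>j\<in>J. b j * g j i) = (\<lambda>i. \<Sum>j\<in>J. b j * ?P (g j) i)"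
    using assms(2)
  proof (induction J rule: finite_induct)
    case empty
    show ?case using proj_scale[of "insert p m" n "ext_design p Z f" 0] assms by simp
  next
    case (insert x F)
    then show ?case using proj_linear[of "insert p m" n "ext_design p Z f" "b x" "g x" 1] assms by simp
  qed
  then have "energy n p Z f m (\<lambda>i. \<Sum>j\<in>J. b j * g j i) = (\<Sum>i<n. (\<Sum>j\<in>J. b j * ?P (g j) i)\<^sup>2)"
    by (simp add: energy_def sqn_def)
  also have "\<dots> \<le> (\<Sum>i<n. real (card J) * (\<Sum>j\<in>J. (b j * ?P (g j) i)\<^sup>2))"
    by (intro sum_mono, subst mult.commute, rule sum_squared_le_sum_of_squares)
  also have "\<dots> = real (card J) * (\<Sum>j\<in>J. (b j)\<^sup>2 * energy n p Z f m (g j))"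
    by (simp add: energy_def sqn_def sum_distrib_left power_mult_distrib) (rule sum.swap)
  finally show ?thesis .
qed

lemma energy_add_le:
  assumes "finite m"
  shows "energy n p Z f m (\<lambda>i. a i + b i) \<le> 2 * energy n p Z f m a + 2 * energy n p Z f m b"
  unfolding energy_def using assms by (simp add: proj_add sqn_add_le)

lemma measurable_energy:
  assumes "m \<in> subsets_of_size p u"
    and "\<And>i k. i < n \<Longrightarrow> k < p \<Longrightarrow> (\<lambda>\<omega>. Z \<omega> i k) \<in> borel_measurable M"
    and "\<And>i. i < n \<Longrightarrow> (\<lambda>\<omega>. f \<omega> i) \<in> borel_measurable M"
    and "\<And>i. i < n \<Longrightarrow> (\<lambda>\<omega>. \<xi> \<omega> i) \<in> borel_measurable M"
  shows "(\<lambda>\<omega>. energy n p (Z \<omega>) (f \<omega>) m (\<xi> \<omega>)) \<in> borel_measurable M"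
proof -
  have "(\<lambda>\<omega>. ext_design p (Z \<omega>) (f \<omega>) i k) \<in> borel_measurable M" if "i < n" "k \<in> insert p m" for i k
    using that assms subsets_of_sizeD[OF assms(1)] by (cases "k = p") (auto simp: ext_design_def)
  then show ?thesis unfolding energy_def
    by (intro measurable_sqn measurable_proj) (use subsets_of_sizeD[OF assms(1)] assms in auto)
qed

subsection \<open>Exponential moments of projected sub-Gaussian noise\<close>

text \<open>Completing the square: the exponential tilt shifts the mean to \<open>c\<close>.\<close>

lemma nn_integral_std_normal_exp:
  "(\<integral>\<^sup>+g. ennreal (exp (c * g)) \<partial>std_normal_distribution) = ennreal (exp (c\<^sup>2 / 2))"
proof -
  have eq: "std_normal_density g * exp (c * g) = exp (c\<^sup>2 / 2) * normal_density c 1 g" for g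
  proof -
    have "- g\<^sup>2 / 2 + c * g = c\<^sup>2 / 2 + (- (g - c)\<^sup>2 / (2 * 1\<^sup>2))" by (simp add: power2_eq_square field_simps)
    then show ?thesis by (simp add: normal_density_def mult_exp_exp)
  qed
  have "(\<integral>\<^sup>+g. ennreal (exp (c * g)) \<partial>std_normal_distribution) = (\<integral>\<^sup>+g. ennreal (std_normal_density g * exp (c * g)) \<partial>lborel)"
    by (subst nn_integral_density) (auto simp: ennreal_mult')
  also have "\<dots> = ennreal (exp (c\<^sup>2 / 2)) * (\<integral>\<^sup>+g. ennreal (normal_density c 1 g) \<partial>lborel)"
    unfolding eq by (subst nn_integral_cmult[symmetric]) (auto simp: ennreal_mult')
  also have "(\<integral>\<^sup>+g. ennreal (normal_density c 1 g) \<partial>lborel) = 1"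
    using prob_space.emeasure_space_1[OF prob_space_normal_density[of 1 c]] by (simp add: emeasure_density)
  finally show ?thesis by simp
qed

text \<open>The tilted density is \<open>sqrt 2\<close> times the normal density of variance
  2.\<close>

lemma nn_integral_std_normal_exp_square:
  "(\<integral>\<^sup>+g. ennreal (exp (g\<^sup>2 / 4)) \<partial>std_normal_distribution) = ennreal (sqrt 2)"
proof -
  have eq: "std_normal_density g * exp (g\<^sup>2 / 4) = sqrt 2 * normal_density 0 (sqrt 2) g" for g
  proof -
    have "- g\<^sup>2 / 2 + g\<^sup>2 / 4 = - (g - 0)\<^sup>2 / (2 * (sqrt 2)\<^sup>2)" by simp
    then show ?thesis by (simp add: normal_density_def mult_exp_exp real_sqrt_mult real_div_sqrt field_simps flip: power2_eq_square)
  qed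
  have "(\<integral>\<^sup>+g. ennreal (exp (g\<^sup>2 / 4)) \<partial>std_normal_distribution) = (\<integral>\<^sup>+g. ennreal (std_normal_density g * exp (g\<^sup>2 / 4)) \<partial>lborel)"
    by (subst nn_integral_density) (auto simp: ennreal_mult')
  also have "\<dots> = ennreal (sqrt 2) * (\<integral>\<^sup>+g. ennreal (normal_density 0 (sqrt 2) g) \<partial>lborel)"
    unfolding eq by (subst nn_integral_cmult[symmetric]) (auto simp: ennreal_mult')
  also have "(\<integral>\<^sup>+g. ennreal (normal_density 0 (sqrt 2) g) \<partial>lborel) = 1"
    using prob_space.emeasure_space_1[OF prob_space_normal_density[of "sqrt 2" 0]] by (simp add: emeasure_density)
  finally show ?thesis by simp
qed

text \<open>Each Gram--Schmidt direction is linearised by an independent standard Gaussian,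
  \<open>exp (\<kappa> x\<^sup>2) = E exp (sqrt (2 \<kappa>) x g)\<close>; the free vector \<open>b\<close> carries the directions already linearised.\<close>
lemma exp_moment_sqn_proj:
  assumes M: "prob_space M" and meas: "\<And>i. i < n \<Longrightarrow> (\<lambda>\<omega>. \<xi> \<omega> i) \<in> borel_measurable M"
    and sub: "\<And>l. (\<integral>\<^sup>+\<omega>. ennreal (exp (inn n l (\<xi> \<omega>))) \<partial>M) \<le> ennreal (exp (K\<^sup>2 * sqn n l / 2))"
    and lam: "\<kappa> \<ge> 0" "\<kappa> * K\<^sup>2 = 1 / 4"
    and m: "finite m" and b: "\<And>k. k \<in> m \<Longrightarrow> inn n b (\<lambda>i. Z i k) = 0"
  shows "(\<integral>\<^sup>+\<omega>. ennreal (exp (\<kappa> * sqn n (proj n Z m (\<xi> \<omega>)) + inn n b (\<xi> \<omega>))) \<partial>M)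
    \<le> ennreal (sqrt 2 ^ card m * exp (K\<^sup>2 * sqn n b / 2))"
  using m b
proof (induction m arbitrary: b rule: finite_induct)
  case empty
  have "sqn n (proj n Z {} v) = 0" for v by (simp add: sqn_def proj_empty)
  then show ?case using sub[of b] by simp
next
  case (insert x m)
  let ?G = std_normal_distribution
  interpret M: prob_space M by fact
  interpret G: prob_space ?G by (simp add: prob_space_normal_density)
  interpret MG: pair_sigma_finite M ?G ..
  define r where "r = resid n Z m (\<lambda>i. Z i x)"
  \<comment> \<open>The unit vector along \<open>r\<close>, or a vector that vanishes on
    \<open>{..<n}\<close> if \<open>r\<close> does; hence only \<open>sqn n \<rho> \<le> 1\<close>
    is claimed.\<close>
  define \<rho> where "\<rho> = (\<lambda>i. 1 / sqrt (sqn n r) * r i)"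
  have ro: "inn n r w = 0" if "in_span n Z m w" for w
    unfolding r_def using that insert.hyps by (intro resid_orth_span)
  have br: "inn n b r = 0"
  proof -
    have "inn n b r = inn n b (\<lambda>i. Z i x - proj n Z m (\<lambda>i. Z i x) i)"
      by (rule inn_cong) (auto simp: r_def resid_def)
    also have "\<dots> = 0" using insert.prems in_span_orth[OF proj_in_span[of n Z m "\<lambda>i. Z i x"], of b] by (simp add: inn_linear)
    finally show ?thesis .
  qed
  have b\<rho>: "inn n b \<rho> = 0" unfolding \<rho>_def inn_linear br by simp
  have \<rho>le: "sqn n \<rho> \<le> 1" unfolding \<rho>_def sqn_scale by (cases "sqn n r = 0") (auto simp: power_divide)
  have \<rho>inn: "(inn n v r)\<^sup>2 / sqn n r = (inn n v \<rho>)\<^sup>2" for v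
    unfolding \<rho>_def inn_linear by (simp add: power_mult_distrib power_divide)
  have \<rho>o: "inn n \<rho> (\<lambda>i. Z i k) = 0" if "k \<in> m" for k
    unfolding \<rho>_def inn_linear using ro[OF in_span_col[OF insert.hyps(1) that]] by simp
  \<comment> \<open>Chosen so that the Gaussian average of \<open>exp (s * x * g)\<close> is
    \<open>exp (\<kappa> * x\<^sup>2)\<close>.\<close>
  define s where "s = sqrt (2 * \<kappa>)"
  define F where "F \<omega> g = exp (\<kappa> * sqn n (proj n Z m (\<xi> \<omega>)) + inn n (\<lambda>i. b i + (s * g) * \<rho> i) (\<xi> \<omega>))" for \<omega> g
  have Fm: "(\<lambda>(\<omega>, g). ennreal (F \<omega> g)) \<in> borel_measurable (M \<Otimes>\<^sub>M ?G)"
  proof -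
    have [measurable]: "(\<lambda>\<omega>. sqn n (proj n Z m (\<xi> \<omega>))) \<in> borel_measurable M" "(\<lambda>\<omega>. inn n b (\<xi> \<omega>)) \<in> borel_measurable M"
      "(\<lambda>\<omega>. inn n \<rho> (\<xi> \<omega>)) \<in> borel_measurable M"
      using insert.hyps meas by (auto intro!: measurable_sqn measurable_proj measurable_inn)
    have "(\<lambda>g::real. g) \<in> borel_measurable ?G" by simp
    then have [measurable]: "snd \<in> borel_measurable (M \<Otimes>\<^sub>M ?G)"
      using measurable_compose[OF measurable_snd] by (auto simp: comp_def)
    have "(\<lambda>z. \<kappa> * sqn n (proj n Z m (\<xi> (fst z))) + (inn n b (\<xi> (fst z)) + (s * snd z) * inn n \<rho> (\<xi> (fst z)))) \<in> borel_measurable (M \<Otimes>\<^sub>M ?G)"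
      by measurable
    then show ?thesis unfolding F_def inn_linear case_prod_unfold
      by (intro measurable_compose[OF _ measurable_ennreal] measurable_compose[OF _ borel_measurable_exp])
  qed
  have "(\<integral>\<^sup>+\<omega>. ennreal (exp (\<kappa> * sqn n (proj n Z (insert x m) (\<xi> \<omega>)) + inn n b (\<xi> \<omega>))) \<partial>M)
     = (\<integral>\<^sup>+\<omega>. (\<integral>\<^sup>+g. ennreal (F \<omega> g) \<partial>?G) \<partial>M)"
  proof (rule nn_integral_cong)
    fix \<omega>
    have "F \<omega> g = exp (\<kappa> * sqn n (proj n Z m (\<xi> \<omega>)) + inn n b (\<xi> \<omega>)) * exp ((s * inn n \<rho> (\<xi> \<omega>)) * g)" for g
      by (simp add: F_def inn_linear exp_add[symmetric] algebra_simps)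
    then have "(\<integral>\<^sup>+g. ennreal (F \<omega> g) \<partial>?G) = ennreal (exp (\<kappa> * sqn n (proj n Z m (\<xi> \<omega>)) + inn n b (\<xi> \<omega>))) *
        ennreal (exp ((s * inn n \<rho> (\<xi> \<omega>))\<^sup>2 / 2))"
      by (simp add: ennreal_mult' nn_integral_cmult nn_integral_std_normal_exp)
    also have "(s * inn n \<rho> (\<xi> \<omega>))\<^sup>2 / 2 = \<kappa> * ((inn n (\<xi> \<omega>) r)\<^sup>2 / sqn n r)"
      unfolding \<rho>inn inn_commute[of n \<rho>] using lam by (simp add: s_def power_mult_distrib)
    finally show "ennreal (exp (\<kappa> * sqn n (proj n Z (insert x m) (\<xi> \<omega>)) + inn n b (\<xi> \<omega>))) = (\<integral>\<^sup>+g. ennreal (F \<omega> g) \<partial>?G)"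
      unfolding sqn_proj_insert[OF insert.hyps(1)] r_def[symmetric]
      by (simp add: ennreal_mult'[symmetric] exp_add[symmetric] distrib_left add_ac)
  qed
  \<comment> \<open>After the exchange \<open>g\<close> is fixed, and the inner integral is an
    instance of the induction hypothesis: \<open>b\<close> shifted along \<open>\<rho>\<close> is
    still orthogonal to the columns in \<open>m\<close>.\<close>
  also have "\<dots> = (\<integral>\<^sup>+g. (\<integral>\<^sup>+\<omega>. ennreal (F \<omega> g) \<partial>M) \<partial>?G)"
    using MG.Fubini'[OF Fm] by simp
  also have "\<dots> \<le> (\<integral>\<^sup>+g. ennreal (sqrt 2 ^ card m * exp (K\<^sup>2 * sqn n b / 2)) * ennreal (exp (g\<^sup>2 / 4)) \<partial>?G)"
  proof (rule nn_integral_mono)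
    fix g
    let ?b = "\<lambda>i. b i + (s * g) * \<rho> i"
    have le1: "(\<integral>\<^sup>+\<omega>. ennreal (F \<omega> g) \<partial>M) \<le> ennreal (sqrt 2 ^ card m * exp (K\<^sup>2 * sqn n ?b / 2))"
      unfolding F_def
    proof (rule insert.IH)
      fix k assume "k \<in> m"
      then show "inn n ?b (\<lambda>i. Z i k) = 0" unfolding inn_linear using insert.prems[of k] \<rho>o[of k] by simp
    qed
    \<comment> \<open>Orthogonality of \<open>b\<close> and \<open>\<rho>\<close> makes squared
      norms add, and \<open>\<kappa> * K\<^sup>2 = 1 / 4\<close> turns the increment into at most
      \<open>g\<^sup>2 / 4\<close>.\<close>
    have le2: "K\<^sup>2 * sqn n ?b / 2 \<le> K\<^sup>2 * sqn n b / 2 + g\<^sup>2 / 4"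
    proof -
      have "sqn n ?b = sqn n b + (s * g)\<^sup>2 * sqn n \<rho>" unfolding sqn_add sqn_scale inn_scale_right b\<rho> by simp
      also have "(s * g)\<^sup>2 = 2 * \<kappa> * g\<^sup>2" using lam by (simp add: s_def power_mult_distrib)
      also have "2 * \<kappa> * g\<^sup>2 * sqn n \<rho> \<le> 2 * \<kappa> * g\<^sup>2 * 1" using lam \<rho>le by (intro mult_left_mono) auto
      finally have "K\<^sup>2 * sqn n ?b \<le> K\<^sup>2 * (sqn n b + 2 * \<kappa> * g\<^sup>2 * 1)" by (intro mult_left_mono) auto
      also have "\<dots> = K\<^sup>2 * sqn n b + 2 * (\<kappa> * K\<^sup>2) * g\<^sup>2" by (simp add: algebra_simps)
      finally show ?thesis unfolding lam(2) by simp
    qed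
    have "sqrt 2 ^ card m * exp (K\<^sup>2 * sqn n ?b / 2) \<le> sqrt 2 ^ card m * (exp (K\<^sup>2 * sqn n b / 2) * exp (g\<^sup>2 / 4))"
      unfolding exp_add[symmetric] using le2 by (intro mult_left_mono) auto
    from order_trans[OF le1 ennreal_leI[OF this]]
    show "(\<integral>\<^sup>+\<omega>. ennreal (F \<omega> g) \<partial>M) \<le> ennreal (sqrt 2 ^ card m * exp (K\<^sup>2 * sqn n b / 2)) * ennreal (exp (g\<^sup>2 / 4))"
      by (simp add: ennreal_mult'[symmetric] mult.assoc)
  qed
  also have "\<dots> = ennreal (sqrt 2 ^ card m * exp (K\<^sup>2 * sqn n b / 2)) * ennreal (sqrt 2)"
    by (subst nn_integral_cmult) (auto simp: nn_integral_std_normal_exp_square)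
  also have "\<dots> = ennreal (sqrt 2 ^ card (insert x m) * exp (K\<^sup>2 * sqn n b / 2))"
    using insert.hyps by (simp add: ennreal_mult'[symmetric] ac_simps)
  finally show ?case .
qed

lemma subgaussian_nn_integral:
  assumes "subgaussian M \<xi> K"
  shows "(\<integral>\<^sup>+\<omega>. ennreal (exp (l * \<xi> \<omega>)) \<partial>M) \<le> ennreal (exp (K\<^sup>2 * l\<^sup>2 / 2))"
proof -
  have "integrable M (\<lambda>\<omega>. exp (l * \<xi> \<omega>))" "(\<integral>\<omega>. exp (l * \<xi> \<omega>) \<partial>M) \<le> exp (K\<^sup>2 * l\<^sup>2 / 2)"
    using assms by (auto simp: subgaussian_def)
  then show ?thesis by (subst nn_integral_eq_integral) (auto intro: ennreal_leI)
qed

lemma indep_subgaussian_nn_integral: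
  assumes M: "prob_space M" and ind: "prob_space.indep_vars M (\<lambda>_. borel) (\<lambda>i \<omega>. \<xi> \<omega> i) {..<n}"
    and sub: "\<And>i. i < n \<Longrightarrow> subgaussian M (\<lambda>\<omega>. \<xi> \<omega> i) K"
  shows "(\<integral>\<^sup>+\<omega>. ennreal (exp (inn n l (\<xi> \<omega>))) \<partial>M) \<le> ennreal (exp (K\<^sup>2 * sqn n l / 2))"
proof -
  interpret prob_space M by fact
  have "(\<integral>\<^sup>+\<omega>. ennreal (exp (inn n l (\<xi> \<omega>))) \<partial>M) = (\<integral>\<^sup>+\<omega>. (\<Prod>i<n. ennreal (exp (l i * \<xi> \<omega> i))) \<partial>M)"
    by (simp add: inn_def exp_sum prod_ennreal)
  also have "\<dots> = (\<Prod>i<n. \<integral>\<^sup>+\<omega>. ennreal (exp (l i * \<xi> \<omega> i)) \<partial>M)"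
  proof (rule indep_vars_nn_integral)
    show "indep_vars (\<lambda>_. borel) (\<lambda>i \<omega>. ennreal (exp (l i * \<xi> \<omega> i))) {..<n}"
      by (rule indep_vars_compose2[OF ind, where Y="\<lambda>i x. ennreal (exp (l i * x))"]) measurable
  qed auto
  also have "\<dots> \<le> (\<Prod>i<n. ennreal (exp (K\<^sup>2 * (l i)\<^sup>2 / 2)))"
    by (intro prod_mono_ennreal subgaussian_nn_integral sub) auto
  also have "\<dots> = ennreal (exp (K\<^sup>2 * sqn n l / 2))"
    by (simp add: prod_ennreal exp_sum[symmetric] sqn_def sum_distrib_left sum_divide_distrib)
  finally show ?thesis .
qed

lemma subgaussian_mono:
  assumes "subgaussian M \<xi> K" "K\<^sup>2 \<le> K'\<^sup>2"
  shows "subgaussian M \<xi> K'"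
proof -
  have "exp (K\<^sup>2 * l\<^sup>2 / 2) \<le> exp (K'\<^sup>2 * l\<^sup>2 / 2)" for l
    using assms(2) by (simp add: mult_right_mono)
  then show ?thesis using assms(1) unfolding subgaussian_def by (meson order_trans)
qed

subsection \<open>Stochastic order and independence\<close>

definition outside_small :: "(nat \<Rightarrow> 'a measure) \<Rightarrow> real \<Rightarrow> (nat \<Rightarrow> 'a \<Rightarrow> bool) \<Rightarrow> bool" where
  "outside_small M e P \<longleftrightarrow> (\<forall>\<^sub>F n in sequentially.
     \<exists>A\<in>sets (M n). measure (M n) A \<le> e \<and> (\<forall>\<omega>\<in>space (M n) - A. P n \<omega>))"

text \<open>Convergence to zero and boundedness in probability, phrased through exceptional events so that
  no measurability of the sequence itself is needed.\<close>
definition vanish_prob :: "(nat \<Rightarrow> 'a measure) \<Rightarrow> (nat \<Rightarrow> 'a \<Rightarrow> real) \<Rightarrow> bool" where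
  "vanish_prob M T \<longleftrightarrow> (\<forall>\<delta>>0. \<forall>e>0. outside_small M e (\<lambda>n \<omega>. \<bar>T n \<omega>\<bar> \<le> \<delta>))"

definition bounded_prob :: "(nat \<Rightarrow> 'a measure) \<Rightarrow> (nat \<Rightarrow> 'a \<Rightarrow> real) \<Rightarrow> bool" where
  "bounded_prob M T \<longleftrightarrow> (\<forall>e>0. \<exists>C. outside_small M e (\<lambda>n \<omega>. \<bar>T n \<omega>\<bar> \<le> C))"

lemma outside_smallI:
  "(\<forall>\<^sub>F n in sequentially. \<exists>A\<in>sets (M n). measure (M n) A \<le> e \<and> (\<forall>\<omega>\<in>space (M n) - A. P n \<omega>)) \<Longrightarrow>
    outside_small M e P"
  by (simp add: outside_small_def)

lemma outside_small_combine:
  assumes "outside_small M a P" "outside_small M b Q" "a + b \<le> e"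
    and "\<forall>\<^sub>F n in sequentially. \<forall>\<omega>\<in>space (M n). P n \<omega> \<longrightarrow> Q n \<omega> \<longrightarrow> R n \<omega>"
  shows "outside_small M e R"
  using assms(1,2,4) unfolding outside_small_def
proof eventually_elim
  case (elim n)
  then obtain A B where A: "A \<in> sets (M n)" "measure (M n) A \<le> a" "\<forall>\<omega>\<in>space (M n) - A. P n \<omega>"
    and B: "B \<in> sets (M n)" "measure (M n) B \<le> b" "\<forall>\<omega>\<in>space (M n) - B. Q n \<omega>" by blast
  have "measure (M n) (A \<union> B) \<le> e" using measure_Un_le[OF A(1) B(1)] A(2) B(2) assms(3) by linarith
  then show ?case using A B elim(3) by (intro bexI[of _ "A \<union> B"]) auto
qed

lemma outside_small_always:
  assumes "0 \<le> e" "\<forall>\<^sub>F n in sequentially. \<forall>\<omega>\<in>space (M n). P n \<omega>"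
  shows "outside_small M e P"
  using assms(2) unfolding outside_small_def
  by eventually_elim (use assms(1) in \<open>auto intro!: bexI[of _ "{}"]\<close>)

lemma outside_small_mono:
  assumes "outside_small M e P" "\<forall>\<^sub>F n in sequentially. \<forall>\<omega>\<in>space (M n). P n \<omega> \<longrightarrow> R n \<omega>"
  shows "outside_small M e R"
  by (rule outside_small_combine[OF assms(1) outside_small_always[OF order_refl], of "\<lambda>_ _. True"]) (use assms(2) in auto)

lemma vanish_probD: "vanish_prob M T \<Longrightarrow> \<delta> > 0 \<Longrightarrow> e > 0 \<Longrightarrow> outside_small M e (\<lambda>n \<omega>. \<bar>T n \<omega>\<bar> \<le> \<delta>)"
  by (simp add: vanish_prob_def)

text \<open>The comparison may fail where \<open>D\<close> is large. It is applied with a multiple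
  of the perturbation of the Gram matrix as \<open>D\<close>, whose small values ensure
  invertibility.\<close>

lemma vanish_prob_mono_event:
  assumes "vanish_prob M T" "vanish_prob M D" "d > 0"
    and "\<forall>\<^sub>F n in sequentially. \<forall>\<omega>\<in>space (M n). \<bar>D n \<omega>\<bar> \<le> d \<longrightarrow> \<bar>S n \<omega>\<bar> \<le> \<bar>T n \<omega>\<bar>"
  shows "vanish_prob M S"
  unfolding vanish_prob_def
proof (intro allI impI)
  fix \<delta> e :: real assume "\<delta> > 0" "e > 0"
  then have e: "e / 2 > 0" by auto
  show "outside_small M e (\<lambda>n \<omega>. \<bar>S n \<omega>\<bar> \<le> \<delta>)"
    by (rule outside_small_combine[OF vanish_probD[OF assms(1) \<open>\<delta> > 0\<close> e] vanish_probD[OF assms(2,3) e]], simp,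
        rule eventually_mono[OF assms(4)]) (auto intro: order_trans)
qed

lemma vanish_prob_const:
  assumes "c \<longlonglongrightarrow> 0"
  shows "vanish_prob M (\<lambda>n \<omega>. c n)"
  unfolding vanish_prob_def
proof (intro allI impI)
  fix \<delta> e :: real assume "\<delta> > 0" "e > 0"
  from tendstoD[OF assms \<open>\<delta> > 0\<close>] \<open>e > 0\<close> show "outside_small M e (\<lambda>n \<omega>. \<bar>c n\<bar> \<le> \<delta>)"
    by (intro outside_small_always) (auto elim!: eventually_mono)
qed

lemma vanish_prob_mono:
  assumes "vanish_prob M T" "\<forall>\<^sub>F n in sequentially. \<forall>\<omega>\<in>space (M n). \<bar>S n \<omega>\<bar> \<le> \<bar>T n \<omega>\<bar>"
  shows "vanish_prob M S"
  by (rule vanish_prob_mono_event[OF assms(1) vanish_prob_const[OF tendsto_const] zero_less_one])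
    (rule eventually_mono[OF assms(2)], simp)

lemma vanish_prob_add:
  assumes "vanish_prob M S" "vanish_prob M T"
  shows "vanish_prob M (\<lambda>n \<omega>. S n \<omega> + T n \<omega>)"
  unfolding vanish_prob_def
proof (intro allI impI)
  fix \<delta> e :: real assume "\<delta> > 0" "e > 0"
  then have *: "\<delta> / 2 > 0" "e / 2 > 0" by auto
  show "outside_small M e (\<lambda>n \<omega>. \<bar>S n \<omega> + T n \<omega>\<bar> \<le> \<delta>)"
    by (rule outside_small_combine[OF vanish_probD[OF assms(1) *] vanish_probD[OF assms(2) *]]) (auto intro!: always_eventually)
qed

lemma vanish_prob_mult:
  assumes "vanish_prob M S" "bounded_prob M T"
  shows "vanish_prob M (\<lambda>n \<omega>. S n \<omega> * T n \<omega>)"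
  unfolding vanish_prob_def
proof (intro allI impI)
  fix \<delta> e :: real assume "\<delta> > 0" "e > 0"
  then have e: "e / 2 > 0" by auto
  then obtain C where C: "outside_small M (e / 2) (\<lambda>n \<omega>. \<bar>T n \<omega>\<bar> \<le> C)"
    using assms(2) unfolding bounded_prob_def by blast
  define d where "d = \<delta> / (\<bar>C\<bar> + 1)"
  have d: "d > 0" using \<open>\<delta> > 0\<close> by (simp add: d_def)
  have "\<bar>x * y\<bar> \<le> \<delta>" if "\<bar>x\<bar> \<le> d" "\<bar>y\<bar> \<le> C" for x y
  proof -
    have "\<bar>x\<bar> * \<bar>y\<bar> \<le> d * (\<bar>C\<bar> + 1)" using d that by (intro mult_mono) auto
    then show ?thesis by (simp add: d_def abs_mult)
  qed
  then show "outside_small M e (\<lambda>n \<omega>. \<bar>S n \<omega> * T n \<omega>\<bar> \<le> \<delta>)"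
    by (intro outside_small_combine[OF vanish_probD[OF assms(1) d e] C] always_eventually) auto
qed

lemma bounded_prob_mono:
  assumes "bounded_prob M T" "\<forall>\<^sub>F n in sequentially. \<forall>\<omega>\<in>space (M n). \<bar>S n \<omega>\<bar> \<le> \<bar>T n \<omega>\<bar>"
  shows "bounded_prob M S"
  unfolding bounded_prob_def
proof (intro allI impI)
  fix e :: real assume "e > 0"
  then obtain C where C: "outside_small M e (\<lambda>n \<omega>. \<bar>T n \<omega>\<bar> \<le> C)"
    using assms(1) unfolding bounded_prob_def by blast
  have "outside_small M e (\<lambda>n \<omega>. \<bar>S n \<omega>\<bar> \<le> C)"
    by (rule outside_small_mono[OF C], rule eventually_mono[OF assms(2)]) (auto intro: order_trans)
  then show "\<exists>C. outside_small M e (\<lambda>n \<omega>. \<bar>S n \<omega>\<bar> \<le> C)" ..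
qed

lemma bounded_prob_const: "bounded_prob M (\<lambda>n \<omega>. c)"
  unfolding bounded_prob_def by (intro allI impI exI[of _ "\<bar>c\<bar>"] outside_small_always) auto

lemma vanish_prob_bounded: "vanish_prob M T \<Longrightarrow> bounded_prob M T"
  unfolding vanish_prob_def bounded_prob_def using zero_less_one by blast

lemma bounded_prob_add:
  assumes "bounded_prob M S" "bounded_prob M T"
  shows "bounded_prob M (\<lambda>n \<omega>. S n \<omega> + T n \<omega>)"
  unfolding bounded_prob_def
proof (intro allI impI)
  fix e :: real assume "e > 0"
  then have e: "e / 2 > 0" by auto
  obtain C D where "outside_small M (e / 2) (\<lambda>n \<omega>. \<bar>S n \<omega>\<bar> \<le> C)" "outside_small M (e / 2) (\<lambda>n \<omega>. \<bar>T n \<omega>\<bar> \<le> D)"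
    using assms e unfolding bounded_prob_def by blast
  then have "outside_small M e (\<lambda>n \<omega>. \<bar>S n \<omega> + T n \<omega>\<bar> \<le> C + D)"
    by (rule outside_small_combine) (auto intro!: always_eventually)
  then show "\<exists>C. outside_small M e (\<lambda>n \<omega>. \<bar>S n \<omega> + T n \<omega>\<bar> \<le> C)" ..
qed

lemma bounded_prob_sum:
  assumes "finite J" "\<And>j. j \<in> J \<Longrightarrow> bounded_prob M (T j)"
  shows "bounded_prob M (\<lambda>n \<omega>. \<Sum>j\<in>J. T j n \<omega>)"
  using assms by (induction J rule: finite_induct) (auto simp: bounded_prob_const bounded_prob_add)

lemma bounded_prob_cmult:
  assumes "bounded_prob M T"
  shows "bounded_prob M (\<lambda>n \<omega>. c * T n \<omega>)"
  unfolding bounded_prob_def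
proof (intro allI impI)
  fix e :: real assume "e > 0"
  then obtain C where "outside_small M e (\<lambda>n \<omega>. \<bar>T n \<omega>\<bar> \<le> C)"
    using assms unfolding bounded_prob_def by blast
  then have "outside_small M e (\<lambda>n \<omega>. \<bar>c * T n \<omega>\<bar> \<le> \<bar>c\<bar> * C)"
    by (rule outside_small_mono) (auto simp: abs_mult intro!: always_eventually mult_left_mono)
  then show "\<exists>C. outside_small M e (\<lambda>n \<omega>. \<bar>c * T n \<omega>\<bar> \<le> C)" ..
qed

lemma vanish_prob_cmult: "vanish_prob M T \<Longrightarrow> vanish_prob M (\<lambda>n \<omega>. c * T n \<omega>)"
  using vanish_prob_mult[OF _ bounded_prob_const, of M T c] by (simp add: mult.commute)

lemma vanish_prob_diff:
  "vanish_prob M S \<Longrightarrow> vanish_prob M T \<Longrightarrow> vanish_prob M (\<lambda>n \<omega>. S n \<omega> - T n \<omega>)"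
  using vanish_prob_add[of M S "\<lambda>n \<omega>. -1 * T n \<omega>"] vanish_prob_cmult[of M T "-1"] by simp

lemma vanish_prob_abs: "vanish_prob M T \<Longrightarrow> vanish_prob M (\<lambda>n \<omega>. \<bar>T n \<omega>\<bar>)"
  by (erule vanish_prob_mono) simp

lemma vanish_prob_sum:
  assumes "finite J" "\<And>j. j \<in> J \<Longrightarrow> vanish_prob M (T j)"
  shows "vanish_prob M (\<lambda>n \<omega>. \<Sum>j\<in>J. T j n \<omega>)"
  using assms by (induction J rule: finite_induct) (auto simp: vanish_prob_add vanish_prob_const[of "\<lambda>_. 0"])

text \<open>The tail events in \<open>smallOp\<close> become the exceptional events, so they have to
  be measurable.\<close>

lemma smallOp_vanish_prob:
  assumes "smallOp M T r" "\<And>n. T n \<in> borel_measurable (M n)" "\<forall>\<^sub>F n in sequentially. r n > 0"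
  shows "vanish_prob M (\<lambda>n \<omega>. T n \<omega> / r n)"
  unfolding vanish_prob_def
proof (intro allI impI outside_smallI)
  fix \<delta> e :: real assume d: "\<delta> > 0" and e: "e > 0"
  have "(\<lambda>n. measure (M n) {\<omega>\<in>space (M n). \<bar>T n \<omega>\<bar> > \<delta> * r n}) \<longlonglongrightarrow> 0"
    using assms(1) d by (simp add: smallOp_def)
  from order_tendstoD(2)[OF this e] assms(3)
  show "\<forall>\<^sub>F n in sequentially. \<exists>A\<in>sets (M n). measure (M n) A \<le> e \<and> (\<forall>\<omega>\<in>space (M n) - A. \<bar>T n \<omega> / r n\<bar> \<le> \<delta>)"
  proof eventually_elim
    case (elim n)
    have [measurable]: "T n \<in> borel_measurable (M n)" by (rule assms)
    have "\<bar>T n \<omega> / r n\<bar> \<le> \<delta>" if "\<not> \<bar>T n \<omega>\<bar> > \<delta> * r n" for \<omega>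
      using that elim by (simp add: abs_divide field_simps)
    with elim show ?case
      by (intro bexI[of _ "{\<omega>\<in>space (M n). \<bar>T n \<omega>\<bar> > \<delta> * r n}"]) auto
  qed
qed

text \<open>Chebyshev's inequality, the common source of the bounds for the Gram entries and for the
  score.\<close>

lemma second_moment_tail:
  assumes "\<And>n. prob_space (M n)" "\<And>n. T n \<in> borel_measurable (M n)" "t > 0"
    and "\<forall>\<^sub>F n in sequentially. integrable (M n) (\<lambda>\<omega>. (T n \<omega>)\<^sup>2) \<and> (\<integral>\<omega>. (T n \<omega>)\<^sup>2 \<partial>M n) \<le> e * t\<^sup>2"
  shows "outside_small M e (\<lambda>n \<omega>. \<bar>T n \<omega>\<bar> \<le> t)"
  using assms(4) unfolding outside_small_def
proof (eventually_elim, intro bexI conjI ballI)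
  case (elim n)
  note [measurable] = assms(2)
  let ?A = "{\<omega>\<in>space (M n). (T n \<omega>)\<^sup>2 \<ge> t\<^sup>2}"
  show "?A \<in> sets (M n)" by measurable
  have "measure (M n) ?A \<le> (\<integral>\<omega>. (T n \<omega>)\<^sup>2 \<partial>M n) / t\<^sup>2"
    using elim assms(3) by (intro integral_Markov_inequality_measure[where A="{}"]) auto
  also have "\<dots> \<le> e" using elim assms(3) by (simp add: pos_divide_le_eq)
  finally show "measure (M n) ?A \<le> e" .
  fix \<omega> assume "\<omega> \<in> space (M n) - ?A"
  then have "(T n \<omega>)\<^sup>2 < t\<^sup>2" by auto
  then show "\<bar>T n \<omega>\<bar> \<le> t" using assms(3) by (metis abs_le_square_iff abs_of_pos less_imp_le)
qed

lemma vanish_prob_second_moment: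
  assumes "\<And>n. prob_space (M n)" "\<And>n. T n \<in> borel_measurable (M n)"
    and "\<forall>\<^sub>F n in sequentially. integrable (M n) (\<lambda>\<omega>. (T n \<omega>)\<^sup>2) \<and> (\<integral>\<omega>. (T n \<omega>)\<^sup>2 \<partial>M n) \<le> v n" "v \<longlonglongrightarrow> 0"
  shows "vanish_prob M T"
  unfolding vanish_prob_def
proof (intro allI impI second_moment_tail assms(1,2))
  fix \<delta> e :: real assume "\<delta> > 0" "e > 0"
  then have "e * \<delta>\<^sup>2 > 0" by simp
  from order_tendstoD(2)[OF assms(4) this] assms(3)
  show "\<forall>\<^sub>F n in sequentially. integrable (M n) (\<lambda>\<omega>. (T n \<omega>)\<^sup>2) \<and> (\<integral>\<omega>. (T n \<omega>)\<^sup>2 \<partial>M n) \<le> e * \<delta>\<^sup>2"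
    by eventually_elim auto
qed

lemma bounded_prob_second_moment:
  assumes "\<And>n. prob_space (M n)" "\<And>n. T n \<in> borel_measurable (M n)"
    and "\<forall>\<^sub>F n in sequentially. integrable (M n) (\<lambda>\<omega>. (T n \<omega>)\<^sup>2) \<and> (\<integral>\<omega>. (T n \<omega>)\<^sup>2 \<partial>M n) \<le> v"
  shows "bounded_prob M T"
  unfolding bounded_prob_def
proof (intro allI impI)
  fix e :: real assume e: "e > 0"
  define C where "C = sqrt ((\<bar>v\<bar> + 1) / e)"
  have C: "C > 0" "e * C\<^sup>2 = \<bar>v\<bar> + 1" using e by (auto simp: C_def)
  have "outside_small M e (\<lambda>n \<omega>. \<bar>T n \<omega>\<bar> \<le> C)"
    by (rule second_moment_tail[OF assms(1,2) C(1)], rule eventually_mono[OF assms(3)]) (auto simp: C(2))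
  then show "\<exists>C. outside_small M e (\<lambda>n \<omega>. \<bar>T n \<omega>\<bar> \<le> C)" ..
qed

section \<open>Generated sigma-algebras and Fubini's theorem under independence\<close>

definition sub_alg :: "'a measure \<Rightarrow> ('a \<Rightarrow> real) set \<Rightarrow> 'a measure" where
  "sub_alg M F = sigma (space M) (gen_sigma M F)"

lemma gen_sigma_subset: "gen_sigma M F \<subseteq> Pow (space M)"
proof -
  have "(\<Union>f\<in>F. {f -` A \<inter> space M | A. A \<in> sets borel}) \<subseteq> Pow (space M)" by auto
  then show ?thesis unfolding gen_sigma_def using sigma_sets_into_sp by blast
qed

lemma space_sub_alg [simp]: "space (sub_alg M F) = space M"
  unfolding sub_alg_def by (rule space_measure_of[OF gen_sigma_subset])

lemma sets_sub_alg: "sets (sub_alg M F) = gen_sigma M F"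
proof -
  have "sigma_sets (space M) (gen_sigma M F) = gen_sigma M F"
    unfolding gen_sigma_def by (rule sigma_sets_sigma_sets_eq) auto
  then show ?thesis unfolding sub_alg_def sets_measure_of[OF gen_sigma_subset] .
qed

lemma sub_alg_measurable: "f \<in> F \<Longrightarrow> f \<in> borel_measurable (sub_alg M F)"
proof (rule measurableI)
  fix A :: "real set" assume "f \<in> F" "A \<in> sets borel"
  then show "f -` A \<inter> space (sub_alg M F) \<in> sets (sub_alg M F)"
    unfolding sets_sub_alg gen_sigma_def by (auto intro!: sigma_sets.Basic)
qed auto

lemma measurable_ident_sub_alg:
  assumes "\<And>f. f \<in> F \<Longrightarrow> f \<in> borel_measurable M"
  shows "(\<lambda>\<omega>. \<omega>) \<in> measurable M (sub_alg M F)"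
proof (rule measurableI)
  fix A assume "A \<in> sets (sub_alg M F)"
  then have A: "A \<in> gen_sigma M F" by (simp add: sets_sub_alg)
  have "gen_sigma M F \<subseteq> sets M"
    unfolding gen_sigma_def by (rule sets.sigma_sets_subset) (auto dest!: assms)
  then show "(\<lambda>\<omega>. \<omega>) -` A \<inter> space M \<in> sets M" using A sets.sets_into_space[of A M] by (auto simp: Int_absorb2)
qed auto

text \<open>Independence of two generated sigma-algebras is independence of the identity map read
  into two coarser spaces. The diagonal therefore has a product law.\<close>

lemma indep_distr_pair:
  assumes M: "prob_space M"
    and F: "\<And>f. f \<in> F \<Longrightarrow> f \<in> borel_measurable M" and G: "\<And>f. f \<in> G \<Longrightarrow> f \<in> borel_measurable M"
    and ind: "prob_space.indep_set M (gen_sigma M F) (gen_sigma M G)"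
  shows "distr M (sub_alg M F) (\<lambda>\<omega>. \<omega>) \<Otimes>\<^sub>M distr M (sub_alg M G) (\<lambda>\<omega>. \<omega>) =
    distr M (sub_alg M F \<Otimes>\<^sub>M sub_alg M G) (\<lambda>x. (x, x))"
proof -
  interpret prob_space M by fact
  let ?S = "sub_alg M F" and ?T = "sub_alg M G"
  have m: "(\<lambda>\<omega>. \<omega>) \<in> measurable M ?S" "(\<lambda>\<omega>. \<omega>) \<in> measurable M ?T"
    using F G by (auto intro: measurable_ident_sub_alg)
  \<comment> \<open>Preimages under the identity are the sets of \<open>sub_alg M H\<close>
    themselves, so the independence hypothesis has exactly the form that \<open>indep_var_eq\<close>
    asks for.\<close>
  have eq: "sigma_sets (space M) {(\<lambda>\<omega>. \<omega>) -` A \<inter> space M | A. A \<in> sets (sub_alg M H)} = gen_sigma M H" for H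
  proof -
    have "{(\<lambda>\<omega>. \<omega>) -` A \<inter> space M | A. A \<in> sets (sub_alg M H)} = sets (sub_alg M H)"
      using sets.sets_into_space[of _ "sub_alg M H"] by (auto simp: Int_absorb2)
    then show ?thesis using sets.sigma_sets_eq[of "sub_alg M H"] by (simp add: sets_sub_alg)
  qed
  have "indep_var ?S (\<lambda>\<omega>. \<omega>) ?T (\<lambda>\<omega>. \<omega>)"
    unfolding indep_var_eq eq using m ind by simp
  then show ?thesis unfolding indep_var_distribution_eq by simp
qed

text \<open>A freezing lemma: the two occurrences of the sample point are decoupled, so one block of
  variables can be held fixed. This plays the part of conditioning throughout.\<close>

lemma indep_nn_integral:
  assumes M: "prob_space M"
    and F: "\<And>f. f \<in> F \<Longrightarrow> f \<in> borel_measurable M" and G: "\<And>f. f \<in> G \<Longrightarrow> f \<in> borel_measurable M"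
    and ind: "prob_space.indep_set M (gen_sigma M F) (gen_sigma M G)"
    and \<Phi>: "\<Phi> \<in> borel_measurable (sub_alg M F \<Otimes>\<^sub>M sub_alg M G)"
  shows "(\<integral>\<^sup>+\<omega>. \<Phi> (\<omega>, \<omega>) \<partial>M) = (\<integral>\<^sup>+y. (\<integral>\<^sup>+x. \<Phi> (x, y) \<partial>M) \<partial>M)"
proof -
  let ?S = "sub_alg M F" and ?T = "sub_alg M G"
  interpret prob_space M by fact
  have m: "(\<lambda>\<omega>. \<omega>) \<in> measurable M ?S" "(\<lambda>\<omega>. \<omega>) \<in> measurable M ?T"
    using F G by (auto intro: measurable_ident_sub_alg)
  have D: "distr M ?S (\<lambda>\<omega>. \<omega>) \<Otimes>\<^sub>M distr M ?T (\<lambda>\<omega>. \<omega>) = distr M (?S \<Otimes>\<^sub>M ?T) (\<lambda>x. (x, x))"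
    by (rule indep_distr_pair[OF M _ _ ind]) (auto intro: F G)
  interpret S: prob_space "distr M ?S (\<lambda>\<omega>. \<omega>)" by (rule prob_space_distr[OF m(1)])
  interpret T: prob_space "distr M ?T (\<lambda>\<omega>. \<omega>)" by (rule prob_space_distr[OF m(2)])
  interpret ST: pair_sigma_finite "distr M ?S (\<lambda>\<omega>. \<omega>)" "distr M ?T (\<lambda>\<omega>. \<omega>)" ..
  have \<Phi>': "\<Phi> \<in> borel_measurable (distr M ?S (\<lambda>\<omega>. \<omega>) \<Otimes>\<^sub>M distr M ?T (\<lambda>\<omega>. \<omega>))"
    using \<Phi> by (simp cong: measurable_cong_sets sets_pair_measure_cong)
  have "(\<integral>\<^sup>+\<omega>. \<Phi> (\<omega>, \<omega>) \<partial>M) = (\<integral>\<^sup>+z. \<Phi> z \<partial>distr M (?S \<Otimes>\<^sub>M ?T) (\<lambda>x. (x, x)))"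
    using m \<Phi> by (subst nn_integral_distr) (auto intro: measurable_Pair)
  also have "\<dots> = (\<integral>\<^sup>+y. (\<integral>\<^sup>+x. \<Phi> (x, y) \<partial>distr M ?S (\<lambda>\<omega>. \<omega>)) \<partial>distr M ?T (\<lambda>\<omega>. \<omega>))"
    unfolding D[symmetric] by (rule ST.nn_integral_snd[OF \<Phi>', symmetric])
  also have "\<dots> = (\<integral>\<^sup>+y. (\<integral>\<^sup>+x. \<Phi> (x, y) \<partial>distr M ?S (\<lambda>\<omega>. \<omega>)) \<partial>M)"
  proof -
    have "(\<lambda>(y, x). \<Phi> (x, y)) \<in> borel_measurable (?T \<Otimes>\<^sub>M distr M ?S (\<lambda>\<omega>. \<omega>))"
      using measurable_pair_swap[OF \<Phi>] by (simp cong: measurable_cong_sets sets_pair_measure_cong)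
    then have "(\<lambda>y. \<integral>\<^sup>+x. \<Phi> (x, y) \<partial>distr M ?S (\<lambda>\<omega>. \<omega>)) \<in> borel_measurable ?T"
      by (rule S.borel_measurable_nn_integral[of "\<lambda>y x. \<Phi> (x, y)"])
    then show ?thesis using m(2) by (subst nn_integral_distr) auto
  qed
  also have "\<dots> = (\<integral>\<^sup>+y. (\<integral>\<^sup>+x. \<Phi> (x, y) \<partial>M) \<partial>M)"
  proof (rule nn_integral_cong)
    fix y assume y: "y \<in> space M"
    have "(\<lambda>x. \<Phi> (x, y)) \<in> borel_measurable ?S"
      by (rule measurable_compose[OF _ \<Phi>]) (use y in \<open>auto intro: measurable_Pair2'\<close>)
    then show "(\<integral>\<^sup>+x. \<Phi> (x, y) \<partial>distr M ?S (\<lambda>\<omega>. \<omega>)) = (\<integral>\<^sup>+x. \<Phi> (x, y) \<partial>M)"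
      using m by (subst nn_integral_distr) auto
  qed
  finally show ?thesis .
qed

lemma indep_integral:
  fixes \<Phi> :: "'a \<times> 'a \<Rightarrow> 'b::{banach, second_countable_topology}"
  assumes M: "prob_space M"
    and F: "\<And>f. f \<in> F \<Longrightarrow> f \<in> borel_measurable M" and G: "\<And>f. f \<in> G \<Longrightarrow> f \<in> borel_measurable M"
    and ind: "prob_space.indep_set M (gen_sigma M F) (gen_sigma M G)"
    and \<Phi>: "\<Phi> \<in> borel_measurable (sub_alg M F \<Otimes>\<^sub>M sub_alg M G)" and B: "\<And>z. norm (\<Phi> z) \<le> B"
  shows "(\<integral>\<omega>. \<Phi> (\<omega>, \<omega>) \<partial>M) = (\<integral>x. (\<integral>y. \<Phi> (x, y) \<partial>M) \<partial>M)"
proof -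
  let ?S = "sub_alg M F" and ?T = "sub_alg M G"
  interpret prob_space M by fact
  have m: "(\<lambda>\<omega>. \<omega>) \<in> measurable M ?S" "(\<lambda>\<omega>. \<omega>) \<in> measurable M ?T"
    using F G by (auto intro: measurable_ident_sub_alg)
  have D: "distr M ?S (\<lambda>\<omega>. \<omega>) \<Otimes>\<^sub>M distr M ?T (\<lambda>\<omega>. \<omega>) = distr M (?S \<Otimes>\<^sub>M ?T) (\<lambda>x. (x, x))"
    by (rule indep_distr_pair[OF M _ _ ind]) (auto intro: F G)
  interpret S: prob_space "distr M ?S (\<lambda>\<omega>. \<omega>)" by (rule prob_space_distr[OF m(1)])
  interpret T: prob_space "distr M ?T (\<lambda>\<omega>. \<omega>)" by (rule prob_space_distr[OF m(2)])
  interpret ST: pair_prob_space "distr M ?S (\<lambda>\<omega>. \<omega>)" "distr M ?T (\<lambda>\<omega>. \<omega>)" ..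
  have \<Phi>': "\<Phi> \<in> borel_measurable (distr M ?S (\<lambda>\<omega>. \<omega>) \<Otimes>\<^sub>M distr M ?T (\<lambda>\<omega>. \<omega>))"
    using \<Phi> by (simp cong: measurable_cong_sets sets_pair_measure_cong)
  have int: "integrable (distr M ?S (\<lambda>\<omega>. \<omega>) \<Otimes>\<^sub>M distr M ?T (\<lambda>\<omega>. \<omega>)) \<Phi>"
    using \<Phi>' B by (intro ST.P.integrable_const_bound[where B=B]) auto
  have "(\<integral>\<omega>. \<Phi> (\<omega>, \<omega>) \<partial>M) = (\<integral>z. \<Phi> z \<partial>distr M (?S \<Otimes>\<^sub>M ?T) (\<lambda>x. (x, x)))"
    using m \<Phi> by (subst integral_distr) (auto intro: measurable_Pair)
  also have "\<dots> = (\<integral>x. (\<integral>y. \<Phi> (x, y) \<partial>distr M ?T (\<lambda>\<omega>. \<omega>)) \<partial>distr M ?S (\<lambda>\<omega>. \<omega>))"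
    unfolding D[symmetric] by (rule ST.integral_fst'[OF int, symmetric])
  also have "\<dots> = (\<integral>x. (\<integral>y. \<Phi> (x, y) \<partial>distr M ?T (\<lambda>\<omega>. \<omega>)) \<partial>M)"
  proof (rule integral_distr[OF m(1)])
    have "(\<lambda>(x, y). \<Phi> (x, y)) \<in> borel_measurable (?S \<Otimes>\<^sub>M distr M ?T (\<lambda>\<omega>. \<omega>))"
      using \<Phi> by (simp cong: measurable_cong_sets sets_pair_measure_cong)
    then show "(\<lambda>x. \<integral>y. \<Phi> (x, y) \<partial>distr M ?T (\<lambda>\<omega>. \<omega>)) \<in> borel_measurable ?S"
      by (rule T.borel_measurable_lebesgue_integral[of "\<lambda>x y. \<Phi> (x, y)"])
  qed
  also have "\<dots> = (\<integral>x. (\<integral>y. \<Phi> (x, y) \<partial>M) \<partial>M)"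
  proof (rule Bochner_Integration.integral_cong[OF refl])
    fix x assume x: "x \<in> space M"
    have "(\<lambda>y. \<Phi> (x, y)) \<in> borel_measurable ?T"
      by (rule measurable_compose[OF _ \<Phi>]) (use x in \<open>auto intro: measurable_Pair1'\<close>)
    then show "(\<integral>y. \<Phi> (x, y) \<partial>distr M ?T (\<lambda>\<omega>. \<omega>)) = (\<integral>y. \<Phi> (x, y) \<partial>M)"
      using m by (subst integral_distr) auto
  qed
  finally show ?thesis .
qed

lemma indep_nn_integral_le:
  assumes M: "prob_space M"
    and F: "\<And>f. f \<in> F \<Longrightarrow> f \<in> borel_measurable M" and G: "\<And>f. f \<in> G \<Longrightarrow> f \<in> borel_measurable M"
    and ind: "prob_space.indep_set M (gen_sigma M F) (gen_sigma M G)"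
    and \<Phi>: "\<Phi> \<in> borel_measurable (sub_alg M F \<Otimes>\<^sub>M sub_alg M G)"
    and le: "\<And>y. y \<in> space M \<Longrightarrow> (\<integral>\<^sup>+x. \<Phi> (x, y) \<partial>M) \<le> C"
  shows "(\<integral>\<^sup>+\<omega>. \<Phi> (\<omega>, \<omega>) \<partial>M) \<le> C"
proof -
  have "(\<integral>\<^sup>+\<omega>. \<Phi> (\<omega>, \<omega>) \<partial>M) = (\<integral>\<^sup>+y. (\<integral>\<^sup>+x. \<Phi> (x, y) \<partial>M) \<partial>M)"
    by (rule indep_nn_integral[OF M _ _ ind \<Phi>]) (auto intro: F G)
  also have "\<dots> \<le> (\<integral>\<^sup>+y. C \<partial>M)" by (intro nn_integral_mono le)
  also have "\<dots> = C" using prob_space.emeasure_space_1[OF M] by simp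
  finally show ?thesis .
qed

subsection \<open>The largest energy over all models\<close>

text \<open>The inserted 0 keeps the set nonempty when there is no model, that is for
  \<open>u > p\<close>; otherwise it does not change the maximum, because energies are
  nonnegative.\<close>

definition max_energy :: "nat \<Rightarrow> nat \<Rightarrow> (nat \<Rightarrow> nat \<Rightarrow> real) \<Rightarrow> (nat \<Rightarrow> real) \<Rightarrow> nat \<Rightarrow> (nat \<Rightarrow> real) \<Rightarrow> real" where
  "max_energy n p Z f u \<xi> = Max (insert 0 ((\<lambda>m. energy n p Z f m \<xi>) ` subsets_of_size p u))"

lemma energy_le_max: "m \<in> subsets_of_size p u \<Longrightarrow> energy n p Z f m \<xi> \<le> max_energy n p Z f u \<xi>"
  by (simp add: max_energy_def)

lemma max_energy_nonneg [simp]: "0 \<le> max_energy n p Z f u \<xi>"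
  by (simp add: max_energy_def)

lemma max_energy_le:
  "0 \<le> c \<Longrightarrow> (\<And>m. m \<in> subsets_of_size p u \<Longrightarrow> energy n p Z f m \<xi> \<le> c) \<Longrightarrow> max_energy n p Z f u \<xi> \<le> c"
  by (auto simp: max_energy_def)

text \<open>With design and signal frozen, the bound for a fixed design applies with
  \<open>b = 0\<close>. The exponent \<open>Suc u\<close> counts the additional column
  \<open>f\<close>.\<close>

lemma exp_moment_energy:
  assumes M: "prob_space M"
    and F: "\<And>h. h \<in> F \<Longrightarrow> h \<in> borel_measurable M" and G: "\<And>h. h \<in> G \<Longrightarrow> h \<in> borel_measurable M"
    and ind: "prob_space.indep_set M (gen_sigma M F) (gen_sigma M G)"
    and \<xi>: "\<And>i. i < n \<Longrightarrow> (\<lambda>\<omega>. \<xi> \<omega> i) \<in> borel_measurable (sub_alg M F)"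
    and Z: "\<And>i k. i < n \<Longrightarrow> k < p \<Longrightarrow> (\<lambda>\<omega>. Z \<omega> i k) \<in> borel_measurable (sub_alg M G)"
    and f: "\<And>i. i < n \<Longrightarrow> (\<lambda>\<omega>. f \<omega> i) \<in> borel_measurable (sub_alg M G)"
    and sub: "\<And>l. (\<integral>\<^sup>+\<omega>. ennreal (exp (inn n l (\<xi> \<omega>))) \<partial>M) \<le> ennreal (exp (K\<^sup>2 * sqn n l / 2))"
    and K: "\<kappa> \<ge> 0" "\<kappa> * K\<^sup>2 = 1 / 4"
    and m: "m \<in> subsets_of_size p u"
  shows "(\<integral>\<^sup>+\<omega>. ennreal (exp (\<kappa> * energy n p (Z \<omega>) (f \<omega>) m (\<xi> \<omega>))) \<partial>M) \<le> ennreal (sqrt 2 ^ Suc u)"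
proof -
  note mD = subsets_of_sizeD[OF m]
  let ?P = "sub_alg M F \<Otimes>\<^sub>M sub_alg M G"
  let ?\<Phi> = "\<lambda>(x, y). ennreal (exp (\<kappa> * energy n p (Z y) (f y) m (\<xi> x)))"
  have "(\<lambda>z. energy n p (Z (snd z)) (f (snd z)) m (\<xi> (fst z))) \<in> borel_measurable ?P"
    using Z f \<xi> by (intro measurable_energy[OF m]) (auto intro: measurable_compose[OF measurable_snd] measurable_compose[OF measurable_fst])
  then have meas: "?\<Phi> \<in> borel_measurable ?P"
    unfolding case_prod_unfold
    by (intro measurable_compose[OF _ measurable_ennreal] measurable_compose[OF _ borel_measurable_exp] borel_measurable_times) auto
  have idm: "(\<lambda>\<omega>. \<omega>) \<in> measurable M (sub_alg M F)" by (rule measurable_ident_sub_alg[OF F])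
  have "(\<integral>\<^sup>+\<omega>. ?\<Phi> (\<omega>, \<omega>) \<partial>M) \<le> ennreal (sqrt 2 ^ Suc u)"
  proof (rule indep_nn_integral_le[OF M F G ind meas])
    fix y assume "y \<in> space M"
    have "(\<integral>\<^sup>+x. ennreal (exp (\<kappa> * sqn n (proj n (ext_design p (Z y) (f y)) (insert p m) (\<xi> x)) + inn n (\<lambda>i. 0) (\<xi> x))) \<partial>M)
      \<le> ennreal (sqrt 2 ^ card (insert p m) * exp (K\<^sup>2 * sqn n (\<lambda>i. 0) / 2))"
      by (rule exp_moment_sqn_proj[OF M _ sub K])
        (use mD \<xi> in \<open>auto intro: measurable_compose[OF idm]\<close>)
    then show "(\<integral>\<^sup>+x. ?\<Phi> (x, y) \<partial>M) \<le> ennreal (sqrt 2 ^ Suc u)"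
      using mD by (simp add: energy_def sqn_def)
  qed
  then show ?thesis by simp
qed

text \<open>Chernoff's bound for each model, then a union bound over the \<open>p choose u\<close>
  models; \<open>B m\<close> is the Markov event of model \<open>m\<close>.\<close>

lemma max_energy_tail:
  assumes M: "prob_space M"
    and F: "\<And>h. h \<in> F \<Longrightarrow> h \<in> borel_measurable M" and G: "\<And>h. h \<in> G \<Longrightarrow> h \<in> borel_measurable M"
    and ind: "prob_space.indep_set M (gen_sigma M F) (gen_sigma M G)"
    and \<xi>: "\<And>i. i < n \<Longrightarrow> (\<lambda>\<omega>. \<xi> \<omega> i) \<in> borel_measurable (sub_alg M F)"
    and Z: "\<And>i k. i < n \<Longrightarrow> k < p \<Longrightarrow> (\<lambda>\<omega>. Z \<omega> i k) \<in> borel_measurable (sub_alg M G)"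
    and f: "\<And>i. i < n \<Longrightarrow> (\<lambda>\<omega>. f \<omega> i) \<in> borel_measurable (sub_alg M G)"
    and sub: "\<And>l. (\<integral>\<^sup>+\<omega>. ennreal (exp (inn n l (\<xi> \<omega>))) \<partial>M) \<le> ennreal (exp (K\<^sup>2 * sqn n l / 2))"
    and K: "\<kappa> \<ge> 0" "\<kappa> * K\<^sup>2 = 1 / 4" and t: "t \<ge> 0"
  shows "\<exists>A\<in>sets M. measure M A \<le> real (p choose u) * (sqrt 2 ^ Suc u * exp (- \<kappa> * t)) \<and>
     (\<forall>\<omega>\<in>space M - A. max_energy n p (Z \<omega>) (f \<omega>) u (\<xi> \<omega>) \<le> t)"
proof -
  interpret prob_space M by fact
  let ?I = "subsets_of_size p u" and ?e = "\<lambda>\<omega> m. energy n p (Z \<omega>) (f \<omega>) m (\<xi> \<omega>)"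
  define B where "B m = {\<omega>\<in>space M. exp (- \<kappa> * t) * exp (\<kappa> * ?e \<omega> m) \<ge> 1}" for m
  have em: "(\<lambda>\<omega>. ?e \<omega> m) \<in> borel_measurable M" if "m \<in> ?I" for m
    by (rule measurable_energy[OF that])
      (auto intro: measurable_compose[OF measurable_ident_sub_alg[OF F] \<xi>] measurable_compose[OF measurable_ident_sub_alg[OF G] Z]
        measurable_compose[OF measurable_ident_sub_alg[OF G] f])
  have Bm: "B m \<in> sets M" if "m \<in> ?I" for m
  proof -
    note [measurable] = em[OF that]
    show ?thesis unfolding B_def by measurable
  qed
  have "measure M (B m) \<le> sqrt 2 ^ Suc u * exp (- \<kappa> * t)" if "m \<in> ?I" for m
  proof -
    note [measurable] = em[OF that]
    have "emeasure M (B m) \<le> (\<integral>\<^sup>+\<omega>. ennreal (exp (- \<kappa> * t)) * ennreal (exp (\<kappa> * ?e \<omega> m)) \<partial>M)"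
    proof -
      have "emeasure M (B m) = (\<integral>\<^sup>+\<omega>. indicator (B m) \<omega> \<partial>M)" using Bm[OF that] by simp
      also have "\<dots> \<le> (\<integral>\<^sup>+\<omega>. ennreal (exp (- \<kappa> * t)) * ennreal (exp (\<kappa> * ?e \<omega> m)) \<partial>M)"
        by (intro nn_integral_mono) (auto simp: B_def indicator_def ennreal_mult'[symmetric])
      finally show ?thesis .
    qed
    also have "\<dots> = ennreal (exp (- \<kappa> * t)) * (\<integral>\<^sup>+\<omega>. ennreal (exp (\<kappa> * ?e \<omega> m)) \<partial>M)"
      by (rule nn_integral_cmult) measurable
    also have "\<dots> \<le> ennreal (exp (- \<kappa> * t)) * ennreal (sqrt 2 ^ Suc u)"
      by (intro mult_left_mono exp_moment_energy[OF M F G ind \<xi> Z f sub K that]) auto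
    also have "\<dots> = ennreal (sqrt 2 ^ Suc u * exp (- \<kappa> * t))"
      by (simp add: ennreal_mult'[symmetric] mult.commute)
    finally show ?thesis by (simp add: emeasure_eq_measure)
  qed
  then have "measure M (\<Union>m\<in>?I. B m) \<le> (\<Sum>m\<in>?I. sqrt 2 ^ Suc u * exp (- \<kappa> * t))"
    using Bm by (intro order_trans[OF finite_measure_subadditive_finite] sum_mono) auto
  also have "\<dots> = real (p choose u) * (sqrt 2 ^ Suc u * exp (- \<kappa> * t))"
    by (simp add: card_subsets_of_size)
  finally have "measure M (\<Union>m\<in>?I. B m) \<le> real (p choose u) * (sqrt 2 ^ Suc u * exp (- \<kappa> * t))" .
  moreover have "max_energy n p (Z \<omega>) (f \<omega>) u (\<xi> \<omega>) \<le> t" if "\<omega> \<in> space M - (\<Union>m\<in>?I. B m)" for \<omega>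
  proof (rule max_energy_le[OF t])
    fix m assume "m \<in> ?I"
    then have "\<not> 1 \<le> exp (- \<kappa> * t) * exp (\<kappa> * ?e \<omega> m)" using that by (auto simp: B_def)
    then have "exp (- \<kappa> * t + \<kappa> * ?e \<omega> m) < exp 0" unfolding exp_add exp_zero not_le .
    then have "\<kappa> * ?e \<omega> m < \<kappa> * t" unfolding exp_less_cancel_iff by simp
    then show "?e \<omega> m \<le> t" using K by (meson less_imp_le mult_left_mono not_le)
  qed
  moreover have "(\<Union>m\<in>?I. B m) \<in> sets M" using Bm by auto
  ultimately show ?thesis by blast
qed

text \<open>Includes \<open>k = 0\<close>, where \<open>ln 0 = 0\<close>.\<close>

lemma ln_nonneg_nat: "0 \<le> ln (real (k::nat))"
  by (cases k) auto

lemma binomial_le_exp: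
  assumes "u \<le> p"
  shows "real (p choose u) \<le> exp (real u * ln (real p))"
proof (cases "p = 0")
  case False
  have "real (p choose u) \<le> real (p ^ u)" using binomial_le_pow[OF assms] by (simp only: of_nat_le_iff)
  also have "\<dots> = exp (real u * ln (real p))" using False by (simp add: exp_of_nat_mult)
  finally show ?thesis .
qed (use assms in simp)

lemma ln_binomial_le:
  assumes "u \<le> p"
  shows "0 \<le> ln (real (p choose u))" "ln (real (p choose u)) \<le> real u * ln (real p)"
proof -
  show "0 \<le> ln (real (p choose u))" by (rule ln_nonneg_nat)
  have "real (p choose u) > 0" using assms by simp
  from ln_mono[OF binomial_le_exp[OF assms] this] show "ln (real (p choose u)) \<le> real u * ln (real p)" by simp
qed

text \<open>Eventually \<open>u * ln p\<close> is at most \<open>c / 4 * sqrt n\<close>. The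
  binomial coefficient and the power of \<open>sqrt 2\<close> each cost at most one such exponent up
  to a constant, so half of the exponential decay survives.\<close>

lemma union_bound_vanishes:
  fixes p u :: "nat \<Rightarrow> nat"
  assumes le: "\<forall>\<^sub>F n in sequentially. u n \<le> p n"
    and rate: "(\<lambda>n. real (u n) * ln (real (p n)) / sqrt (real n)) \<longlonglongrightarrow> 0"
    and c: "c > 0"
  shows "(\<lambda>n. real (p n choose u n) * (sqrt 2 ^ Suc (u n) * exp (- c * sqrt (real n)))) \<longlonglongrightarrow> 0"
proof (rule tendsto_sandwich[OF _ _ tendsto_const])
  show "\<forall>\<^sub>F n in sequentially. 0 \<le> real (p n choose u n) * (sqrt 2 ^ Suc (u n) * exp (- c * sqrt (real n)))"
    by simp
  have "\<forall>\<^sub>F n in sequentially. real (u n) * ln (real (p n)) / sqrt (real n) < c / 4"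
    using order_tendstoD(2)[OF rate, of "c / 4"] c by simp
  then show "\<forall>\<^sub>F n in sequentially. real (p n choose u n) * (sqrt 2 ^ Suc (u n) * exp (- c * sqrt (real n))) \<le> exp (2 - c / 2 * sqrt (real n))"
    using le eventually_gt_at_top[of 0]
  proof eventually_elim
    case (elim n)
    let ?L = "real (u n) * ln (real (p n))"
    have L: "?L \<le> c / 4 * sqrt (real n)" using elim by (simp add: field_simps)
    \<comment> \<open>For \<open>p \<ge> 2\<close> this is \<open>ln 2 \<le> ln p\<close>. For
      smaller \<open>p\<close> the logarithm gives nothing, but then \<open>u \<le> 1\<close>, which
      the summand 1 covers.\<close>
    have "real (u n) * ln 2 \<le> ?L + 1"
    proof (cases "p n \<ge> 2")
      case True
      then have "real (u n) * ln 2 \<le> ?L" by (intro mult_left_mono) auto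
      then show ?thesis by simp
    next
      case False
      then have "u n \<le> 1" using elim by simp
      then have "real (u n) * ln 2 \<le> 1 * 1" using ln_le_minus_one[of "2::real"] by (intro mult_mono) auto
      moreover have "0 \<le> ?L" by (simp add: ln_nonneg_nat)
      ultimately show ?thesis by simp
    qed
    moreover have "ln 2 \<le> (1::real)" using ln_le_minus_one[of "2::real"] by simp
    ultimately have s: "real (Suc (u n)) * (ln 2 / 2) \<le> ?L + 2" using mult_nonneg_nonneg[OF of_nat_0_le_iff ln_nonneg_nat, of "u n" "p n"]
      by (simp add: distrib_right)
    have "sqrt 2 = exp (ln 2 / 2)"
      by (rule real_sqrt_unique) (auto simp: power2_eq_square exp_add[symmetric])
    then have "sqrt 2 ^ Suc (u n) = exp (real (Suc (u n)) * (ln 2 / 2))"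
      by (simp only: exp_of_nat_mult)
    then have "real (p n choose u n) * (sqrt 2 ^ Suc (u n) * exp (- c * sqrt (real n))) \<le>
      exp ?L * (exp (?L + 2) * exp (- c * sqrt (real n)))"
      using s binomial_le_exp[of "u n" "p n"] elim by (intro mult_mono) auto
    also have "\<dots> \<le> exp (2 - c / 2 * sqrt (real n))"
      unfolding exp_add[symmetric] using L by simp
    finally show ?case .
  qed
  show "(\<lambda>n. exp (2 - c / 2 * sqrt (real n))) \<longlonglongrightarrow> 0"
    using c by real_asymp
qed

lemma vanish_prob_max_energy:
  fixes p u :: "nat \<Rightarrow> nat"
  assumes M: "\<And>n. prob_space (M n)"
    and F: "\<And>n h. h \<in> F n \<Longrightarrow> h \<in> borel_measurable (M n)" and G: "\<And>n h. h \<in> G n \<Longrightarrow> h \<in> borel_measurable (M n)"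
    and ind: "\<And>n. prob_space.indep_set (M n) (gen_sigma (M n) (F n)) (gen_sigma (M n) (G n))"
    and \<xi>: "\<And>n i. i < n \<Longrightarrow> (\<lambda>\<omega>. \<xi> n \<omega> i) \<in> borel_measurable (sub_alg (M n) (F n))"
    and Z: "\<And>n i k. i < n \<Longrightarrow> k < p n \<Longrightarrow> (\<lambda>\<omega>. Z n \<omega> i k) \<in> borel_measurable (sub_alg (M n) (G n))"
    and f: "\<And>n i. i < n \<Longrightarrow> (\<lambda>\<omega>. f n \<omega> i) \<in> borel_measurable (sub_alg (M n) (G n))"
    and iv: "\<And>n. prob_space.indep_vars (M n) (\<lambda>_. borel) (\<lambda>i \<omega>. \<xi> n \<omega> i) {..<n}"
    and sub: "\<And>n i. i < n \<Longrightarrow> subgaussian (M n) (\<lambda>\<omega>. \<xi> n \<omega> i) K"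
    and le: "\<forall>\<^sub>F n in sequentially. u n \<le> p n"
    and rate: "(\<lambda>n. real (u n) * ln (real (p n)) / sqrt (real n)) \<longlonglongrightarrow> 0"
  shows "vanish_prob M (\<lambda>n \<omega>. max_energy n (p n) (Z n \<omega>) (f n \<omega>) (u n) (\<xi> n \<omega>) / sqrt (real n))"
  unfolding vanish_prob_def
proof (intro allI impI outside_smallI)
  fix \<delta> e :: real assume d: "\<delta> > 0" and e: "e > 0"
  \<comment> \<open>The given parameter may be 0; a larger positive one is still sub-Gaussian and
    makes \<open>\<kappa>\<close> well defined and positive.\<close>
  define K' where "K' = \<bar>K\<bar> + 1"
  define \<kappa> where "\<kappa> = 1 / (4 * K'\<^sup>2)"
  have K': "K' > 0" by (simp add: K'_def)
  have \<kappa>: "\<kappa> > 0" "\<kappa> * K'\<^sup>2 = 1 / 4" using K' by (auto simp: \<kappa>_def)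
  have "\<bar>K\<bar> \<le> \<bar>K'\<bar>" by (simp add: K'_def)
  then have KK: "K\<^sup>2 \<le> K'\<^sup>2" by (simp only: abs_le_square_iff)
  have sub': "(\<integral>\<^sup>+\<omega>. ennreal (exp (inn n l (\<xi> n \<omega>))) \<partial>M n) \<le> ennreal (exp (K'\<^sup>2 * sqn n l / 2))" for n l
    by (rule indep_subgaussian_nn_integral[OF M iv]) (rule subgaussian_mono[OF sub KK])
  have lim: "(\<lambda>n. real (p n choose u n) * (sqrt 2 ^ Suc (u n) * exp (- (\<kappa> * \<delta>) * sqrt (real n)))) \<longlonglongrightarrow> 0"
    by (rule union_bound_vanishes[OF le rate]) (use \<kappa> d in simp)
  from order_tendstoD(2)[OF lim e] eventually_gt_at_top[of 0]
  show "\<forall>\<^sub>F n in sequentially. \<exists>A\<in>sets (M n). measure (M n) A \<le> e \<and>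
    (\<forall>\<omega>\<in>space (M n) - A. \<bar>max_energy n (p n) (Z n \<omega>) (f n \<omega>) (u n) (\<xi> n \<omega>) / sqrt (real n)\<bar> \<le> \<delta>)"
  proof eventually_elim
    case (elim n)
    have "\<exists>A\<in>sets (M n). measure (M n) A \<le> real (p n choose u n) * (sqrt 2 ^ Suc (u n) * exp (- \<kappa> * (\<delta> * sqrt (real n)))) \<and>
     (\<forall>\<omega>\<in>space (M n) - A. max_energy n (p n) (Z n \<omega>) (f n \<omega>) (u n) (\<xi> n \<omega>) \<le> \<delta> * sqrt (real n))"
      by (rule max_energy_tail[OF M F G ind \<xi> Z f sub' less_imp_le[OF \<kappa>(1)] \<kappa>(2)]) (use d in auto)
    then obtain A where A: "A \<in> sets (M n)" "measure (M n) A \<le> real (p n choose u n) * (sqrt 2 ^ Suc (u n) * exp (- \<kappa> * (\<delta> * sqrt (real n))))"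
      "\<forall>\<omega>\<in>space (M n) - A. max_energy n (p n) (Z n \<omega>) (f n \<omega>) (u n) (\<xi> n \<omega>) \<le> \<delta> * sqrt (real n)" by blast
    have "measure (M n) A \<le> e" using A(2) elim by (simp add: mult.assoc)
    moreover have "\<bar>max_energy n (p n) (Z n \<omega>) (f n \<omega>) (u n) (\<xi> n \<omega>) / sqrt (real n)\<bar> \<le> \<delta>" if "\<omega> \<in> space (M n) - A" for \<omega>
      using A(3) that elim by (simp add: field_simps)
    ultimately show ?case using A(1) by blast
  qed
qed

subsection \<open>A multivariate continuity theorem\<close>

text \<open>Finite complex combinations of characters: on them convergence of characteristic
  functions is convergence of integrals, and they are closed under products because characters
  multiply.\<close>

inductive trig_poly :: "('b::real_inner \<Rightarrow> complex) \<Rightarrow> bool" where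
  cis: "trig_poly (\<lambda>x. c * cis (t \<bullet> x))"
| add: "trig_poly f \<Longrightarrow> trig_poly g \<Longrightarrow> trig_poly (\<lambda>x. f x + g x)"

lemma trig_poly_const: "trig_poly (\<lambda>x. c)"
  using trig_poly.cis[of c 0] by simp

lemma trig_poly_mult:
  assumes "trig_poly f" "trig_poly g"
  shows "trig_poly (\<lambda>x. f x * g x)"
  using assms
proof (induction f rule: trig_poly.induct)
  case (cis c t)
  from cis show ?case
  proof (induction g rule: trig_poly.induct)
    case (cis d s)
    have "(\<lambda>x. c * cis (t \<bullet> x) * (d * cis (s \<bullet> x))) = (\<lambda>x. (c * d) * cis ((t + s) \<bullet> x))"
      by (simp add: fun_eq_iff cis_mult[symmetric] inner_add_left)
    then show ?case using trig_poly.cis[of "c * d" "t + s"] by simp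
  next
    case (add f g)
    then show ?case by (simp add: distrib_left trig_poly.add)
  qed
next
  case (add f g)
  then show ?case by (simp add: distrib_right trig_poly.add)
qed

lemma trig_poly_sin: "trig_poly (\<lambda>x. complex_of_real (sin (t \<bullet> x)))"
proof -
  have "complex_of_real (sin a) = (- \<i> / 2) * cis a + (\<i> / 2) * cis (- a)" for a
    by (simp add: complex_eq_iff)
  then have "(\<lambda>x. complex_of_real (sin (t \<bullet> x))) = (\<lambda>x. (- \<i> / 2) * cis (t \<bullet> x) + (\<i> / 2) * cis ((- t) \<bullet> x))"
    by (simp add: fun_eq_iff inner_minus_left)
  then show ?thesis by (simp only: trig_poly.intros)
qed

text \<open>Each \<open>sin (x $ j / \<rho>)\<close> is the sine of a linear form, and the class is
  closed under the operations that build polynomials.\<close>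

lemma trig_poly_polynomial_of_sin:
  fixes P :: "real^'q::finite \<Rightarrow> real"
  assumes "real_polynomial_function P"
  shows "trig_poly (\<lambda>x::real^'q. complex_of_real (P (\<chi> j. sin (x $ j / \<rho>))))"
  using assms
proof (induction P rule: real_polynomial_function.induct)
  case (linear f)
  interpret bounded_linear f by fact
  have *: "trig_poly (\<lambda>x::real^'q. complex_of_real (sin (x $ j / \<rho>)))" for j
  proof -
    have "x $ j / \<rho> = ((1 / \<rho>) *\<^sub>R axis j 1) \<bullet> x" for x :: "real^'q" by (simp add: inner_axis')
    then show ?thesis by (simp only: trig_poly_sin)
  qed
  have "f (\<chi> j. sin (x $ j / \<rho>)) = (\<Sum>j\<in>UNIV. sin (x $ j / \<rho>) * f (axis j 1))" for x :: "real^'q"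
  proof -
    have "(\<chi> j. sin (x $ j / \<rho>)) = (\<Sum>j\<in>UNIV. sin (x $ j / \<rho>) *\<^sub>R axis j (1::real))"
      using basis_expansion[of "\<chi> j. sin (x $ j / \<rho>)"] by (simp add: scalar_mult_eq_scaleR)
    then show ?thesis by (simp add: sum scaleR)
  qed
  then have "(\<lambda>x::real^'q. complex_of_real (f (\<chi> j. sin (x $ j / \<rho>)))) =
      (\<lambda>x. \<Sum>j\<in>UNIV. complex_of_real (sin (x $ j / \<rho>)) * complex_of_real (f (axis j 1)))"
    by simp
  moreover have "trig_poly (\<lambda>x::real^'q. \<Sum>j\<in>J. complex_of_real (sin (x $ j / \<rho>)) * complex_of_real (f (axis j 1)))" if "finite J" for J
    using that by (induction J rule: finite_induct) (auto intro!: trig_poly_const trig_poly.add trig_poly_mult *)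
  ultimately show ?case by simp
next
  case (const c)
  show ?case by (rule trig_poly_const)
next
  case (add f g)
  then show ?case by (simp add: trig_poly.add)
next
  case (mult f g)
  then show ?case by (simp add: trig_poly_mult)
qed

lemma trig_poly_integrable:
  assumes "finite_measure M" "X \<in> borel_measurable M" "trig_poly f"
  shows "integrable M (\<lambda>\<omega>. f (X \<omega> :: 'b::euclidean_space))"
  using assms(3)
proof (induction f rule: trig_poly.induct)
  case (cis c t)
  interpret finite_measure M by fact
  note [measurable] = assms(2)
  have "(\<lambda>\<omega>. cis (t \<bullet> X \<omega>)) \<in> borel_measurable M"
    by (rule borel_measurable_continuous_on[of cis]) (auto intro!: continuous_intros)
  then show ?case by (intro integrable_mult_right integrable_const_bound[where B=1]) auto
qed auto

lemma trig_poly_tendsto: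
  fixes X :: "nat \<Rightarrow> 'a \<Rightarrow> 'b::euclidean_space"
  assumes M: "\<And>n. prob_space (M n)" and X: "\<And>n. X n \<in> borel_measurable (M n)"
    and L: "prob_space L" "sets L = sets borel"
    and char: "\<And>t. (\<lambda>n. \<integral>\<omega>. cis (t \<bullet> X n \<omega>) \<partial>M n) \<longlonglongrightarrow> (\<integral>x. cis (t \<bullet> x) \<partial>L)"
    and f: "trig_poly f"
  shows "(\<lambda>n. \<integral>\<omega>. f (X n \<omega>) \<partial>M n) \<longlonglongrightarrow> (\<integral>x. f x \<partial>L)"
proof -
  have iM: "integrable (M n) (\<lambda>\<omega>. g (X n \<omega>))" if "trig_poly g" for g n
    using M[of n] X that by (intro trig_poly_integrable) (auto simp: prob_space_def)
  have idm: "(\<lambda>x. x) \<in> borel_measurable L" using measurable_ident_sets[OF L(2)] by simp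
  have iL: "integrable L g" if "trig_poly g" for g
    using trig_poly_integrable[OF _ idm that] L by (auto simp: prob_space_def)
  show ?thesis using f
  proof (induction f rule: trig_poly.induct)
    case (cis c t)
    show ?case using tendsto_mult_left[OF char[of t], of c] by simp
  next
    case (add f g)
    then show ?case by (simp add: iM iL tendsto_add)
  qed
qed

text \<open>Tightness reduces a bounded continuous \<open>g\<close> to a large box, on which \<open>g\<close> is uniformly close to a polynomial
  in the bounded functions \<open>sin (x\<^sub>j / \<rho>)\<close>; such a polynomial obeys the bound of \<open>g\<close> on all of space.\<close>
lemma sin_polynomial_approx:
  fixes g :: "real^'q::finite \<Rightarrow> real"
  assumes g: "continuous_on UNIV g" and B: "\<And>x. \<bar>g x\<bar> \<le> B" and e: "e > 0"
  obtains P \<rho> where "real_polynomial_function P" "\<rho> > 0"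
    and "\<And>x. norm x \<le> R \<Longrightarrow> \<bar>g x - P (\<chi> j. sin (x $ j / \<rho>))\<bar> \<le> e"
    and "\<And>x :: real^'q. \<bar>P (\<chi> j. sin (x $ j / \<rho>))\<bar> \<le> B + e"
proof -
  \<comment> \<open>Large enough that \<open>x $ j / \<rho>\<close> lies in \<open>[-1, 1]\<close>
    on the ball, inside the interval on which \<open>arcsin\<close> inverts
    \<open>sin\<close>.\<close>
  define \<rho> where "\<rho> = \<bar>R\<bar> + 1"
  have \<rho>: "\<rho> > 0" "\<bar>R\<bar> \<le> \<rho>" by (auto simp: \<rho>_def)
  define S where "S = (cbox (\<chi> j. - 1) (\<chi> j. 1) :: (real^'q) set)"
  have S: "compact S" by (simp add: S_def)
  have Sin: "y \<in> S \<longleftrightarrow> (\<forall>j. \<bar>y $ j\<bar> \<le> 1)" for y by (auto simp: S_def mem_box_cart abs_le_iff minus_le_iff)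
  \<comment> \<open>The function \<open>g\<close> transported to the cube \<open>S\<close>, where
    Stone--Weierstrass applies. Every point of sines lies in \<open>S\<close>, so the bound for
    \<open>P\<close> extends to the whole space.\<close>
  define h where "h y = g (\<chi> j. \<rho> * arcsin (y $ j))" for y :: "real^'q"
  have "continuous_on S h" unfolding h_def
    by (intro continuous_on_compose2[OF g] continuous_on_vec_lambda continuous_intros) (auto simp: Sin abs_le_iff minus_le_iff)
  from Stone_Weierstrass_real_polynomial_function[OF S this e]
  obtain P where P: "real_polynomial_function P" "\<And>y. y \<in> S \<Longrightarrow> \<bar>h y - P y\<bar> < e" by blast
  have sS: "(\<chi> j. sin (x $ j / \<rho>)) \<in> S" for x :: "real^'q" by (simp add: Sin abs_sin_le_one)
  show thesis
  proof (rule that[OF P(1) \<rho>(1)])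
    fix x :: "real^'q" assume x: "norm x \<le> R"
    have "\<rho> * arcsin (sin (x $ j / \<rho>)) = x $ j" for j
    proof -
      have "\<bar>x $ j\<bar> \<le> \<rho>" using component_le_norm_cart[of x j] x \<rho> by linarith
      then have "\<bar>x $ j / \<rho>\<bar> \<le> 1" using \<rho> by (simp add: abs_divide)
      then have "- (pi / 2) \<le> x $ j / \<rho>" "x $ j / \<rho> \<le> pi / 2" using pi_gt3 by linarith+
      then show ?thesis using \<rho> by (simp add: arcsin_sin)
    qed
    then have "h (\<chi> j. sin (x $ j / \<rho>)) = g x" by (simp add: h_def)
    then show "\<bar>g x - P (\<chi> j. sin (x $ j / \<rho>))\<bar> \<le> e" using P(2)[OF sS[of x]] by simp
  next
    fix x :: "real^'q"
    have "\<bar>h (\<chi> j. sin (x $ j / \<rho>))\<bar> \<le> B" by (simp add: h_def B)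
    then show "\<bar>P (\<chi> j. sin (x $ j / \<rho>))\<bar> \<le> B + e" using P(2)[OF sS[of x]] by linarith
  qed
qed

lemma integral_diff_le_off_event:
  fixes u v :: "'a \<Rightarrow> 'b::{banach, second_countable_topology}"
  assumes "prob_space M" "integrable M u" "integrable M v" "A \<in> sets M"
    and "\<And>\<omega>. \<omega> \<in> space M \<Longrightarrow> norm (u \<omega> - v \<omega>) \<le> C"
    and "\<And>\<omega>. \<omega> \<in> space M - A \<Longrightarrow> norm (u \<omega> - v \<omega>) \<le> e" "0 \<le> e"
  shows "norm ((\<integral>\<omega>. u \<omega> \<partial>M) - (\<integral>\<omega>. v \<omega> \<partial>M)) \<le> e + C * measure M A"
proof -
  interpret prob_space M by fact
  have ind: "integrable M (indicator A :: 'a \<Rightarrow> real)"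
    using assms by (intro integrable_real_indicator) (auto simp: emeasure_eq_measure)
  have "norm ((\<integral>\<omega>. u \<omega> \<partial>M) - (\<integral>\<omega>. v \<omega> \<partial>M)) = norm (\<integral>\<omega>. u \<omega> - v \<omega> \<partial>M)"
    using assms by simp
  also have "\<dots> \<le> (\<integral>\<omega>. norm (u \<omega> - v \<omega>) \<partial>M)" by (rule integral_norm_bound)
  also have "\<dots> \<le> (\<integral>\<omega>. e + C * indicator A \<omega> \<partial>M)"
  proof (rule integral_mono)
    fix \<omega> assume "\<omega> \<in> space M"
    then show "norm (u \<omega> - v \<omega>) \<le> e + C * indicator A \<omega>"
      using assms(5)[of \<omega>] assms(6)[of \<omega>] assms(7) by (auto simp: indicator_def)
  qed (use assms ind in auto)
  also have "\<dots> = e + C * measure M A" using assms ind by (simp add: prob_space)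
  finally show ?thesis .
qed

theorem levy_continuity_multivariate:
  fixes X :: "nat \<Rightarrow> 'a \<Rightarrow> real^'q::finite"
  assumes M: "\<And>n. prob_space (M n)" and X: "\<And>n. X n \<in> borel_measurable (M n)"
    and L: "prob_space L" "sets L = sets borel"
    and char: "\<And>t. (\<lambda>n. \<integral>\<omega>. cis (t \<bullet> X n \<omega>) \<partial>M n) \<longlonglongrightarrow> (\<integral>x. cis (t \<bullet> x) \<partial>L)"
    and tight: "bounded_prob M (\<lambda>n \<omega>. norm (X n \<omega>))"
  shows "conv_in_distr M X L"
  unfolding conv_in_distr_def
proof (intro conjI allI impI X)
  fix g :: "real^'q \<Rightarrow> real" assume "continuous_on UNIV g \<and> bounded (range g)"
  then have g: "continuous_on UNIV g" and "bounded (range g)" by auto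
  then obtain B where B: "\<And>x. \<bar>g x\<bar> \<le> B" by (auto simp: bounded_iff)
  then have B0: "B \<ge> 0" by (meson abs_ge_zero order_trans)
  interpret L: prob_space L by fact
  have gm: "g \<in> borel_measurable borel" using g by (rule borel_measurable_continuous_onI)
  show "(\<lambda>n. \<integral>\<omega>. g (X n \<omega>) \<partial>M n) \<longlonglongrightarrow> (\<integral>x. g x \<partial>L)"
  proof (rule tendstoI)
    fix \<epsilon> :: real assume \<epsilon>: "\<epsilon> > 0"
    \<comment> \<open>The two replacements of \<open>g\<close> by \<open>Q\<close> and the limit for
      \<open>Q\<close> cost together at most \<open>(4 * B + 5) * e\<close>, which is below
      \<open>4 * (e * (B + 2))\<close>. The cap 1 gives
      \<open>\<bar>g x - Q x\<bar> \<le> 2 * B + 1\<close>.\<close>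
    define e where "e = min 1 (\<epsilon> / (4 * (B + 2)))"
    have e: "e > 0" "e \<le> 1" using \<epsilon> B0 by (auto simp: e_def)
    have "e \<le> \<epsilon> / (4 * (B + 2))" by (simp add: e_def)
    then have ee: "4 * (e * (B + 2)) \<le> \<epsilon>" using B0 by (subst (asm) pos_le_divide_eq) (auto simp: algebra_simps)
    obtain R1 where R1: "\<forall>\<^sub>F n in sequentially. \<exists>A\<in>sets (M n). measure (M n) A \<le> e \<and>
        (\<forall>\<omega>\<in>space (M n) - A. norm (X n \<omega>) \<le> R1)"
      using tight e(1) unfolding bounded_prob_def outside_small_def by auto
    have "\<exists>R2. measure L {x. norm x > R2} \<le> e"
    proof -
      have "(\<lambda>k::nat. measure L {x. norm x > real k}) \<longlonglongrightarrow> measure L (\<Inter>k::nat. {x. norm x > real k})"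
        by (rule L.finite_Lim_measure_decseq) (auto simp: L(2) decseq_def)
      also have "(\<Inter>k::nat. {x::real^'q. norm x > real k}) = {}"
        by (auto simp: set_eq_iff not_less intro: real_arch_simple)
      finally have "(\<lambda>k::nat. measure L {x. norm x > real k}) \<longlonglongrightarrow> 0" by simp
      from order_tendstoD(2)[OF this e(1)] show ?thesis
        by (auto simp: eventually_sequentially intro: less_imp_le)
    qed
    then obtain R2 where R2: "measure L {x. norm x > R2} \<le> e" by blast
    obtain P \<rho> where P: "real_polynomial_function P" "\<rho> > 0"
      "\<And>x. norm x \<le> max R1 R2 \<Longrightarrow> \<bar>g x - P (\<chi> j. sin (x $ j / \<rho>))\<bar> \<le> e"
      "\<And>x :: real^'q. \<bar>P (\<chi> j. sin (x $ j / \<rho>))\<bar> \<le> B + e"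
      using sin_polynomial_approx[OF g B e(1)] by blast
    define Q where "Q x = P (\<chi> j. sin (x $ j / \<rho>))" for x :: "real^'q"
    have tQ: "trig_poly (\<lambda>x. complex_of_real (Q x))"
      unfolding Q_def by (rule trig_poly_polynomial_of_sin[OF P(1)])
    have "continuous_on UNIV Q" unfolding Q_def
      using continuous_real_polymonial_function[OF P(1)] P(2)
      by (intro continuous_on_compose2[OF continuous_at_imp_continuous_on, of UNIV P] continuous_on_vec_lambda continuous_intros) auto
    then have Qm: "Q \<in> borel_measurable borel" by (rule borel_measurable_continuous_onI)
    have dif: "\<bar>g x - Q x\<bar> \<le> 2 * B + 1" for x using B[of x] P(4)[of x] e by (simp add: Q_def abs_le_iff)
    have "(\<lambda>n. \<integral>\<omega>. complex_of_real (Q (X n \<omega>)) \<partial>M n) \<longlonglongrightarrow> (\<integral>x. complex_of_real (Q x) \<partial>L)"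
      by (rule trig_poly_tendsto[OF M X L char tQ])
    then have "(\<lambda>n. \<integral>\<omega>. Q (X n \<omega>) \<partial>M n) \<longlonglongrightarrow> (\<integral>x. Q x \<partial>L)"
      by (simp add: tendsto_of_real_iff)
    from tendstoD[OF this e(1)] R1
    show "\<forall>\<^sub>F n in sequentially. dist (\<integral>\<omega>. g (X n \<omega>) \<partial>M n) (\<integral>x. g x \<partial>L) < \<epsilon>"
    proof eventually_elim
      case (elim n)
      interpret Mn: prob_space "M n" by (rule M)
      from elim obtain A where A: "A \<in> sets (M n)" "measure (M n) A \<le> e" "\<forall>\<omega>\<in>space (M n) - A. norm (X n \<omega>) \<le> R1" by blast
      have "norm ((\<integral>\<omega>. g (X n \<omega>) \<partial>M n) - (\<integral>\<omega>. Q (X n \<omega>) \<partial>M n)) \<le> e + (2 * B + 1) * measure (M n) A"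
      proof (rule integral_diff_le_off_event[OF M _ _ A(1)])
        show "integrable (M n) (\<lambda>\<omega>. g (X n \<omega>))"
          using B measurable_compose[OF X gm] by (intro Mn.integrable_const_bound[where B=B]) auto
        show "integrable (M n) (\<lambda>\<omega>. Q (X n \<omega>))"
          using P(4) measurable_compose[OF X Qm] by (intro Mn.integrable_const_bound[where B="B + e"]) (auto simp: Q_def)
        show "norm (g (X n \<omega>) - Q (X n \<omega>)) \<le> e" if "\<omega> \<in> space (M n) - A" for \<omega>
          using P(3)[of "X n \<omega>"] bspec[OF A(3) that] by (simp add: Q_def le_max_iff_disj)
      qed (use dif e in auto)
      also have "\<dots> \<le> e + (2 * B + 1) * e" using A(2) B0 by (intro add_mono mult_left_mono) auto
      finally have 1: "\<bar>(\<integral>\<omega>. g (X n \<omega>) \<partial>M n) - (\<integral>\<omega>. Q (X n \<omega>) \<partial>M n)\<bar> \<le> e + (2 * B + 1) * e" by simp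
      have "norm ((\<integral>x. g x \<partial>L) - (\<integral>x. Q x \<partial>L)) \<le> e + (2 * B + 1) * measure L {x. norm x > R2}"
      proof (rule integral_diff_le_off_event[OF L(1)])
        show "integrable L g"
          using B gm L(2) by (intro L.integrable_const_bound[where B=B]) (auto cong: measurable_cong_sets)
        show "integrable L Q"
          using P(4) Qm L(2) by (intro L.integrable_const_bound[where B="B + e"]) (auto simp: Q_def cong: measurable_cong_sets)
        show "norm (g x - Q x) \<le> e" if "x \<in> space L - {x. norm x > R2}" for x
          using P(3)[of x] that by (simp add: Q_def le_max_iff_disj not_less)
      qed (use dif e L(2) in auto)
      also have "\<dots> \<le> e + (2 * B + 1) * e" using R2 B0 by (intro add_mono mult_left_mono) auto
      finally have 2: "\<bar>(\<integral>x. g x \<partial>L) - (\<integral>x. Q x \<partial>L)\<bar> \<le> e + (2 * B + 1) * e" by simp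
      have "\<bar>(\<integral>\<omega>. g (X n \<omega>) \<partial>M n) - (\<integral>x. g x \<partial>L)\<bar> < 2 * (e + (2 * B + 1) * e) + e"
      proof -
        have "\<bar>a - c\<bar> < 2 * D + e" if "\<bar>a - b\<bar> \<le> D" "\<bar>c - d\<bar> \<le> D" "\<bar>b - d\<bar> < e" for a b c d D :: real
          using that by linarith
        from this[OF 1 2] elim(1) show ?thesis by (simp add: dist_real_def)
      qed
      also have "\<dots> \<le> 4 * (e * (B + 2))" using e by (simp add: algebra_simps)
      finally show ?case using ee by (simp add: dist_real_def)
    qed
  qed
qed

subsection \<open>Existence of multivariate normal distributions\<close>

text \<open>Schur complements write a positive semidefinite form as a sum of squares; for a vanishing pivot
  the corresponding row vanishes too.\<close>
lemma psd_form_sum_of_squares: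
  fixes a :: "'i \<Rightarrow> 'i \<Rightarrow> real"
  assumes "finite J" and sym: "\<And>i j. a i j = a j i"
    and psd: "\<And>c. 0 \<le> (\<Sum>i\<in>J. \<Sum>j\<in>J. c i * c j * a i j)"
  shows "\<exists>b. \<forall>i\<in>J. \<forall>j\<in>J. a i j = (\<Sum>k\<in>J. b k i * b k j)"
  using assms
proof (induction J arbitrary: a rule: finite_induct)
  case empty
  then show ?case by simp
next
  case (insert x J)
  note sym = insert.prems(1) and psd = insert.prems(2)
  have expand: "(\<Sum>i\<in>insert x J. \<Sum>j\<in>insert x J. c i * c j * a i j) =
      c x * c x * a x x + 2 * c x * (\<Sum>j\<in>J. c j * a x j) + (\<Sum>i\<in>J. \<Sum>j\<in>J. c i * c j * a i j)" for c
  proof -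
    have "(\<Sum>i\<in>J. c i * c x * a i x) = c x * (\<Sum>j\<in>J. c j * a x j)"
      by (simp add: sum_distrib_left sym[of _ x] ac_simps)
    moreover have "(\<Sum>j\<in>J. c x * c j * a x j) = c x * (\<Sum>j\<in>J. c j * a x j)"
      by (simp add: sum_distrib_left ac_simps)
    ultimately show ?thesis using insert.hyps by (simp add: sum.distrib)
  qed
  have axx: "0 \<le> a x x"
    using psd[of "\<lambda>i. if i = x then 1 else 0"] unfolding expand using insert.hyps
    by (simp add: if_distrib[of "\<lambda>z. z * _"] sum.neutral cong: if_cong)
  have zero: "a x j = 0" if "a x x = 0" "j \<in> J" for j
  proof (rule ccontr)
    assume nz: "a x j \<noteq> 0"
    \<comment> \<open>With coefficient \<open>s\<close> at \<open>x\<close> and 1 at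
      \<open>j\<close> the form equals \<open>2 * s * a x j + a j j\<close>; this \<open>s\<close>
      makes it -1.\<close>
    define s where "s = - (a j j + 1) / (2 * a x j)"
    let ?c = "\<lambda>i. if i = x then s else if i = j then 1 else 0 :: real"
    have xj: "x \<noteq> j" using that insert.hyps by auto
    have 1: "(\<Sum>k\<in>J. ?c k * a x k) = a x j"
      using that insert.hyps by (subst sum.mono_neutral_cong_right[of J "{j}"]) auto
    have 2: "(\<Sum>i\<in>J. \<Sum>k\<in>J. ?c i * ?c k * a i k) = a j j"
    proof -
      have "(\<Sum>k\<in>J. ?c i * ?c k * a i k) = (if i = j then a j j else 0)" if "i \<in> J" for i
        using that \<open>j \<in> J\<close> insert.hyps xj by (subst sum.mono_neutral_cong_right[of J "{j}"]) auto
      then show ?thesis using that insert.hyps by simp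
    qed
    have "0 \<le> 2 * s * a x j + a j j" using psd[of ?c] unfolding expand 1 2 using that by simp
    also have "\<dots> = -1" using nz by (simp add: s_def field_simps)
    finally show False by simp
  qed
  define a' where "a' i j = a i j - a x i * a x j / a x x" for i j
  have "\<exists>b. \<forall>i\<in>J. \<forall>j\<in>J. a' i j = (\<Sum>k\<in>J. b k i * b k j)"
  proof (rule insert.IH)
    fix i j show "a' i j = a' j i" by (simp add: a'_def sym[of i j] mult.commute)
  next
    fix c
    define T where "T = (\<Sum>j\<in>J. c j * a x j)"
    \<comment> \<open>The value at \<open>x\<close> minimises the form when the other coefficients
      are fixed, and what remains is the form of the Schur complement. If the pivot is 0, then
      \<open>T = 0\<close> as well and the quotient is 0.\<close>
    define d where "d = (\<lambda>i. if i = x then - T / a x x else c i)"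
    have dJ: "d i = c i" if "i \<in> J" for i using that insert.hyps by (auto simp: d_def)
    have "0 \<le> d x * d x * a x x + 2 * d x * (\<Sum>j\<in>J. d j * a x j) + (\<Sum>i\<in>J. \<Sum>j\<in>J. d i * d j * a i j)"
      using psd[of d] unfolding expand .
    also have "\<dots> = (\<Sum>i\<in>J. \<Sum>j\<in>J. c i * c j * a i j) - T * T / a x x"
      using zero by (cases "a x x = 0") (simp_all add: dJ d_def[THEN fun_cong, of x] T_def[symmetric] cong: sum.cong)
    also have "T * T / a x x = (\<Sum>i\<in>J. \<Sum>j\<in>J. c i * c j * (a x i * a x j / a x x))"
      by (simp add: T_def sum_product sum_divide_distrib ac_simps)
    also have "(\<Sum>i\<in>J. \<Sum>j\<in>J. c i * c j * a i j) - \<dots> = (\<Sum>i\<in>J. \<Sum>j\<in>J. c i * c j * a' i j)"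
      by (simp add: a'_def right_diff_distrib sum_subtractf)
    finally show "0 \<le> (\<Sum>i\<in>J. \<Sum>j\<in>J. c i * c j * a' i j)" .
  qed
  then obtain b where b: "\<And>i j. i \<in> J \<Longrightarrow> j \<in> J \<Longrightarrow> a' i j = (\<Sum>k\<in>J. b k i * b k j)" by blast
  \<comment> \<open>One new square accounts for the pivot row, and the squares of the complement are
    extended by 0 at \<open>x\<close>.\<close>
  define b' where "b' k i = (if k = x then a x i / sqrt (a x x) else if i = x then 0 else b k i)" for k i
  have b'J: "(\<Sum>k\<in>J. b' k i * b' k j) = (if i = x \<or> j = x then 0 else (\<Sum>k\<in>J. b k i * b k j))" for i j
    using insert.hyps by (auto simp: b'_def intro!: sum.cong sum.neutral)
  have bx: "b' x i * b' x j = a x i * a x j / a x x" for i j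
    using axx by (simp add: b'_def real_sqrt_mult_self)
  have "a i j = (\<Sum>k\<in>insert x J. b' k i * b' k j)" if "i \<in> insert x J" "j \<in> insert x J" for i j
  proof (cases "i = x \<or> j = x")
    case True
    then have "a x i * a x j / a x x = a i j"
      using that zero sym[of i x] by (cases "a x x = 0") auto
    then show ?thesis using insert.hyps True by (simp add: b'J bx)
  next
    case False
    then have "a i j = a x i * a x j / a x x + (\<Sum>k\<in>J. b k i * b k j)"
      using that b[of i j] by (simp add: a'_def)
    then show ?thesis using insert.hyps False by (simp add: b'J bx)
  qed
  then show ?case by blast
qed

lemma integral_cis_std_normal:
  "(\<integral>g. cis (s * g) \<partial>std_normal_distribution) = complex_of_real (exp (- s\<^sup>2 / 2))"
proof -
  have "char std_normal_distribution s = complex_of_real (exp (- (s^2) / 2))"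
    by (simp add: char_std_normal_distribution)
  then show ?thesis by (simp add: char_def cis_conv_exp mult.commute)
qed

lemma cis_sum: "finite J \<Longrightarrow> cis (\<Sum>k\<in>J. f k) = (\<Prod>k\<in>J. cis (f k))"
  by (induction J rule: finite_induct) (auto simp: cis_mult[symmetric])

text \<open>The law of a linear image of independent standard normal variables, with coefficients
  from a factorisation of \<open>S\<close>. Degenerate covariances, such as the zero matrix, are
  included.\<close>

lemma mvnormal_exists:
  fixes S :: "real^'q::finite^'q"
  assumes sym: "\<And>i j. S $ i $ j = S $ j $ i" and psd: "\<And>t. 0 \<le> t \<bullet> (S *v t)"
  shows "\<exists>L. is_mvnormal L S"
proof -
  have quad: "t \<bullet> (S *v t) = (\<Sum>i\<in>UNIV. \<Sum>j\<in>UNIV. t $ i * t $ j * S $ i $ j)" for t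
    by (simp add: inner_vec_def matrix_vector_mult_def sum_distrib_left ac_simps)
  have "\<exists>b. \<forall>i\<in>UNIV. \<forall>j\<in>UNIV. S $ i $ j = (\<Sum>k\<in>(UNIV::'q set). b k i * b k j)"
  proof (rule psd_form_sum_of_squares)
    fix c show "0 \<le> (\<Sum>i\<in>UNIV. \<Sum>j\<in>UNIV. c i * c j * S $ i $ j)"
      using psd[of "\<chi> i. c i"] unfolding quad by simp
  qed (auto intro: sym)
  then obtain b :: "'q \<Rightarrow> 'q \<Rightarrow> real" where b: "\<And>i j. S $ i $ j = (\<Sum>k\<in>UNIV. b k i * b k j)" by blast
  define \<beta> :: "'q \<Rightarrow> real^'q" where "\<beta> k = (\<chi> i. b k i)" for k
  have quad2: "t \<bullet> (S *v t) = (\<Sum>k\<in>UNIV. (t \<bullet> \<beta> k)\<^sup>2)" for t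
  proof -
    have "(t \<bullet> \<beta> k)\<^sup>2 = (\<Sum>i\<in>UNIV. \<Sum>j\<in>UNIV. t $ i * t $ j * (b k i * b k j))" for k
      by (simp add: \<beta>_def inner_vec_def power2_eq_square sum_product ac_simps)
    then have "(\<Sum>k\<in>UNIV. (t \<bullet> \<beta> k)\<^sup>2) = (\<Sum>i\<in>UNIV. \<Sum>k\<in>UNIV. \<Sum>j\<in>UNIV. t $ i * t $ j * (b k i * b k j))"
      by (simp only:) (rule sum.swap)
    also have "\<dots> = (\<Sum>i\<in>UNIV. \<Sum>j\<in>UNIV. \<Sum>k\<in>UNIV. t $ i * t $ j * (b k i * b k j))"
      by (intro sum.cong refl sum.swap)
    also have "\<dots> = t \<bullet> (S *v t)" by (simp add: quad b sum_distrib_left)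
    finally show ?thesis by simp
  qed
  define N where "N = (\<Pi>\<^sub>M k\<in>(UNIV::'q set). std_normal_distribution)"
  interpret PN: product_prob_space "\<lambda>_::'q. std_normal_distribution" UNIV
    by (rule product_prob_spaceI) (simp add: prob_space_normal_density)
  define T where "T g = (\<Sum>k\<in>UNIV. g k *\<^sub>R \<beta> k)" for g :: "'q \<Rightarrow> real"
  have Tm: "T \<in> borel_measurable N"
  proof -
    have "(\<lambda>g. g k) \<in> borel_measurable N" for k
    proof -
      have "(\<lambda>g. g k) \<in> measurable N std_normal_distribution"
        unfolding N_def by (rule measurable_component_singleton) simp
      then show ?thesis by (simp cong: measurable_cong_sets)
    qed
    then show ?thesis unfolding T_def by (intro borel_measurable_sum borel_measurable_scaleR) auto
  qed
  define L where "L = distr N borel T"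
  have N: "prob_space N" unfolding N_def by (rule PN.prob_space_axioms)
  have "(\<integral>x. cis (t \<bullet> x) \<partial>L) = complex_of_real (exp (- (t \<bullet> (S *v t)) / 2))" for t
  proof -
    have cm: "(\<lambda>x::real^'q. cis (t \<bullet> x)) \<in> borel_measurable borel"
      by (intro borel_measurable_continuous_onI continuous_intros)
    have "(\<integral>x. cis (t \<bullet> x) \<partial>L) = (\<integral>g. cis (t \<bullet> T g) \<partial>N)"
      unfolding L_def by (rule integral_distr[OF Tm cm])
    also have "\<dots> = (\<integral>g. (\<Prod>k\<in>UNIV. cis ((t \<bullet> \<beta> k) * g k)) \<partial>N)"
      by (simp add: T_def inner_sum_right cis_sum mult.commute)
    also have "\<dots> = (\<Prod>k\<in>UNIV. \<integral>y. cis ((t \<bullet> \<beta> k) * y) \<partial>std_normal_distribution)"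
      unfolding N_def
    proof (rule PN.product_integral_prod)
      fix k :: 'q
      have "prob_space std_normal_distribution" by (simp add: prob_space_normal_density)
      then have fin: "finite_measure std_normal_distribution" by (simp add: prob_space_def)
      have "(\<lambda>y::real. cis ((t \<bullet> \<beta> k) * y)) \<in> borel_measurable borel"
        by (intro borel_measurable_continuous_onI continuous_intros)
      then show "integrable std_normal_distribution (\<lambda>y. cis ((t \<bullet> \<beta> k) * y))"
        by (intro finite_measure.integrable_const_bound[OF fin, where B=1]) auto
    qed simp
    also have "\<dots> = (\<Prod>k\<in>UNIV. complex_of_real (exp (- (t \<bullet> \<beta> k)\<^sup>2 / 2)))"
      by (simp only: integral_cis_std_normal)
    also have "\<dots> = complex_of_real (exp (- (t \<bullet> (S *v t)) / 2))"
      by (simp add: quad2 of_real_prod[symmetric] exp_sum[symmetric] sum_negf sum_divide_distrib)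
    finally show ?thesis .
  qed
  moreover have "prob_space L" unfolding L_def using N Tm by (rule prob_space.prob_space_distr)
  moreover have "sets L = sets borel" by (simp add: L_def)
  ultimately show ?thesis unfolding is_mvnormal_def by blast
qed

subsection \<open>Moments of sub-Gaussian variables\<close>

text \<open>The constant is \<open>4 ^ 4\<close>, from the fourth power of
  \<open>y / 4 \<le> exp (y / 4)\<close>.\<close>

lemma fourth_power_le_exp: "(x::real) ^ 4 \<le> 256 * (exp x + exp (- x))"
proof -
  have *: "y ^ 4 \<le> 256 * exp y" if "y \<ge> 0" for y :: real
  proof -
    have "y / 4 \<le> exp (y / 4)" using exp_ge_add_one_self[of "y / 4"] by linarith
    then have "(y / 4) ^ 4 \<le> exp (y / 4) ^ 4" using that by (intro power_mono) auto
    also have "exp (y / 4) ^ 4 = exp y" by (simp add: exp_of_nat_mult[symmetric])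
    finally show ?thesis by (simp add: power_divide)
  qed
  show ?thesis
  proof (cases "x \<ge> 0")
    case True
    have "x ^ 4 \<le> 256 * exp x" using *[OF True] .
    also have "\<dots> \<le> 256 * (exp x + exp (- x))" by simp
    finally show ?thesis .
  next
    case False
    have "x ^ 4 = (- x) ^ 4" by simp
    also have "\<dots> \<le> 256 * exp (- x)" using False by (intro *) simp
    also have "\<dots> \<le> 256 * (exp x + exp (- x))" by simp
    finally show ?thesis .
  qed
qed

lemma abs_power_le_fourth: "k \<le> 4 \<Longrightarrow> \<bar>x::real\<bar> ^ k \<le> 1 + x ^ 4"
proof (cases "\<bar>x\<bar> \<le> 1")
  case True
  then have "\<bar>x\<bar> ^ k \<le> 1" by (simp add: power_le_one)
  moreover have "0 \<le> x ^ 4" by simp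
  ultimately show ?thesis by linarith
next
  case False
  assume "k \<le> 4"
  then have "\<bar>x\<bar> ^ k \<le> \<bar>x\<bar> ^ 4" using False by (intro power_increasing) auto
  then show ?thesis by simp
qed

lemma square_le_exp: "(x::real)\<^sup>2 \<le> 257 * (exp x + exp (- x))"
proof -
  have 1: "1 \<le> exp x + exp (- x)"
    using exp_ge_add_one_self[of x] exp_ge_add_one_self[of "-x"] by linarith
  have "x\<^sup>2 \<le> 1 + x ^ 4" using abs_power_le_fourth[of 2 x] by simp
  also have "\<dots> \<le> (exp x + exp (- x)) + 256 * (exp x + exp (- x))"
    by (rule add_mono[OF 1 fourth_power_le_exp])
  finally show ?thesis by simp
qed

text \<open>The exponential moments at 1 and -1 suffice, whence the constant
  \<open>2 * 256\<close>.\<close>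

lemma subgaussian_fourth_moment:
  assumes "prob_space M" "subgaussian M \<xi> K"
  shows "integrable M (\<lambda>\<omega>. \<xi> \<omega> ^ 4)" "(\<integral>\<omega>. \<xi> \<omega> ^ 4 \<partial>M) \<le> 512 * exp (K\<^sup>2 / 2)"
proof -
  have \<xi>: "\<xi> \<in> borel_measurable M" using assms(2) by (auto simp: subgaussian_def)
  note [measurable] = \<xi>
  have i: "integrable M (\<lambda>\<omega>. exp (1 * \<xi> \<omega>))" "integrable M (\<lambda>\<omega>. exp (-1 * \<xi> \<omega>))"
    and e: "(\<integral>\<omega>. exp (1 * \<xi> \<omega>) \<partial>M) \<le> exp (K\<^sup>2 * 1\<^sup>2 / 2)" "(\<integral>\<omega>. exp (-1 * \<xi> \<omega>) \<partial>M) \<le> exp (K\<^sup>2 * (-1)\<^sup>2 / 2)"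
    using assms(2) unfolding subgaussian_def by blast+
  have int: "integrable M (\<lambda>\<omega>. 256 * (exp (1 * \<xi> \<omega>) + exp (-1 * \<xi> \<omega>)))" using i by simp
  show 4: "integrable M (\<lambda>\<omega>. \<xi> \<omega> ^ 4)"
    by (rule Bochner_Integration.integrable_bound[OF int]) (use fourth_power_le_exp in \<open>auto simp: abs_mult\<close>)
  have "(\<integral>\<omega>. \<xi> \<omega> ^ 4 \<partial>M) \<le> (\<integral>\<omega>. 256 * (exp (1 * \<xi> \<omega>) + exp (-1 * \<xi> \<omega>)) \<partial>M)"
    using 4 int by (rule integral_mono) (use fourth_power_le_exp in auto)
  also have "\<dots> = 256 * ((\<integral>\<omega>. exp (1 * \<xi> \<omega>) \<partial>M) + (\<integral>\<omega>. exp (-1 * \<xi> \<omega>) \<partial>M))" using i by simp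
  also have "\<dots> \<le> 512 * exp (K\<^sup>2 / 2)" using e by simp
  finally show "(\<integral>\<omega>. \<xi> \<omega> ^ 4 \<partial>M) \<le> 512 * exp (K\<^sup>2 / 2)" .
qed

lemma integrable_abs_power:
  assumes "prob_space M" "\<xi> \<in> borel_measurable M" "integrable M (\<lambda>\<omega>. \<xi> \<omega> ^ 4)" "k \<le> 4"
  shows "integrable M (\<lambda>\<omega>. \<bar>\<xi> \<omega> :: real\<bar> ^ k)" "(\<integral>\<omega>. \<bar>\<xi> \<omega>\<bar> ^ k \<partial>M) \<le> 1 + (\<integral>\<omega>. \<xi> \<omega> ^ 4 \<partial>M)"
proof -
  interpret prob_space M by fact
  note [measurable] = assms(2)
  have int: "integrable M (\<lambda>\<omega>. 1 + \<xi> \<omega> ^ 4)" using assms by simp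
  show i: "integrable M (\<lambda>\<omega>. \<bar>\<xi> \<omega>\<bar> ^ k)"
    by (rule Bochner_Integration.integrable_bound[OF int]) (use abs_power_le_fourth[OF assms(4)] in \<open>auto\<close>)
  have "(\<integral>\<omega>. \<bar>\<xi> \<omega>\<bar> ^ k \<partial>M) \<le> (\<integral>\<omega>. 1 + \<xi> \<omega> ^ 4 \<partial>M)"
    using i int by (rule integral_mono) (rule abs_power_le_fourth[OF assms(4)])
  then show "(\<integral>\<omega>. \<bar>\<xi> \<omega>\<bar> ^ k \<partial>M) \<le> 1 + (\<integral>\<omega>. \<xi> \<omega> ^ 4 \<partial>M)" using assms by (simp add: prob_space)
qed

text \<open>Scaling \<open>e\<close> to a unit vector before comparing with exponentials makes the
  bound proportional to \<open>sqn n e\<close>; the constant is \<open>2 * 257\<close>.\<close>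

lemma subgaussian_vector_second_moment:
  assumes meas: "\<And>i. i < n \<Longrightarrow> (\<lambda>\<omega>. \<xi> \<omega> i) \<in> borel_measurable M"
    and sub: "\<And>l. (\<integral>\<^sup>+\<omega>. ennreal (exp (inn n l (\<xi> \<omega>))) \<partial>M) \<le> ennreal (exp (K\<^sup>2 * sqn n l / 2))"
  shows "(\<integral>\<^sup>+\<omega>. ennreal ((inn n e (\<xi> \<omega>))\<^sup>2) \<partial>M) \<le> ennreal (514 * exp (K\<^sup>2 / 2) * sqn n e)"
proof (cases "sqn n e = 0")
  case True
  then have "inn n e (\<xi> \<omega>) = inn n (\<lambda>i. 0) (\<xi> \<omega>)" for \<omega> by (intro inn_cong) (auto dest: sqn_eq_0D)
  then show ?thesis by simp
next
  case False
  then have pos: "sqn n e > 0" using sqn_nonneg[of n e] by linarith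
  define l where "l = (\<lambda>i. 1 / sqrt (sqn n e) * e i)"
  define l' where "l' = (\<lambda>i. -1 * l i)"
  have l: "sqn n l = 1" unfolding l_def sqn_scale using pos by (simp add: power_divide)
  have l': "sqn n l' = 1" unfolding l'_def sqn_scale using l by simp
  have il': "inn n l' v = - inn n l v" for v unfolding l'_def inn_linear by simp
  have eq: "(inn n e v)\<^sup>2 = sqn n e * (inn n l v)\<^sup>2" for v
    unfolding l_def inn_linear using pos by (simp add: power_mult_distrib power_divide)
  have [measurable]: "(\<lambda>\<omega>. inn n l (\<xi> \<omega>)) \<in> borel_measurable M" using meas by (intro measurable_inn) auto
  have "(\<integral>\<^sup>+\<omega>. ennreal ((inn n e (\<xi> \<omega>))\<^sup>2) \<partial>M) \<le>
      (\<integral>\<^sup>+\<omega>. ennreal (sqn n e * 257) * (ennreal (exp (inn n l (\<xi> \<omega>))) + ennreal (exp (inn n l' (\<xi> \<omega>)))) \<partial>M)"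
  proof (rule nn_integral_mono)
    fix \<omega>
    have "sqn n e * (inn n l (\<xi> \<omega>))\<^sup>2 \<le> sqn n e * (257 * (exp (inn n l (\<xi> \<omega>)) + exp (- inn n l (\<xi> \<omega>))))"
      using square_le_exp pos by (intro mult_left_mono) auto
    then show "ennreal ((inn n e (\<xi> \<omega>))\<^sup>2) \<le> ennreal (sqn n e * 257) * (ennreal (exp (inn n l (\<xi> \<omega>))) + ennreal (exp (inn n l' (\<xi> \<omega>))))"
      unfolding eq il' by (simp add: ennreal_plus[symmetric] ennreal_mult'[symmetric] mult.assoc ennreal_leI del: ennreal_plus)
  qed
  also have "\<dots> = ennreal (sqn n e * 257) * ((\<integral>\<^sup>+\<omega>. ennreal (exp (inn n l (\<xi> \<omega>))) \<partial>M) + (\<integral>\<^sup>+\<omega>. ennreal (exp (inn n l' (\<xi> \<omega>))) \<partial>M))"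
    unfolding il' by (subst nn_integral_cmult, measurable, subst nn_integral_add) auto
  also have "\<dots> \<le> ennreal (sqn n e * 257) * (ennreal (exp (K\<^sup>2 / 2)) + ennreal (exp (K\<^sup>2 / 2)))"
    using sub[of l] sub[of l'] l l' by (intro mult_left_mono add_mono) auto
  also have "\<dots> = ennreal (514 * exp (K\<^sup>2 / 2) * sqn n e)"
    by (simp add: ennreal_plus[symmetric] ennreal_mult'[symmetric] mult_ac del: ennreal_plus)
  finally show ?thesis .
qed

lemma integrable_square_nn_integral:
  assumes "X \<in> borel_measurable M" "(\<integral>\<^sup>+\<omega>. ennreal ((X \<omega>)\<^sup>2) \<partial>M) \<le> ennreal v" "0 \<le> v"
  shows "integrable M (\<lambda>\<omega>. (X \<omega>)\<^sup>2) \<and> (\<integral>\<omega>. (X \<omega> :: real)\<^sup>2 \<partial>M) \<le> v"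
proof -
  note [measurable] = assms(1)
  have "(\<integral>\<^sup>+\<omega>. ennreal (norm ((X \<omega>)\<^sup>2)) \<partial>M) < \<infinity>"
    using assms(2) by (simp add: le_less_trans[OF _ ennreal_less_top])
  then have i: "integrable M (\<lambda>\<omega>. (X \<omega>)\<^sup>2)" by (intro integrableI_bounded) auto
  have "(\<integral>\<^sup>+\<omega>. ennreal ((X \<omega>)\<^sup>2) \<partial>M) = ennreal (\<integral>\<omega>. (X \<omega>)\<^sup>2 \<partial>M)"
    using i by (rule nn_integral_eq_integral) simp
  then show ?thesis using i assms(2,3) by simp
qed

lemma indep_sum_second_moment:
  fixes U :: "nat \<Rightarrow> 'a \<Rightarrow> real"
  assumes M: "prob_space M" and ind: "prob_space.indep_vars M (\<lambda>_. borel) U {..<n}"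
    and sq: "\<And>i. i < n \<Longrightarrow> integrable M (\<lambda>\<omega>. (U i \<omega>)\<^sup>2)" and int: "\<And>i. i < n \<Longrightarrow> integrable M (U i)"
    and mean: "\<And>i. i < n \<Longrightarrow> (\<integral>\<omega>. U i \<omega> \<partial>M) = 0" and v: "\<And>i. i < n \<Longrightarrow> (\<integral>\<omega>. (U i \<omega>)\<^sup>2 \<partial>M) \<le> v"
  shows "integrable M (\<lambda>\<omega>. (\<Sum>i<n. U i \<omega>)\<^sup>2) \<and> (\<integral>\<omega>. (\<Sum>i<n. U i \<omega>)\<^sup>2 \<partial>M) \<le> real n * v"
proof -
  interpret prob_space M by fact
  have eq: "(\<Sum>i<n. U i \<omega>)\<^sup>2 = (\<Sum>i<n. \<Sum>k<n. U i \<omega> * U k \<omega>)" for \<omega>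
    by (simp add: power2_eq_square sum_product)
  have ik: "integrable M (\<lambda>\<omega>. U i \<omega> * U k \<omega>) \<and> (\<integral>\<omega>. U i \<omega> * U k \<omega> \<partial>M) \<le> (if i = k then v else 0)"
    if "i < n" "k < n" for i k
  proof (cases "i = k")
    case True
    then show ?thesis using sq[of i] v[of i] that by (simp add: power2_eq_square)
  next
    case False
    have ind': "indep_vars (\<lambda>_. borel) U {i, k}" using that by (intro indep_vars_subset[OF ind]) auto
    have "integrable M (\<lambda>\<omega>. \<Prod>j\<in>{i, k}. U j \<omega>)" "(\<integral>\<omega>. (\<Prod>j\<in>{i, k}. U j \<omega>) \<partial>M) = (\<Prod>j\<in>{i, k}. \<integral>\<omega>. U j \<omega> \<partial>M)"
      using that int by (intro indep_vars_integrable[OF _ ind'] indep_vars_lebesgue_integral[OF _ ind']; auto)+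
    then show ?thesis using False mean that by simp
  qed
  have ii: "integrable M (\<lambda>\<omega>. U i \<omega> * U k \<omega>)" if "i < n" "k < n" for i k using ik[OF that] by simp
  have "(\<integral>\<omega>. (\<Sum>i<n. \<Sum>k<n. U i \<omega> * U k \<omega>) \<partial>M) = (\<Sum>i<n. \<integral>\<omega>. (\<Sum>k<n. U i \<omega> * U k \<omega>) \<partial>M)"
    by (rule Bochner_Integration.integral_sum) (auto intro!: Bochner_Integration.integrable_sum ii)
  also have "\<dots> = (\<Sum>i<n. \<Sum>k<n. \<integral>\<omega>. U i \<omega> * U k \<omega> \<partial>M)"
    by (intro sum.cong refl Bochner_Integration.integral_sum) (auto intro: ii)
  also have "\<dots> \<le> (\<Sum>i<n. \<Sum>k<n. if i = k then v else 0)"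
    using ik by (intro sum_mono) auto
  also have "\<dots> = real n * v" by simp
  finally show ?thesis unfolding eq by (auto intro!: Bochner_Integration.integrable_sum ii)
qed

text \<open>A cubic remainder that is uniform over all laws with these moments. It is applied at a
  frequency \<open>s\<close> that depends on a row of \<open>H\<close>, so the dependence on
  \<open>s\<close> must be explicit enough to be integrated afterwards.\<close>

lemma char_approx_fourth_moment:
  assumes M: "prob_space M" and X: "X \<in> borel_measurable M" and 4: "integrable M (\<lambda>\<omega>. X \<omega> ^ 4)"
    and mean: "(\<integral>\<omega>. X \<omega> \<partial>M) = 0" and var: "(\<integral>\<omega>. (X \<omega>)\<^sup>2 \<partial>M) = \<sigma>2"
    and C: "(\<integral>\<omega>. X \<omega> ^ 4 \<partial>M) \<le> C"
  shows "cmod ((\<integral>\<omega>. cis (s * X \<omega>) \<partial>M) - complex_of_real (1 - s\<^sup>2 * \<sigma>2 / 2)) \<le> \<bar>s\<bar> ^ 3 * (1 + C)"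
proof -
  interpret prob_space M by fact
  note [measurable] = X
  have i1: "integrable M X" using integrable_abs_power(1)[OF M X 4, of 1] integrable_abs_iff[OF X] by simp
  have i2: "integrable M (\<lambda>\<omega>. (X \<omega>)\<^sup>2)" using integrable_abs_power(1)[OF M X 4, of 2] by simp
  note i3 = integrable_abs_power[OF M X 4, of 3]
  have ch: "char (distr M borel X) s = (\<integral>\<omega>. cis (s * X \<omega>) \<partial>M)"
    by (simp add: char_def integral_distr cis_conv_exp)
  have "variance X = \<sigma>2" using mean var by simp
  then have "cmod (char (distr M borel X) s - (1 - s\<^sup>2 * \<sigma>2 / 2)) \<le>
      (s\<^sup>2 / 6) * expectation (\<lambda>x. min (6 * (X x)\<^sup>2) (\<bar>s\<bar> * \<bar>X x\<bar> ^ 3))"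
    using i1 i2 mean by (intro char_approx3'[OF X]) auto
  also have "\<dots> \<le> (s\<^sup>2 / 6) * (\<bar>s\<bar> * (1 + C))"
  proof (rule mult_left_mono)
    have "expectation (\<lambda>x. min (6 * (X x)\<^sup>2) (\<bar>s\<bar> * \<bar>X x\<bar> ^ 3)) \<le> expectation (\<lambda>x. \<bar>s\<bar> * \<bar>X x\<bar> ^ 3)"
      using i2 i3 by (intro integral_mono integrable_min integrable_mult_right) auto
    also have "\<dots> \<le> \<bar>s\<bar> * (1 + C)"
      using i3(2) C by (auto intro!: mult_left_mono)
    finally show "expectation (\<lambda>x. min (6 * (X x)\<^sup>2) (\<bar>s\<bar> * \<bar>X x\<bar> ^ 3)) \<le> \<bar>s\<bar> * (1 + C)" .
  qed simp
  also have "\<dots> = \<bar>s\<bar> ^ 3 * ((1 + C) / 6)" by (simp add: power3_eq_cube power2_eq_square)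
  also have "\<dots> \<le> \<bar>s\<bar> ^ 3 * (1 + C)"
  proof -
    have "0 \<le> C" using C by (rule order_trans[rotated]) simp
    then show ?thesis by (intro mult_left_mono) auto
  qed
  finally show ?thesis unfolding ch by simp
qed

subsection \<open>Law of large numbers and central limit theorem for the noise\<close>

lemma borel_measurable_vec_nth:
  "f \<in> borel_measurable N \<Longrightarrow> (\<lambda>x. (f x :: real^'q::finite) $ j) \<in> borel_measurable N"
  by (erule measurable_compose) (intro borel_measurable_continuous_onI continuous_on_component continuous_on_id)

lemma product_square_le: "((x::real) * y)\<^sup>2 \<le> x ^ 4 + y ^ 4"
proof -
  have "2 * (x * y)\<^sup>2 \<le> x ^ 4 + y ^ 4"
    using sum_squares_bound[of "x\<^sup>2" "y\<^sup>2"] by (simp add: power_mult_distrib power_mult[symmetric])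
  then show ?thesis using zero_le_power2[of "x * y"] by linarith
qed

text \<open>Collects the assumptions on \<open>H\<close> and \<open>\<epsilon>\<close> alone: the
  law of large numbers and the limit law of the score do not involve the design.\<close>

locale regression_noise =
  fixes M :: "nat \<Rightarrow> 'a measure"
    and H :: "nat \<Rightarrow> 'a \<Rightarrow> nat \<Rightarrow> real^'q::finite"
    and \<epsilon> :: "nat \<Rightarrow> 'a \<Rightarrow> nat \<Rightarrow> real"
    and \<sigma>2 :: real and \<Sigma> :: "real^'q^'q"
    and K\<eta> :: "'q \<Rightarrow> real" and K\<epsilon> :: real
  assumes prob: "\<And>n. prob_space (M n)"
    and meas_eps: "\<And>n i. (\<lambda>\<omega>. \<epsilon> n \<omega> i) \<in> borel_measurable (M n)"
    and meas_H: "\<And>n i. (\<lambda>\<omega>. H n \<omega> i) \<in> borel_measurable (M n)"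
    and H_indep: "\<And>n. prob_space.indep_vars (M n) (\<lambda>_. borel) (\<lambda>i \<omega>. H n \<omega> i) {..<n}"
    and H_ident: "\<And>n i. i < n \<Longrightarrow> distr (M n) borel (\<lambda>\<omega>. H n \<omega> i) = distr (M n) borel (\<lambda>\<omega>. H n \<omega> 0)"
    and eps_indep: "\<And>n. prob_space.indep_vars (M n) (\<lambda>_. borel) (\<lambda>i \<omega>. \<epsilon> n \<omega> i) {..<n}"
    and eps_ident: "\<And>n i. i < n \<Longrightarrow> distr (M n) borel (\<lambda>\<omega>. \<epsilon> n \<omega> i) = distr (M n) borel (\<lambda>\<omega>. \<epsilon> n \<omega> 0)"
    and H_eps_indep: "\<And>n. prob_space.indep_set (M n) (gen_sigma (M n) {(\<lambda>\<omega>. H n \<omega> i $ j) | i j. i < n})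
      (gen_sigma (M n) {(\<lambda>\<omega>. \<epsilon> n \<omega> i) | i. i < n})"
    and H_subg: "\<And>n i j. i < n \<Longrightarrow> subgaussian (M n) (\<lambda>\<omega>. H n \<omega> i $ j) (K\<eta> j)"
    and eps_subg: "\<And>n i. i < n \<Longrightarrow> subgaussian (M n) (\<lambda>\<omega>. \<epsilon> n \<omega> i) K\<epsilon>"
    and var_eps: "\<And>n. 0 < n \<Longrightarrow> prob_space.variance (M n) (\<lambda>\<omega>. \<epsilon> n \<omega> 0) = \<sigma>2"
    and var_H: "\<And>n j k. 0 < n \<Longrightarrow>
       (\<integral>\<omega>. (H n \<omega> 0 $ j - (\<integral>\<omega>'. H n \<omega>' 0 $ j \<partial>M n)) *
             (H n \<omega> 0 $ k - (\<integral>\<omega>'. H n \<omega>' 0 $ k \<partial>M n)) \<partial>M n) = \<Sigma> $ j $ k"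
begin

lemma meas_H_component: "(\<lambda>\<omega>. H n \<omega> i $ j) \<in> borel_measurable (M n)"
  using meas_H by (rule borel_measurable_vec_nth)

lemma eps_mean: "i < n \<Longrightarrow> (\<integral>\<omega>. \<epsilon> n \<omega> i \<partial>M n) = 0"
  using eps_subg by (auto simp: subgaussian_def)

lemma H_mean: "i < n \<Longrightarrow> (\<integral>\<omega>. H n \<omega> i $ j \<partial>M n) = 0"
  using H_subg by (auto simp: subgaussian_def)

lemma eps_square:
  assumes "i < n"
  shows "(\<integral>\<omega>. (\<epsilon> n \<omega> i)\<^sup>2 \<partial>M n) = \<sigma>2"
proof -
  have "(\<integral>\<omega>. (\<epsilon> n \<omega> i)\<^sup>2 \<partial>M n) = (\<integral>x. x\<^sup>2 \<partial>distr (M n) borel (\<lambda>\<omega>. \<epsilon> n \<omega> i))"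
    using meas_eps by (subst integral_distr) auto
  also have "\<dots> = (\<integral>\<omega>. (\<epsilon> n \<omega> 0)\<^sup>2 \<partial>M n)"
    unfolding eps_ident[OF assms] using meas_eps by (subst integral_distr) auto
  also have "\<dots> = \<sigma>2" using var_eps[of n] eps_mean[of 0 n] assms by simp
  finally show ?thesis .
qed

lemma H_product:
  assumes "i < n"
  shows "(\<integral>\<omega>. H n \<omega> i $ j * H n \<omega> i $ k \<partial>M n) = \<Sigma> $ j $ k"
proof -
  have m: "(\<lambda>x::real^'q. x $ j * x $ k) \<in> borel_measurable borel"
    by (intro borel_measurable_times borel_measurable_vec_nth) auto
  have "(\<integral>\<omega>. H n \<omega> i $ j * H n \<omega> i $ k \<partial>M n) = (\<integral>x. x $ j * x $ k \<partial>distr (M n) borel (\<lambda>\<omega>. H n \<omega> i))"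
    using integral_distr[OF meas_H m] by simp
  also have "\<dots> = (\<integral>\<omega>. H n \<omega> 0 $ j * H n \<omega> 0 $ k \<partial>M n)"
    unfolding H_ident[OF assms] using integral_distr[OF meas_H m] by simp
  also have "\<dots> = \<Sigma> $ j $ k" using var_H[of n j k] H_mean[of 0 n] assms by simp
  finally show ?thesis .
qed

lemma H_fourth:
  assumes "i < n"
  shows "integrable (M n) (\<lambda>\<omega>. (H n \<omega> i $ j) ^ 4)" "(\<integral>\<omega>. (H n \<omega> i $ j) ^ 4 \<partial>M n) \<le> 512 * exp ((K\<eta> j)\<^sup>2 / 2)"
  using subgaussian_fourth_moment[OF prob H_subg[OF assms]] by auto

lemma eps_fourth:
  assumes "i < n"
  shows "integrable (M n) (\<lambda>\<omega>. (\<epsilon> n \<omega> i) ^ 4)" "(\<integral>\<omega>. (\<epsilon> n \<omega> i) ^ 4 \<partial>M n) \<le> 512 * exp (K\<epsilon>\<^sup>2 / 2)"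
  using subgaussian_fourth_moment[OF prob eps_subg[OF assms]] by auto

lemma H_product_integrable:
  assumes "i < n"
  shows "integrable (M n) (\<lambda>\<omega>. (H n \<omega> i $ j * H n \<omega> i $ k)\<^sup>2)" "integrable (M n) (\<lambda>\<omega>. H n \<omega> i $ j * H n \<omega> i $ k)"
proof -
  interpret prob_space "M n" by (rule prob)
  note [measurable] = meas_H_component
  show i: "integrable (M n) (\<lambda>\<omega>. (H n \<omega> i $ j * H n \<omega> i $ k)\<^sup>2)"
    by (rule Bochner_Integration.integrable_bound[OF Bochner_Integration.integrable_add[OF H_fourth(1)[OF assms, of j] H_fourth(1)[OF assms, of k]]])
      (use product_square_le in auto)
  show "integrable (M n) (\<lambda>\<omega>. H n \<omega> i $ j * H n \<omega> i $ k)"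
    using i by (rule square_integrable_imp_integrable[rotated]) measurable
qed

text \<open>The probability space changes with \<open>n\<close>, so this is a weak law for a
  triangular array, proved through variances; fourth moments make the products square
  integrable.\<close>

lemma gram_lln: "vanish_prob M (\<lambda>n \<omega>. inn n (\<lambda>i. H n \<omega> i $ j) (\<lambda>i. H n \<omega> i $ k) / n - \<Sigma> $ j $ k)"
proof -
  define U where "U = (\<lambda>n i \<omega>. H n \<omega> i $ j * H n \<omega> i $ k - \<Sigma> $ j $ k)"
  define v where "v = 2 * (512 * exp ((K\<eta> j)\<^sup>2 / 2) + 512 * exp ((K\<eta> k)\<^sup>2 / 2)) + 2 * (\<Sigma> $ j $ k)\<^sup>2"
  have main: "integrable (M n) (\<lambda>\<omega>. (\<Sum>i<n. U n i \<omega>)\<^sup>2) \<and> (\<integral>\<omega>. (\<Sum>i<n. U n i \<omega>)\<^sup>2 \<partial>M n) \<le> real n * v" for n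
  proof (rule indep_sum_second_moment[OF prob])
    interpret prob_space "M n" by (rule prob)
    have m: "(\<lambda>x::real^'q. x $ j * x $ k - \<Sigma> $ j $ k) \<in> borel_measurable borel"
      by (intro borel_measurable_diff borel_measurable_times borel_measurable_vec_nth) auto
    show "indep_vars (\<lambda>_. borel) (U n) {..<n}"
      unfolding U_def using indep_vars_compose2[OF H_indep, where Y="\<lambda>_ x. x $ j * x $ k - \<Sigma> $ j $ k" and N="\<lambda>_. borel"] m by simp
    fix i assume i: "i < n"
    note [measurable] = meas_H_component
    note hi = H_product_integrable[OF i, of j k]
    show "integrable (M n) (U n i)" using hi by (simp add: U_def)
    show "(\<integral>\<omega>. U n i \<omega> \<partial>M n) = 0" using hi H_product[OF i] by (simp add: U_def prob_space)
    have le: "(U n i \<omega>)\<^sup>2 \<le> 2 * ((H n \<omega> i $ j) ^ 4 + (H n \<omega> i $ k) ^ 4) + 2 * (\<Sigma> $ j $ k)\<^sup>2" for \<omega>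
    proof -
      have "(U n i \<omega>)\<^sup>2 \<le> 2 * (H n \<omega> i $ j * H n \<omega> i $ k)\<^sup>2 + 2 * (\<Sigma> $ j $ k)\<^sup>2"
        using zero_le_power2[of "H n \<omega> i $ j * H n \<omega> i $ k + \<Sigma> $ j $ k"] unfolding U_def power2_diff power2_sum by simp
      also have "\<dots> \<le> 2 * ((H n \<omega> i $ j) ^ 4 + (H n \<omega> i $ k) ^ 4) + 2 * (\<Sigma> $ j $ k)\<^sup>2"
        by (intro add_mono mult_left_mono product_square_le order_refl) simp
      finally show ?thesis .
    qed
    have int: "integrable (M n) (\<lambda>\<omega>. 2 * ((H n \<omega> i $ j) ^ 4 + (H n \<omega> i $ k) ^ 4) + 2 * (\<Sigma> $ j $ k)\<^sup>2)"
      using H_fourth(1)[OF i] by simp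
    show sq: "integrable (M n) (\<lambda>\<omega>. (U n i \<omega>)\<^sup>2)"
    proof (rule Bochner_Integration.integrable_bound[OF int])
      show "(\<lambda>\<omega>. (U n i \<omega>)\<^sup>2) \<in> borel_measurable (M n)" unfolding U_def by measurable
      show "AE \<omega> in M n. norm ((U n i \<omega>)\<^sup>2) \<le> norm (2 * ((H n \<omega> i $ j) ^ 4 + (H n \<omega> i $ k) ^ 4) + 2 * (\<Sigma> $ j $ k)\<^sup>2)"
        using le by (intro AE_I2) (simp only: real_norm_def, smt (verit) abs_ge_self zero_le_power2)
    qed
    have "(\<integral>\<omega>. (U n i \<omega>)\<^sup>2 \<partial>M n) \<le> (\<integral>\<omega>. 2 * ((H n \<omega> i $ j) ^ 4 + (H n \<omega> i $ k) ^ 4) + 2 * (\<Sigma> $ j $ k)\<^sup>2 \<partial>M n)"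
      using sq int le by (rule integral_mono)
    also have "\<dots> \<le> v" using H_fourth[OF i, of j] H_fourth[OF i, of k] by (simp add: v_def prob_space)
    finally show "(\<integral>\<omega>. (U n i \<omega>)\<^sup>2 \<partial>M n) \<le> v" .
  qed
  have "vanish_prob M (\<lambda>n \<omega>. (\<Sum>i<n. U n i \<omega>) / n)"
  proof (rule vanish_prob_second_moment[OF prob])
    note [measurable] = meas_H_component
    show "(\<lambda>\<omega>. (\<Sum>i<n. U n i \<omega>) / n) \<in> borel_measurable (M n)" for n unfolding U_def by measurable
    show "\<forall>\<^sub>F n in sequentially. integrable (M n) (\<lambda>\<omega>. ((\<Sum>i<n. U n i \<omega>) / n)\<^sup>2) \<and> (\<integral>\<omega>. ((\<Sum>i<n. U n i \<omega>) / n)\<^sup>2 \<partial>M n) \<le> v / n"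
    proof (rule eventually_mono[OF eventually_gt_at_top[of 0]])
      fix n :: nat assume n: "0 < n"
      have "(\<integral>\<omega>. ((\<Sum>i<n. U n i \<omega>) / n)\<^sup>2 \<partial>M n) = (\<integral>\<omega>. (\<Sum>i<n. U n i \<omega>)\<^sup>2 \<partial>M n) / (real n)\<^sup>2"
        by (simp add: power_divide)
      also have "\<dots> \<le> (real n * v) / (real n)\<^sup>2" using main[of n] by (intro divide_right_mono) auto
      also have "\<dots> = v / n" using n by (simp add: power2_eq_square)
      finally show "integrable (M n) (\<lambda>\<omega>. ((\<Sum>i<n. U n i \<omega>) / n)\<^sup>2) \<and> (\<integral>\<omega>. ((\<Sum>i<n. U n i \<omega>) / n)\<^sup>2 \<partial>M n) \<le> v / n"
        using main[of n] by (simp add: power_divide)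
    qed
    show "(\<lambda>n. v / real n) \<longlonglongrightarrow> 0" by (rule lim_const_over_n)
  qed
  then show ?thesis
  proof (rule vanish_prob_mono)
    show "\<forall>\<^sub>F n in sequentially. \<forall>\<omega>\<in>space (M n). \<bar>inn n (\<lambda>i. H n \<omega> i $ j) (\<lambda>i. H n \<omega> i $ k) / n - \<Sigma> $ j $ k\<bar> \<le> \<bar>(\<Sum>i<n. U n i \<omega>) / n\<bar>"
      by (rule eventually_mono[OF eventually_gt_at_top[of 0]]) (auto simp: U_def inn_def sum_subtractf field_simps)
  qed
qed

lemma H_sub_alg: "i < n \<Longrightarrow> (\<lambda>\<omega>. H n \<omega> i $ j) \<in> borel_measurable (sub_alg (M n) {(\<lambda>\<omega>. H n \<omega> i $ j) | i j. i < n})"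
  by (rule sub_alg_measurable) auto

lemma eps_sub_alg: "i < n \<Longrightarrow> (\<lambda>\<omega>. \<epsilon> n \<omega> i) \<in> borel_measurable (sub_alg (M n) {(\<lambda>\<omega>. \<epsilon> n \<omega> i) | i. i < n})"
  by (rule sub_alg_measurable) auto

lemma H_indep_column: "prob_space.indep_vars (M n) (\<lambda>_. borel) (\<lambda>i \<omega>. H n \<omega> i $ j) {..<n}"
proof -
  interpret prob_space "M n" by (rule prob)
  show ?thesis using indep_vars_compose2[OF H_indep, where Y="\<lambda>_ x. x $ j" and N="\<lambda>_. borel"] by (simp add: borel_measurable_vec_nth)
qed

lemma H_subgaussian_nn: "(\<integral>\<^sup>+\<omega>. ennreal (exp (inn n l (\<lambda>i. H n \<omega> i $ j))) \<partial>M n) \<le> ennreal (exp ((K\<eta> j)\<^sup>2 * sqn n l / 2))"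
  by (rule indep_subgaussian_nn_integral[OF prob H_indep_column H_subg])

text \<open>For frozen errors the second moment over \<open>H\<close> is at most a constant times
  \<open>sqn n (\<epsilon> n y)\<close>, whose mean is \<open>n * \<sigma>2\<close>. The scaling by
  \<open>sqrt n\<close> removes the factor \<open>n\<close>.\<close>

lemma score_bounded: "bounded_prob M (\<lambda>n \<omega>. inn n (\<lambda>i. H n \<omega> i $ j) (\<epsilon> n \<omega>) / sqrt n)"
proof (rule bounded_prob_second_moment[OF prob])
  note [measurable] = meas_H_component meas_eps
  define C where "C = 514 * exp ((K\<eta> j)\<^sup>2 / 2)"
  have C: "C \<ge> 0" by (simp add: C_def)
  show meas: "(\<lambda>\<omega>. inn n (\<lambda>i. H n \<omega> i $ j) (\<epsilon> n \<omega>) / sqrt n) \<in> borel_measurable (M n)" for n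
    unfolding inn_def by measurable
  show "\<forall>\<^sub>F n in sequentially. integrable (M n) (\<lambda>\<omega>. (inn n (\<lambda>i. H n \<omega> i $ j) (\<epsilon> n \<omega>) / sqrt n)\<^sup>2) \<and>
    (\<integral>\<omega>. (inn n (\<lambda>i. H n \<omega> i $ j) (\<epsilon> n \<omega>) / sqrt n)\<^sup>2 \<partial>M n) \<le> C * \<sigma>2"
  proof (rule eventually_mono[OF eventually_gt_at_top[of 0]])
    fix n :: nat assume n: "0 < n"
    let ?F = "{(\<lambda>\<omega>. H n \<omega> i $ j) | i j. i < n}" and ?G = "{(\<lambda>\<omega>. \<epsilon> n \<omega> i) | i. i < n}"
    let ?\<Phi> = "\<lambda>(x, y). ennreal ((inn n (\<epsilon> n y) (\<lambda>i. H n x i $ j))\<^sup>2)"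
    interpret prob_space "M n" by (rule prob)
    have \<sigma>2: "\<sigma>2 \<ge> 0" using var_eps[OF n] by (metis integral_nonneg_AE AE_I2 zero_le_power2)
    have "(\<lambda>z. inn n (\<epsilon> n (snd z)) (\<lambda>i. H n (fst z) i $ j)) \<in> borel_measurable (sub_alg (M n) ?F \<Otimes>\<^sub>M sub_alg (M n) ?G)"
      by (intro measurable_inn measurable_compose[OF measurable_snd] measurable_compose[OF measurable_fst] H_sub_alg eps_sub_alg)
    then have \<Phi>: "?\<Phi> \<in> borel_measurable (sub_alg (M n) ?F \<Otimes>\<^sub>M sub_alg (M n) ?G)"
      unfolding case_prod_unfold by (intro measurable_compose[OF _ measurable_ennreal] borel_measurable_power)
    have "(\<integral>\<^sup>+\<omega>. ennreal ((inn n (\<lambda>i. H n \<omega> i $ j) (\<epsilon> n \<omega>) / sqrt n)\<^sup>2) \<partial>M n) = (\<integral>\<^sup>+\<omega>. ennreal (1 / n) * ?\<Phi> (\<omega>, \<omega>) \<partial>M n)"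
      by (intro nn_integral_cong) (simp add: inn_commute[of n "\<epsilon> n _"] power_divide ennreal_mult'[symmetric])
    also have "\<dots> = ennreal (1 / n) * (\<integral>\<^sup>+\<omega>. ?\<Phi> (\<omega>, \<omega>) \<partial>M n)"
      unfolding inn_def by (simp, subst nn_integral_cmult) auto
    also have "(\<integral>\<^sup>+\<omega>. ?\<Phi> (\<omega>, \<omega>) \<partial>M n) = (\<integral>\<^sup>+y. (\<integral>\<^sup>+x. ?\<Phi> (x, y) \<partial>M n) \<partial>M n)"
      by (rule indep_nn_integral[OF prob _ _ H_eps_indep \<Phi>]) (auto intro: meas_H_component meas_eps)
    also have "ennreal (1 / n) * \<dots> \<le> ennreal (1 / n) * (\<integral>\<^sup>+y. ennreal (C * sqn n (\<epsilon> n y)) \<partial>M n)"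
      using subgaussian_vector_second_moment[OF meas_H_component H_subgaussian_nn, of n _ j]
      by (intro mult_left_mono nn_integral_mono) (auto simp: C_def)
    also have "(\<integral>\<^sup>+y. ennreal (C * sqn n (\<epsilon> n y)) \<partial>M n) = ennreal (\<integral>y. C * sqn n (\<epsilon> n y) \<partial>M n)"
    proof (rule nn_integral_eq_integral)
      show "integrable (M n) (\<lambda>y. C * sqn n (\<epsilon> n y))" unfolding sqn_def
        by (intro integrable_mult_right Bochner_Integration.integrable_sum)
          (use integrable_abs_power(1)[OF prob meas_eps eps_fourth(1), of _ n 2] in auto)
    qed (use C in auto)
    also have "(\<integral>y. C * sqn n (\<epsilon> n y) \<partial>M n) = C * (n * \<sigma>2)"
    proof -
      have "(\<integral>y. (\<Sum>i<n. (\<epsilon> n y i)\<^sup>2) \<partial>M n) = (\<Sum>i<n. \<integral>y. (\<epsilon> n y i)\<^sup>2 \<partial>M n)"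
        by (rule Bochner_Integration.integral_sum) (use integrable_abs_power(1)[OF prob meas_eps eps_fourth(1), of _ n 2] in auto)
      then show ?thesis by (simp add: sqn_def eps_square)
    qed
    also have "ennreal (1 / n) * ennreal (C * (n * \<sigma>2)) = ennreal (C * \<sigma>2)"
      using n by (simp add: ennreal_mult'[symmetric])
    finally have "(\<integral>\<^sup>+\<omega>. ennreal ((inn n (\<lambda>i. H n \<omega> i $ j) (\<epsilon> n \<omega>) / sqrt n)\<^sup>2) \<partial>M n) \<le> ennreal (C * \<sigma>2)" .
    then show "integrable (M n) (\<lambda>\<omega>. (inn n (\<lambda>i. H n \<omega> i $ j) (\<epsilon> n \<omega>) / sqrt n)\<^sup>2) \<and>
        (\<integral>\<omega>. (inn n (\<lambda>i. H n \<omega> i $ j) (\<epsilon> n \<omega>) / sqrt n)\<^sup>2 \<partial>M n) \<le> C * \<sigma>2"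
      using C \<sigma>2 by (intro integrable_square_nn_integral[OF meas]) auto
  qed
qed

end

section \<open>Characteristic function of the score\<close>

lemma norm_cis_integral_le_1:
  assumes "prob_space M" "X \<in> borel_measurable M"
  shows "integrable M (\<lambda>\<omega>. cis (X \<omega>))" "cmod (\<integral>\<omega>. cis (X \<omega>) \<partial>M) \<le> 1"
proof -
  interpret prob_space M by fact
  have "(\<lambda>\<omega>. cis (X \<omega>)) \<in> borel_measurable M"
    by (rule borel_measurable_continuous_on[OF _ assms(2)]) (intro continuous_intros)
  then show i: "integrable M (\<lambda>\<omega>. cis (X \<omega>))" by (intro integrable_const_bound[where B=1]) auto
  have "cmod (\<integral>\<omega>. cis (X \<omega>) \<partial>M) \<le> (\<integral>\<omega>. cmod (cis (X \<omega>)) \<partial>M)" by (rule integral_norm_bound)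
  then show "cmod (\<integral>\<omega>. cis (X \<omega>) \<partial>M) \<le> 1" by (simp add: prob_space)
qed

lemma fourth_power_inner_le:
  fixes t x :: "real^'q::finite"
  shows "(t \<bullet> x) ^ 4 \<le> norm t ^ 4 * (real CARD('q) * (\<Sum>j\<in>UNIV. (x $ j) ^ 4))"
proof -
  have "(t \<bullet> x) ^ 4 = \<bar>t \<bullet> x\<bar> ^ 4" by simp
  also have "\<dots> \<le> (norm t * norm x) ^ 4" by (intro power_mono Cauchy_Schwarz_ineq2) auto
  also have "\<dots> = norm t ^ 4 * ((norm x)\<^sup>2)\<^sup>2" by (simp add: power_mult_distrib power_mult[symmetric])
  also have "(norm x)\<^sup>2 = (\<Sum>j\<in>UNIV. (x $ j)\<^sup>2)"
    unfolding power2_norm_eq_inner inner_vec_def by (simp add: power2_eq_square)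
  also have "norm t ^ 4 * (\<Sum>j\<in>UNIV. (x $ j)\<^sup>2)\<^sup>2 \<le> norm t ^ 4 * ((\<Sum>j\<in>UNIV. ((x $ j)\<^sup>2)\<^sup>2) * CARD('q))"
    by (intro mult_left_mono sum_squared_le_sum_of_squares) auto
  finally show ?thesis by (simp add: power_mult[symmetric] mult.commute)
qed

context regression_noise
begin

lemma inner_H_square:
  assumes "i < n"
  shows "integrable (M n) (\<lambda>\<omega>. (t \<bullet> H n \<omega> i)\<^sup>2)" "(\<integral>\<omega>. (t \<bullet> H n \<omega> i)\<^sup>2 \<partial>M n) = t \<bullet> (\<Sigma> *v t)"
proof -
  have eq: "(t \<bullet> H n \<omega> i)\<^sup>2 = (\<Sum>j\<in>UNIV. \<Sum>k\<in>UNIV. t $ j * t $ k * (H n \<omega> i $ j * H n \<omega> i $ k))" for \<omega>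
    by (simp add: inner_vec_def power2_eq_square sum_product ac_simps)
  note hi = H_product_integrable(2)[OF assms]
  have ii: "integrable (M n) (\<lambda>\<omega>. t $ j * t $ k * (H n \<omega> i $ j * H n \<omega> i $ k))" for j k
    using hi by (rule integrable_mult_right)
  show "integrable (M n) (\<lambda>\<omega>. (t \<bullet> H n \<omega> i)\<^sup>2)"
    unfolding eq by (intro Bochner_Integration.integrable_sum ii)
  have "(\<integral>\<omega>. (t \<bullet> H n \<omega> i)\<^sup>2 \<partial>M n) = (\<Sum>j\<in>UNIV. \<integral>\<omega>. (\<Sum>k\<in>UNIV. t $ j * t $ k * (H n \<omega> i $ j * H n \<omega> i $ k)) \<partial>M n)"
    unfolding eq by (rule Bochner_Integration.integral_sum) (intro Bochner_Integration.integrable_sum ii)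
  also have "\<dots> = (\<Sum>j\<in>UNIV. \<Sum>k\<in>UNIV. \<integral>\<omega>. t $ j * t $ k * (H n \<omega> i $ j * H n \<omega> i $ k) \<partial>M n)"
    by (intro sum.cong refl Bochner_Integration.integral_sum ii)
  also have "\<dots> = (\<Sum>j\<in>UNIV. \<Sum>k\<in>UNIV. t $ j * t $ k * \<Sigma> $ j $ k)"
    by (simp add: H_product[OF assms])
  also have "\<dots> = t \<bullet> (\<Sigma> *v t)"
    by (simp add: inner_vec_def matrix_vector_mult_def sum_distrib_left ac_simps)
  finally show "(\<integral>\<omega>. (t \<bullet> H n \<omega> i)\<^sup>2 \<partial>M n) = t \<bullet> (\<Sigma> *v t)" .
qed

lemma \<Sigma>_psd: "0 \<le> t \<bullet> (\<Sigma> *v t)"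
  using inner_H_square(2)[of 0 1 t, symmetric] by simp

lemma \<sigma>2_nonneg: "0 \<le> \<sigma>2"
  using eps_square[of 0 1, symmetric] by simp

lemma inner_H_fourth:
  assumes "i < n"
  shows "integrable (M n) (\<lambda>\<omega>. (t \<bullet> H n \<omega> i) ^ 4)"
    "(\<integral>\<omega>. (t \<bullet> H n \<omega> i) ^ 4 \<partial>M n) \<le> norm t ^ 4 * (real CARD('q) * (\<Sum>j\<in>UNIV. 512 * exp ((K\<eta> j)\<^sup>2 / 2)))"
proof -
  note [measurable] = meas_H
  let ?b = "\<lambda>\<omega>. norm t ^ 4 * (real CARD('q) * (\<Sum>j\<in>UNIV. (H n \<omega> i $ j) ^ 4))"
  have int: "integrable (M n) ?b"
    by (intro integrable_mult_right Bochner_Integration.integrable_sum H_fourth assms)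
  show i4: "integrable (M n) (\<lambda>\<omega>. (t \<bullet> H n \<omega> i) ^ 4)"
  proof (rule Bochner_Integration.integrable_bound[OF int])
    show "AE \<omega> in M n. norm ((t \<bullet> H n \<omega> i) ^ 4) \<le> norm (?b \<omega>)"
    proof (rule AE_I2)
      fix \<omega>
      have "norm ((t \<bullet> H n \<omega> i) ^ 4) = (t \<bullet> H n \<omega> i) ^ 4" by simp
      also have "\<dots> \<le> ?b \<omega>" by (rule fourth_power_inner_le)
      also have "\<dots> \<le> norm (?b \<omega>)" unfolding real_norm_def by (rule abs_ge_self)
      finally show "norm ((t \<bullet> H n \<omega> i) ^ 4) \<le> norm (?b \<omega>)" .
    qed
  qed measurable
  have "(\<integral>\<omega>. (t \<bullet> H n \<omega> i) ^ 4 \<partial>M n) \<le> (\<integral>\<omega>. ?b \<omega> \<partial>M n)"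
    using i4 int fourth_power_inner_le by (rule integral_mono)
  also have "\<dots> = norm t ^ 4 * (real CARD('q) * (\<Sum>j\<in>UNIV. \<integral>\<omega>. (H n \<omega> i $ j) ^ 4 \<partial>M n))"
    using H_fourth(1)[OF assms] by (simp add: Bochner_Integration.integral_sum)
  also have "\<dots> \<le> norm t ^ 4 * (real CARD('q) * (\<Sum>j\<in>UNIV. 512 * exp ((K\<eta> j)\<^sup>2 / 2)))"
    by (intro mult_left_mono sum_mono H_fourth(2)[OF assms]) auto
  finally show "(\<integral>\<omega>. (t \<bullet> H n \<omega> i) ^ 4 \<partial>M n) \<le> norm t ^ 4 * (real CARD('q) * (\<Sum>j\<in>UNIV. 512 * exp ((K\<eta> j)\<^sup>2 / 2)))" .
qed

text \<open>The characteristic function of one error, treated as a function in its own right because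
  it will be evaluated at random frequencies given by the rows of \<open>H\<close>.\<close>

definition \<phi> :: "nat \<Rightarrow> nat \<Rightarrow> real \<Rightarrow> complex" where
  "\<phi> n i s = (\<integral>\<omega>. cis (s * \<epsilon> n \<omega> i) \<partial>M n)"

lemma \<phi>_measurable: "\<phi> n i \<in> borel_measurable borel"
proof -
  interpret prob_space "M n" by (rule prob)
  have "(\<lambda>z. fst z * \<epsilon> n (snd z) i) \<in> borel_measurable (borel \<Otimes>\<^sub>M M n)"
    using measurable_compose[OF measurable_snd meas_eps] by (intro borel_measurable_times) auto
  then have "(\<lambda>z. cis (fst z * \<epsilon> n (snd z) i)) \<in> borel_measurable (borel \<Otimes>\<^sub>M M n)"
    by (rule borel_measurable_continuous_on[rotated]) (intro continuous_intros)
  then have "(\<lambda>(s, \<omega>). cis (s * \<epsilon> n \<omega> i)) \<in> borel_measurable (borel \<Otimes>\<^sub>M M n)" by (simp add: case_prod_unfold)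
  then show ?thesis unfolding \<phi>_def[abs_def] by (rule borel_measurable_lebesgue_integral)
qed

lemma \<phi>_le_1: "cmod (\<phi> n i s) \<le> 1"
  unfolding \<phi>_def using meas_eps by (intro norm_cis_integral_le_1 prob borel_measurable_times) auto

text \<open>Conditioning on \<open>H\<close> factorises over the independent errors, and the remaining product over the
  independent rows of \<open>H\<close>; independence of the pairs \<open>(H\<^sub>i, \<epsilon>\<^sub>i)\<close> is never needed.\<close>
lemma score_char_prod:
  "(\<integral>\<omega>. cis (\<Sum>i<n. c * (t \<bullet> H n \<omega> i) * \<epsilon> n \<omega> i) \<partial>M n) = (\<Prod>i<n. \<integral>\<omega>. \<phi> n i (c * (t \<bullet> H n \<omega> i)) \<partial>M n)"
proof -
  interpret prob_space "M n" by (rule prob)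
  let ?F = "{(\<lambda>\<omega>. H n \<omega> i $ j) | i j. i < n}" and ?G = "{(\<lambda>\<omega>. \<epsilon> n \<omega> i) | i. i < n}"
  let ?P = "sub_alg (M n) ?F \<Otimes>\<^sub>M sub_alg (M n) ?G"
  let ?a = "\<lambda>i x. c * (t \<bullet> H n x i)"
  let ?\<Phi> = "\<lambda>(x, y). cis (\<Sum>i<n. ?a i x * \<epsilon> n y i)"
  have "(\<lambda>x. t \<bullet> H n x i) \<in> borel_measurable (sub_alg (M n) ?F)" if "i < n" for i
    unfolding inner_vec_def using H_sub_alg[OF that] by (intro borel_measurable_sum borel_measurable_inner) auto
  then have "(\<lambda>z. \<Sum>i<n. ?a i (fst z) * \<epsilon> n (snd z) i) \<in> borel_measurable ?P"
    by (intro borel_measurable_sum borel_measurable_times measurable_compose[OF measurable_fst] measurable_compose[OF measurable_snd]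
        borel_measurable_const eps_sub_alg) auto
  then have "(\<lambda>z. cis (\<Sum>i<n. ?a i (fst z) * \<epsilon> n (snd z) i)) \<in> borel_measurable ?P"
    by (rule borel_measurable_continuous_on[rotated]) (intro continuous_intros)
  then have \<Phi>: "?\<Phi> \<in> borel_measurable ?P" by (simp add: case_prod_unfold)
  have "(\<integral>\<omega>. ?\<Phi> (\<omega>, \<omega>) \<partial>M n) = (\<integral>x. (\<integral>y. ?\<Phi> (x, y) \<partial>M n) \<partial>M n)"
    by (rule indep_integral[OF prob _ _ H_eps_indep \<Phi>, where B=1]) (auto intro: meas_H_component meas_eps)
  also have "\<dots> = (\<integral>x. (\<Prod>i<n. \<phi> n i (?a i x)) \<partial>M n)"
  proof (rule Bochner_Integration.integral_cong[OF refl])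
    fix x
    have "(\<integral>y. ?\<Phi> (x, y) \<partial>M n) = (\<integral>y. (\<Prod>i<n. cis (?a i x * \<epsilon> n y i)) \<partial>M n)"
      by (simp add: cis_sum)
    also have "\<dots> = (\<Prod>i<n. \<integral>y. cis (?a i x * \<epsilon> n y i) \<partial>M n)"
    proof (rule indep_vars_lebesgue_integral)
      have m: "(\<lambda>z. cis (?a i x * z)) \<in> borel_measurable borel" for i
        by (intro borel_measurable_continuous_onI continuous_intros)
      show "indep_vars (\<lambda>_. borel) (\<lambda>i y. cis (?a i x * \<epsilon> n y i)) {..<n}"
        using indep_vars_compose2[OF eps_indep, where Y="\<lambda>i z. cis (?a i x * z)" and N="\<lambda>_. borel"] m by simp
      show "integrable (M n) (\<lambda>y. cis (?a i x * \<epsilon> n y i))" for i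
        using meas_eps by (intro norm_cis_integral_le_1 prob borel_measurable_times) auto
    qed simp
    finally show "(\<integral>y. ?\<Phi> (x, y) \<partial>M n) = (\<Prod>i<n. \<phi> n i (?a i x))" by (simp add: \<phi>_def)
  qed
  also have "\<dots> = (\<Prod>i<n. \<integral>x. \<phi> n i (?a i x) \<partial>M n)"
  proof (rule indep_vars_lebesgue_integral)
    have m: "(\<lambda>h::real^'q. \<phi> n i (c * (t \<bullet> h))) \<in> borel_measurable borel" for i
      by (rule measurable_compose[OF _ \<phi>_measurable]) (intro borel_measurable_continuous_onI continuous_intros)
    show "indep_vars (\<lambda>_. borel) (\<lambda>i x. \<phi> n i (?a i x)) {..<n}"
      using indep_vars_compose2[OF H_indep, where Y="\<lambda>i h. \<phi> n i (c * (t \<bullet> h))" and N="\<lambda>_. borel"] m by simp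
    show "integrable (M n) (\<lambda>x. \<phi> n i (?a i x))" for i
      using measurable_compose[OF meas_H m] \<phi>_le_1 by (intro integrable_const_bound[where B=1]) auto
  qed simp
  finally show ?thesis by simp
qed

text \<open>Each factor differs from \<open>1 - v / (2 n)\<close> by order \<open>n\<close> to the
  power -3/2. The \<open>n\<close> replacements together cost order \<open>1 / sqrt n\<close>, and
  the power of the replacement tends to the Gaussian value.\<close>

lemma score_char:
  "(\<lambda>n. \<integral>\<omega>. cis (\<Sum>i<n. 1 / sqrt n * (t \<bullet> H n \<omega> i) * \<epsilon> n \<omega> i) \<partial>M n) \<longlonglongrightarrow>
     complex_of_real (exp (- (\<sigma>2 * (t \<bullet> (\<Sigma> *v t))) / 2))"
proof -
  define v where "v = \<sigma>2 * (t \<bullet> (\<Sigma> *v t))"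
  have v0: "v \<ge> 0" using \<sigma>2_nonneg \<Sigma>_psd by (simp add: v_def)
  define Ce where "Ce = 1 + 512 * exp (K\<epsilon>\<^sup>2 / 2)"
  define Ct where "Ct = 1 + norm t ^ 4 * (real CARD('q) * (\<Sum>j\<in>UNIV. 512 * exp ((K\<eta> j)\<^sup>2 / 2)))"
  define g where "g n i = (\<integral>\<omega>. \<phi> n i (1 / sqrt n * (t \<bullet> H n \<omega> i)) \<partial>M n)" for n i
  have Ce0: "Ce \<ge> 0" by (simp add: Ce_def add_nonneg_nonneg)
  \<comment> \<open>The cubic remainder of \<open>\<phi>\<close> is averaged over the row of
    \<open>H\<close>, whose absolute third moment is bounded by \<open>Ct\<close>.\<close>
  have bound: "cmod (g n i - complex_of_real (1 - v / 2 / n)) \<le> (1 / sqrt n) ^ 3 * (Ct * Ce)" if i: "i < n" for n i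
  proof -
    interpret prob_space "M n" by (rule prob)
    let ?c = "1 / sqrt n" and ?h = "\<lambda>\<omega>. t \<bullet> H n \<omega> i"
    have hm: "?h \<in> borel_measurable (M n)" using meas_H by (intro borel_measurable_inner) auto
    note i4 = inner_H_fourth[OF i, of t]
    note i3 = integrable_abs_power[OF prob hm i4(1), of 3]
    note i2 = inner_H_square[OF i, of t]
    have fm: "(\<lambda>\<omega>. \<phi> n i (?c * ?h \<omega>)) \<in> borel_measurable (M n)"
      by (rule measurable_compose[OF _ \<phi>_measurable]) (use hm in auto)
    have fi: "integrable (M n) (\<lambda>\<omega>. \<phi> n i (?c * ?h \<omega>))"
      using fm \<phi>_le_1 by (intro integrable_const_bound[where B=1]) auto
    have gi: "integrable (M n) (\<lambda>\<omega>. complex_of_real (1 - (?c * ?h \<omega>)\<^sup>2 * \<sigma>2 / 2))"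
      using i2(1) by (intro integrable_of_real) (simp add: power_mult_distrib power_divide)
    have gv: "(\<integral>\<omega>. complex_of_real (1 - (?c * ?h \<omega>)\<^sup>2 * \<sigma>2 / 2) \<partial>M n) = complex_of_real (1 - v / 2 / n)"
    proof -
      have "(\<integral>\<omega>. complex_of_real (1 - (?c * ?h \<omega>)\<^sup>2 * \<sigma>2 / 2) \<partial>M n) = complex_of_real (\<integral>\<omega>. 1 - (1 / n * \<sigma>2 / 2) * (?h \<omega>)\<^sup>2 \<partial>M n)"
        unfolding integral_complex_of_real[symmetric] by (simp add: power_mult_distrib power_divide mult_ac)
      also have "(\<integral>\<omega>. 1 - (1 / n * \<sigma>2 / 2) * (?h \<omega>)\<^sup>2 \<partial>M n) = 1 - (1 / n * \<sigma>2 / 2) * (t \<bullet> (\<Sigma> *v t))"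
        using i2 by (subst Bochner_Integration.integral_diff) (auto simp: prob_space)
      finally show ?thesis by (simp add: v_def)
    qed
    have "cmod (g n i - complex_of_real (1 - v / 2 / n)) =
        cmod (\<integral>\<omega>. \<phi> n i (?c * ?h \<omega>) - complex_of_real (1 - (?c * ?h \<omega>)\<^sup>2 * \<sigma>2 / 2) \<partial>M n)"
      unfolding g_def gv[symmetric] using fi gi by (subst Bochner_Integration.integral_diff) auto
    also have "\<dots> \<le> (\<integral>\<omega>. cmod (\<phi> n i (?c * ?h \<omega>) - complex_of_real (1 - (?c * ?h \<omega>)\<^sup>2 * \<sigma>2 / 2)) \<partial>M n)"
      by (rule integral_norm_bound)
    also have "\<dots> \<le> (\<integral>\<omega>. (?c ^ 3 * Ce) * \<bar>?h \<omega>\<bar> ^ 3 \<partial>M n)"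
    proof (rule integral_mono)
      fix \<omega>
      have "cmod (\<phi> n i (?c * ?h \<omega>) - complex_of_real (1 - (?c * ?h \<omega>)\<^sup>2 * \<sigma>2 / 2)) \<le> \<bar>?c * ?h \<omega>\<bar> ^ 3 * Ce"
        unfolding \<phi>_def Ce_def
        by (rule char_approx_fourth_moment[OF prob meas_eps eps_fourth(1)[OF i] eps_mean[OF i] eps_square[OF i] eps_fourth(2)[OF i]])
      then show "cmod (\<phi> n i (?c * ?h \<omega>) - complex_of_real (1 - (?c * ?h \<omega>)\<^sup>2 * \<sigma>2 / 2)) \<le> (?c ^ 3 * Ce) * \<bar>?h \<omega>\<bar> ^ 3"
        by (simp add: abs_mult power_mult_distrib power_divide mult_ac)
    qed (use fi gi i3 in auto)
    also have "\<dots> = (?c ^ 3 * Ce) * (\<integral>\<omega>. \<bar>?h \<omega>\<bar> ^ 3 \<partial>M n)" by (rule integral_mult_right_zero)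
    also have "\<dots> \<le> (?c ^ 3 * Ce) * Ct"
      using i3(2) i4(2) Ce0 by (intro mult_left_mono) (auto simp: Ct_def)
    finally show ?thesis by (simp add: mult_ac)
  qed
  have g1: "cmod (g n i) \<le> 1" for n i
  proof -
    interpret prob_space "M n" by (rule prob)
    have hm: "(\<lambda>\<omega>. t \<bullet> H n \<omega> i) \<in> borel_measurable (M n)" using meas_H by (intro borel_measurable_inner) auto
    have fm: "(\<lambda>\<omega>. \<phi> n i (1 / sqrt n * (t \<bullet> H n \<omega> i))) \<in> borel_measurable (M n)"
      by (rule measurable_compose[OF _ \<phi>_measurable]) (use hm in auto)
    have fi: "integrable (M n) (\<lambda>\<omega>. \<phi> n i (1 / sqrt n * (t \<bullet> H n \<omega> i)))"
      using fm \<phi>_le_1 by (intro integrable_const_bound[where B=1]) auto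
    have "cmod (g n i) \<le> (\<integral>\<omega>. cmod (\<phi> n i (1 / sqrt n * (t \<bullet> H n \<omega> i))) \<partial>M n)"
      unfolding g_def by (rule integral_norm_bound)
    also have "\<dots> \<le> (\<integral>\<omega>. 1 \<partial>M n)" using fi \<phi>_le_1 by (intro integral_mono) auto
    finally show ?thesis by (simp add: prob_space)
  qed
  have "(\<lambda>n. (\<Prod>i<n. g n i) - complex_of_real ((1 + (- v / 2) / real n) ^ n)) \<longlonglongrightarrow> 0"
  proof (rule Lim_null_comparison)
    show "\<forall>\<^sub>F n in sequentially. norm ((\<Prod>i<n. g n i) - complex_of_real ((1 + (- v / 2) / real n) ^ n)) \<le> Ct * Ce / sqrt n"
    \<comment> \<open>Beyond \<open>v\<close> the number \<open>1 - v / 2 / n\<close> has modulus at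
      most 1, as the comparison of products requires.\<close>
    proof (rule eventually_mono[OF eventually_gt_at_top[of "nat \<lceil>v\<rceil>"]])
      fix n assume "nat \<lceil>v\<rceil> < n"
      then have n: "v < n" "0 < n" using v0 by linarith+
      have w: "cmod (complex_of_real (1 - v / 2 / n)) \<le> 1"
        unfolding norm_of_real using n v0 by (simp add: abs_le_iff field_simps)
      have "norm ((\<Prod>i<n. g n i) - (\<Prod>i<n. complex_of_real (1 - v / 2 / n))) \<le> (\<Sum>i<n. norm (g n i - complex_of_real (1 - v / 2 / n)))"
        by (rule norm_prod_diff) (use g1 w in auto)
      also have "\<dots> \<le> (\<Sum>i<n. (1 / sqrt n) ^ 3 * (Ct * Ce))" by (intro sum_mono bound) auto
      also have "\<dots> = Ct * Ce / sqrt n" using n by (simp add: power3_eq_cube power_divide field_simps)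
      finally show "norm ((\<Prod>i<n. g n i) - complex_of_real ((1 + (- v / 2) / real n) ^ n)) \<le> Ct * Ce / sqrt n" by simp
    qed
    show "(\<lambda>n. Ct * Ce / sqrt (real n)) \<longlonglongrightarrow> 0" by real_asymp
  qed
  moreover have "(\<lambda>n. complex_of_real ((1 + (- v / 2) / real n) ^ n)) \<longlonglongrightarrow> complex_of_real (exp (- v / 2))"
    by (intro tendsto_of_real tendsto_exp_limit_sequentially)
  ultimately have "(\<lambda>n. ((\<Prod>i<n. g n i) - complex_of_real ((1 + (- v / 2) / real n) ^ n)) + complex_of_real ((1 + (- v / 2) / real n) ^ n)) \<longlonglongrightarrow> 0 + complex_of_real (exp (- v / 2))"
    by (rule tendsto_add)
  then have "(\<lambda>n. (\<Prod>i<n. g n i)) \<longlonglongrightarrow> complex_of_real (exp (- v / 2))" by simp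
  then show ?thesis unfolding score_char_prod g_def v_def by simp
qed

end

subsection \<open>The estimator\<close>

lemma matrix_inv_mult:
  fixes A :: "real^'q::finite^'q"
  assumes "invertible A"
  shows "A ** matrix_inv A = mat 1" "matrix_inv A ** A = mat 1"
  using someI_ex[OF assms[unfolded invertible_def]] by (auto simp: matrix_inv_def)

text \<open>The entrywise sum serves as operator bound because convergence of the Gram matrix is
  obtained entry by entry.\<close>

lemma norm_matrix_vector_le:
  fixes A :: "real^'q::finite^'q"
  shows "norm (A *v x) \<le> (\<Sum>j\<in>UNIV. \<Sum>k\<in>UNIV. \<bar>A $ j $ k\<bar>) * norm x"
proof -
  have "norm (A *v x) \<le> (\<Sum>j\<in>UNIV. \<bar>(A *v x) $ j\<bar>)" by (rule norm_le_l1_cart)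
  also have "\<dots> \<le> (\<Sum>j\<in>UNIV. \<Sum>k\<in>UNIV. \<bar>A $ j $ k\<bar> * norm x)"
  proof (rule sum_mono)
    fix j
    have "\<bar>(A *v x) $ j\<bar> \<le> (\<Sum>k\<in>UNIV. \<bar>A $ j $ k * x $ k\<bar>)"
      unfolding matrix_vector_mult_def by (simp add: sum_abs)
    also have "\<dots> \<le> (\<Sum>k\<in>UNIV. \<bar>A $ j $ k\<bar> * norm x)"
      by (intro sum_mono) (simp add: abs_mult mult_left_mono component_le_norm_cart)
    finally show "\<bar>(A *v x) $ j\<bar> \<le> (\<Sum>k\<in>UNIV. \<bar>A $ j $ k\<bar> * norm x)" .
  qed
  finally show ?thesis by (simp add: sum_distrib_right)
qed

text \<open>The bound on the inverse of \<open>S\<close> gives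
  \<open>norm x \<le> 2 * c * norm (G *v x)\<close>, so \<open>G\<close> is injective. The solution
  \<open>x\<close> then differs from \<open>matrix_inv S *v w\<close> by the inverse of
  \<open>S\<close> applied to \<open>r + (S - G) *v x\<close>, so the inverse of \<open>G\<close>
  never has to be expanded.\<close>

lemma perturbed_system:
  fixes S G :: "real^'q::finite^'q"
  assumes S: "invertible S" and c: "\<And>x. norm (matrix_inv S *v x) \<le> c * norm x" "c \<ge> 0"
    and D: "\<And>x. norm ((S - G) *v x) \<le> D * norm x" and small: "c * D \<le> 1 / 2"
  shows "invertible G"
    and "G *v x = w + r \<Longrightarrow> norm (x - matrix_inv S *v w) \<le> c * (norm r + D * (2 * c * norm (w + r)))"
proof -
  have Sx: "x = matrix_inv S *v (S *v x)" for x
    by (simp add: matrix_vector_mul_assoc matrix_inv_mult[OF S])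
  have split: "S *v x = G *v x + (S - G) *v x" for x
    by (simp add: matrix_vector_mult_diff_rdistrib)
  have nx: "norm x \<le> 2 * c * norm (G *v x)" for x
  proof -
    have "norm x \<le> c * norm (S *v x)" using c(1)[of "S *v x"] Sx[of x] by simp
    also have "\<dots> \<le> c * (norm (G *v x) + D * norm x)"
      unfolding split[of x] by (intro mult_left_mono c order_trans[OF norm_triangle_ineq] add_mono order_refl D)
    also have "\<dots> = c * norm (G *v x) + (c * D) * norm x" by (simp add: algebra_simps)
    also have "\<dots> \<le> c * norm (G *v x) + 1 / 2 * norm x" using small by (intro add_mono mult_right_mono) auto
    finally show ?thesis by simp
  qed
  have "x = 0" if "G *v x = 0" for x using nx[of x] that by simp
  then show "invertible G" unfolding invertible_left_inverse matrix_left_invertible_ker by blast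
  assume Gx: "G *v x = w + r"
  have "x - matrix_inv S *v w = matrix_inv S *v (S *v x - w)"
    using Sx[of x] by (simp add: matrix_vector_mult_diff_distrib)
  also have "S *v x - w = r + (S - G) *v x" unfolding split[of x] Gx by simp
  finally have "norm (x - matrix_inv S *v w) \<le> c * norm (r + (S - G) *v x)" using c(1) by simp
  also have "\<dots> \<le> c * (norm r + D * (2 * c * norm (w + r)))"
  proof (intro mult_left_mono c order_trans[OF norm_triangle_ineq] add_mono order_refl)
    show "norm ((S - G) *v x) \<le> D * (2 * c * norm (w + r))"
    \<comment> \<open>A nonzero \<open>x\<close> forces \<open>0 \<le> D\<close>; for
      \<open>x = 0\<close> both sides are 0.\<close>
    proof (cases "x = 0")
      case False
      have "0 \<le> D" using order_trans[OF norm_ge_zero D[of x]] False by (simp add: zero_le_mult_iff)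
      then show ?thesis using nx[of x] Gx by (intro order_trans[OF D] mult_left_mono) auto
    next
      case True
      then show ?thesis using Gx by simp
    qed
  qed
  finally show "norm (x - matrix_inv S *v w) \<le> c * (norm r + D * (2 * c * norm (w + r)))" .
qed

lemma borel_measurable_vec_lambda:
  fixes f :: "'q::finite \<Rightarrow> 'a \<Rightarrow> real"
  assumes "\<And>j. f j \<in> borel_measurable M"
  shows "(\<lambda>\<omega>. \<chi> j. f j \<omega>) \<in> borel_measurable M"
proof -
  have "(\<lambda>\<omega>. \<chi> j. f j \<omega>) = (\<lambda>\<omega>. \<Sum>j\<in>UNIV. f j \<omega> *\<^sub>R axis j 1)"
    using basis_expansion[of "\<chi> j. f j _"] by (auto simp: scalar_mult_eq_scaleR fun_eq_iff)
  then show ?thesis using assms by (simp add: borel_measurable_sum borel_measurable_scaleR)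
qed

lemma borel_measurable_det:
  fixes f :: "'q::finite \<Rightarrow> 'q \<Rightarrow> 'a \<Rightarrow> real"
  assumes "\<And>i j. f i j \<in> borel_measurable M"
  shows "(\<lambda>\<omega>. det (\<chi> i j. f i j \<omega>)) \<in> borel_measurable M"
  unfolding det_def using assms by (intro borel_measurable_sum borel_measurable_times borel_measurable_const borel_measurable_prod) auto

lemma measurable_fhat:
  assumes Z: "\<And>i k. i < n \<Longrightarrow> k < p \<Longrightarrow> (\<lambda>\<omega>. Z \<omega> i k) \<in> borel_measurable M"
    and V: "\<And>i. i < n \<Longrightarrow> (\<lambda>\<omega>. V \<omega> i) \<in> borel_measurable M"
  shows "(\<lambda>\<omega>. fhat n p (Z \<omega>) (V \<omega>) u \<alpha> i) \<in> borel_measurable M"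
proof -
  have m: "(\<lambda>\<omega>. proj n (Z \<omega>) m (V \<omega>) i) \<in> borel_measurable M" "(\<lambda>\<omega>. sqn n (resid n (Z \<omega>) m (V \<omega>))) \<in> borel_measurable M"
    if "m \<in> subsets_of_size p u" for m i
    using subsets_of_sizeD[OF that] Z V by (auto intro!: measurable_proj measurable_sqn measurable_resid)
  have e: "(\<lambda>\<omega>. exp (- sqn n (resid n (Z \<omega>) m (V \<omega>)) / \<alpha>)) \<in> borel_measurable M" if "m \<in> subsets_of_size p u" for m
    using m(2)[OF that] by (intro measurable_compose[OF _ borel_measurable_exp] borel_measurable_divide borel_measurable_uminus) auto
  show ?thesis unfolding fhat_def ew_weight_def
    by (intro borel_measurable_sum borel_measurable_times borel_measurable_divide e m(1))
qed

text \<open>Cramer's rule; with \<open>x / 0 = 0\<close> it also gives the value \<open>0\<close> in the singular case.\<close>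
lemma measurable_betahat:
  fixes X :: "'a \<Rightarrow> nat \<Rightarrow> real^'q::finite"
  assumes Z: "\<And>i k. i < n \<Longrightarrow> k < p \<Longrightarrow> (\<lambda>\<omega>. Z \<omega> i k) \<in> borel_measurable M"
    and Y: "\<And>i. i < n \<Longrightarrow> (\<lambda>\<omega>. Y \<omega> i) \<in> borel_measurable M"
    and X: "\<And>i j. i < n \<Longrightarrow> (\<lambda>\<omega>. X \<omega> i $ j) \<in> borel_measurable M"
  shows "(\<lambda>\<omega>. betahat n p (Z \<omega>) (Y \<omega>) (X \<omega>) u\<theta> \<alpha>Y u\<delta> \<alpha>X) \<in> borel_measurable M"
proof -
  define Xt where "Xt \<omega> i j = X \<omega> i $ j - fhat n p (Z \<omega>) (\<lambda>i. X \<omega> i $ j) (u\<delta> j) (\<alpha>X j) i" for \<omega> i j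
  define Yt where "Yt \<omega> i = Y \<omega> i - fhat n p (Z \<omega>) (Y \<omega>) u\<theta> \<alpha>Y i" for \<omega> i
  have Xt: "(\<lambda>\<omega>. Xt \<omega> i j) \<in> borel_measurable M" if "i < n" for i j
    unfolding Xt_def using that Z X by (intro borel_measurable_diff measurable_fhat) auto
  have Yt: "(\<lambda>\<omega>. Yt \<omega> i) \<in> borel_measurable M" if "i < n" for i
    unfolding Yt_def using that Z Y by (intro borel_measurable_diff measurable_fhat) auto
  define g where "g j k \<omega> = (\<Sum>i<n. Xt \<omega> i j * Xt \<omega> i k)" for j k \<omega>
  define b where "b j \<omega> = (\<Sum>i<n. Xt \<omega> i j * Yt \<omega> i)" for j \<omega>
  have gm: "g j k \<in> borel_measurable M" for j k
    unfolding g_def[abs_def] using Xt by (intro borel_measurable_sum borel_measurable_times) auto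
  have bm: "b j \<in> borel_measurable M" for j
    unfolding b_def[abs_def] using Xt Yt by (intro borel_measurable_sum borel_measurable_times) auto
  have "betahat n p (Z \<omega>) (Y \<omega>) (X \<omega>) u\<theta> \<alpha>Y u\<delta> \<alpha>X =
      (\<chi> k. det (\<chi> i j. if j = k then b i \<omega> else g i j \<omega>) / det (\<chi> i j. g i j \<omega>))" for \<omega>
  proof -
    let ?G = "\<chi> j k. g j k \<omega>" and ?b = "\<chi> j. b j \<omega>"
    have bh: "betahat n p (Z \<omega>) (Y \<omega>) (X \<omega>) u\<theta> \<alpha>Y u\<delta> \<alpha>X = (if invertible ?G then matrix_inv ?G *v ?b else 0)"
      by (simp add: betahat_def Let_def Xt_def Yt_def g_def b_def)
    show ?thesis
    proof (cases "invertible ?G")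
      case True
      then have d: "det ?G \<noteq> 0" by (simp add: invertible_det_nz)
      have "?G *v (matrix_inv ?G *v ?b) = ?b" by (simp add: matrix_vector_mul_assoc matrix_inv_mult[OF True])
      then have "matrix_inv ?G *v ?b = (\<chi> k. det (\<chi> i j. if j = k then ?b $ i else ?G $ i $ j) / det ?G)"
        using cramer[OF d] by blast
      then show ?thesis using bh True by (simp cong: if_cong)
    next
      case False
      then have "det ?G = 0" by (simp add: invertible_det_nz)
      then show ?thesis using bh False by (simp add: zero_vec_def)
    qed
  qed
  moreover have "(\<lambda>\<omega>. \<chi> k. det (\<chi> i j. if j = k then b i \<omega> else g i j \<omega>) / det (\<chi> i j. g i j \<omega>)) \<in> borel_measurable M"
  proof -
    have "(\<lambda>\<omega>. det (\<chi> i j. (if j = k then b i else g i j) \<omega>)) \<in> borel_measurable M" for k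
      by (rule borel_measurable_det) (simp add: gm bm)
    then have num: "(\<lambda>\<omega>. det (\<chi> i j. if j = k then b i \<omega> else g i j \<omega>)) \<in> borel_measurable M" for k
      by (simp add: if_distribR)
    have den: "(\<lambda>\<omega>. det (\<chi> i j. g i j \<omega>)) \<in> borel_measurable M" by (rule borel_measurable_det[OF gm])
    show ?thesis by (intro borel_measurable_vec_lambda borel_measurable_divide num den)
  qed
  ultimately show ?thesis by simp
qed

text \<open>Replaces the formula with \<open>matrix_inv\<close> by the linear system, the form in
  which \<open>perturbed_system\<close> is applied.\<close>

lemma betahat_normal_equations:
  fixes X :: "nat \<Rightarrow> real^'q::finite" and Y :: "nat \<Rightarrow> real" and Z :: "nat \<Rightarrow> nat \<Rightarrow> real"
    and n p u\<theta> :: nat and u\<delta> :: "'q \<Rightarrow> nat" and \<alpha>Y :: real and \<alpha>X :: "'q \<Rightarrow> real"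
  defines "Xt \<equiv> \<lambda>j i. X i $ j - fhat n p Z (\<lambda>i. X i $ j) (u\<delta> j) (\<alpha>X j) i"
    and "Yt \<equiv> \<lambda>i. Y i - fhat n p Z Y u\<theta> \<alpha>Y i"
  assumes "invertible (\<chi> j k. inn n (Xt j) (Xt k))"
  shows "(\<chi> j k. inn n (Xt j) (Xt k)) *v betahat n p Z Y X u\<theta> \<alpha>Y u\<delta> \<alpha>X = (\<chi> j. inn n (Xt j) Yt)"
proof -
  let ?G = "\<chi> j k. inn n (Xt j) (Xt k)" and ?b = "\<chi> j. inn n (Xt j) Yt"
  have "betahat n p Z Y X u\<theta> \<alpha>Y u\<delta> \<alpha>X = matrix_inv ?G *v ?b"
    using assms(3) by (simp add: betahat_def Let_def Xt_def Yt_def inn_def)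
  then show ?thesis by (simp add: matrix_vector_mul_assoc matrix_inv_mult[OF assms(3)])
qed

lemma (in prob_space) indep_sets_pair:
  assumes "indep_sets F I" "a \<in> I" "b \<in> I" "a \<noteq> b"
  shows "indep_set (F a) (F b)"
proof (rule indep_setI)
  show "F a \<subseteq> events" "F b \<subseteq> events" using assms by (auto simp: indep_sets_def)
  fix A B assume AB: "A \<in> F a" "B \<in> F b"
  have "prob (\<Inter>k\<in>{a, b}. if k = a then A else B) = (\<Prod>k\<in>{a, b}. prob (if k = a then A else B))"
    by (rule indep_setsD[OF assms(1)]) (use assms AB in auto)
  then show "prob (A \<inter> B) = prob A * prob B" using assms(4) by (auto simp: Int_commute)
qed

section \<open>Fitting errors in probability\<close>

lemma vanish_prob_weakly_sparse:
  assumes "weakly_sparse M p Z f s (\<lambda>n. sqrt (real n))"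
    and Z: "\<And>n i k. (\<lambda>\<omega>. Z n \<omega> i k) \<in> borel_measurable (M n)"
    and f: "\<And>n i. (\<lambda>\<omega>. f n \<omega> i) \<in> borel_measurable (M n)"
  obtains S where "\<And>n \<omega>. \<omega> \<in> space (M n) \<Longrightarrow> S n \<omega> \<in> subsets_of_size (p n) (s n)"
    and "vanish_prob M (\<lambda>n \<omega>. sqn n (resid n (Z n \<omega>) (S n \<omega>) (f n \<omega>)) / sqrt (real n))"
proof -
  obtain S where S: "\<And>n \<omega>. \<omega> \<in> space (M n) \<Longrightarrow> S n \<omega> \<in> subsets_of_size (p n) (s n)"
    "\<And>n m. {\<omega>\<in>space (M n). S n \<omega> = m} \<in> sets (M n)"
    "smallOp M (\<lambda>n \<omega>. sqn n (resid n (Z n \<omega>) (S n \<omega>) (f n \<omega>))) (\<lambda>n. sqrt (real n))"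
    using assms(1) unfolding weakly_sparse_def by blast
  have "vanish_prob M (\<lambda>n \<omega>. sqn n (resid n (Z n \<omega>) (S n \<omega>) (f n \<omega>)) / sqrt (real n))"
  proof (rule smallOp_vanish_prob[OF S(3)])
    fix n
    let ?I = "subsets_of_size (p n) (s n)"
    \<comment> \<open>The random set takes finitely many values on measurable events, so the
      residual at the random set is a finite sum of measurable pieces.\<close>
    let ?g = "\<lambda>\<omega>. \<Sum>m\<in>?I. indicator {\<omega>\<in>space (M n). S n \<omega> = m} \<omega> * sqn n (resid n (Z n \<omega>) m (f n \<omega>))"
    have "?g \<in> borel_measurable (M n)"
    proof (intro borel_measurable_sum borel_measurable_times borel_measurable_indicator S(2) measurable_sqn measurable_resid Z f)
      fix m assume "m \<in> ?I" then show "finite m" by (rule subsets_of_sizeD)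
    qed
    moreover have "sqn n (resid n (Z n \<omega>) (S n \<omega>) (f n \<omega>)) = ?g \<omega>" if "\<omega> \<in> space (M n)" for \<omega>
    proof -
      have "?g \<omega> = (\<Sum>m\<in>?I. if m = S n \<omega> then sqn n (resid n (Z n \<omega>) m (f n \<omega>)) else 0)"
        using that by (intro sum.cong) (auto simp: indicator_def)
      then show ?thesis using S(1)[OF that] by simp
    qed
    ultimately show "(\<lambda>\<omega>. sqn n (resid n (Z n \<omega>) (S n \<omega>) (f n \<omega>))) \<in> borel_measurable (M n)"
      by (simp cong: measurable_cong)
  next
    show "\<forall>\<^sub>F n in sequentially. 0 < sqrt (real n)"
      by (rule eventually_mono[OF eventually_gt_at_top[of 0]]) simp
  qed
  with S(1) show thesis by (rule that)
qed

text \<open>All terms of \<open>fhat_error\<close> are negligible at scale \<open>sqrt n\<close>.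
  The vector \<open>\<zeta>\<close> enters only through its energy and may thus be noise that is
  part of \<open>V\<close> itself.\<close>

lemma vanish_prob_fhat_error:
  fixes p u s :: "nat \<Rightarrow> nat"
  assumes V: "\<And>n \<omega> i. \<omega> \<in> space (M n) \<Longrightarrow> i < n \<Longrightarrow> V n \<omega> i = f n \<omega> i + \<xi> n \<omega> i"
    and sp: "weakly_sparse M p Z f s (\<lambda>n. sqrt (real n))"
    and Z: "\<And>n i k. (\<lambda>\<omega>. Z n \<omega> i k) \<in> borel_measurable (M n)"
    and f: "\<And>n i. (\<lambda>\<omega>. f n \<omega> i) \<in> borel_measurable (M n)"
    and su: "\<forall>\<^sub>F n in sequentially. s n \<le> u n" and up: "\<forall>\<^sub>F n in sequentially. u n \<le> p n"
    and rate: "(\<lambda>n. real (u n) * ln (real (p n)) / sqrt (real n)) \<longlonglongrightarrow> 0" and a: "\<alpha> > 0"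
    and E: "vanish_prob M (\<lambda>n \<omega>. max_energy n (p n) (Z n \<omega>) (f n \<omega>) (u n) (\<xi> n \<omega>) / sqrt (real n))"
    and E': "vanish_prob M (\<lambda>n \<omega>. max_energy n (p n) (Z n \<omega>) (f n \<omega>) (u n) (\<zeta> n \<omega>) / sqrt (real n))"
  shows "vanish_prob M (\<lambda>n \<omega>. sqn n (\<lambda>i. fhat n (p n) (Z n \<omega>) (V n \<omega>) (u n) \<alpha> i - f n \<omega> i) / sqrt (real n))"
    and "vanish_prob M (\<lambda>n \<omega>. inn n (\<lambda>i. fhat n (p n) (Z n \<omega>) (V n \<omega>) (u n) \<alpha> i - f n \<omega> i) (\<zeta> n \<omega>) / sqrt (real n))"
proof -
  obtain S where S: "\<And>n \<omega>. \<omega> \<in> space (M n) \<Longrightarrow> S n \<omega> \<in> subsets_of_size (p n) (s n)"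
    and B: "vanish_prob M (\<lambda>n \<omega>. sqn n (resid n (Z n \<omega>) (S n \<omega>) (f n \<omega>)) / sqrt (real n))"
    using vanish_prob_weakly_sparse[OF sp Z f] by blast
  have "(\<lambda>n. ln (real (p n choose u n)) / sqrt (real n)) \<longlonglongrightarrow> 0"
  proof (rule tendsto_sandwich[OF _ _ tendsto_const rate])
    show "\<forall>\<^sub>F n in sequentially. 0 \<le> ln (real (p n choose u n)) / sqrt (real n)" by (simp add: ln_nonneg_nat)
    show "\<forall>\<^sub>F n in sequentially. ln (real (p n choose u n)) / sqrt (real n) \<le> real (u n) * ln (real (p n)) / sqrt (real n)"
      using up by eventually_elim (simp add: ln_binomial_le divide_right_mono)
  qed
  then have L: "vanish_prob M (\<lambda>n \<omega>. ln (real (p n choose u n)) / sqrt (real n))" by (rule vanish_prob_const)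
  let ?B = "\<lambda>n \<omega>. sqn n (resid n (Z n \<omega>) (S n \<omega>) (f n \<omega>))"
  let ?E = "\<lambda>n \<omega>. max_energy n (p n) (Z n \<omega>) (f n \<omega>) (u n) (\<xi> n \<omega>)"
  let ?E' = "\<lambda>n \<omega>. max_energy n (p n) (Z n \<omega>) (f n \<omega>) (u n) (\<zeta> n \<omega>)"
  let ?L = "\<lambda>n. ln (real (p n choose u n))"
  let ?d = "\<lambda>n \<omega> i. fhat n (p n) (Z n \<omega>) (V n \<omega>) (u n) \<alpha> i - f n \<omega> i"
  have v1: "vanish_prob M (\<lambda>n \<omega>. 8 * (?B n \<omega> / sqrt n) + 18 * (?E n \<omega> / sqrt n) + 4 * \<alpha> * (?L n / sqrt n))"
    by (intro vanish_prob_add vanish_prob_cmult B E L)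
  have v2: "vanish_prob M (\<lambda>n \<omega>. 2 * (?B n \<omega> / sqrt n) + 5 * (?E n \<omega> / sqrt n) + ?E' n \<omega> / sqrt n + \<alpha> * (?L n / sqrt n))"
    by (intro vanish_prob_add vanish_prob_cmult B E E' L)
  have bounds: "\<forall>\<^sub>F n in sequentially. \<forall>\<omega>\<in>space (M n).
     sqn n (?d n \<omega>) \<le> 8 * ?B n \<omega> + 18 * ?E n \<omega> + 4 * \<alpha> * ?L n \<and>
     \<bar>inn n (?d n \<omega>) (\<zeta> n \<omega>)\<bar> \<le> 2 * ?B n \<omega> + 5 * ?E n \<omega> + ?E' n \<omega> + \<alpha> * ?L n"
    using su up
  proof eventually_elim
    case (elim n)
    show ?case
    proof (intro ballI conjI)
      fix \<omega> assume w: "\<omega> \<in> space (M n)"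
      note fe = fhat_error[OF V[OF w] S[OF w] elim a, where E="?E n \<omega>" and E'="?E' n \<omega>"]
      show "sqn n (?d n \<omega>) \<le> 8 * ?B n \<omega> + 18 * ?E n \<omega> + 4 * \<alpha> * ?L n"
        by (rule fe(1)) (auto intro: energy_le_max)
      show "\<bar>inn n (?d n \<omega>) (\<zeta> n \<omega>)\<bar> \<le> 2 * ?B n \<omega> + 5 * ?E n \<omega> + ?E' n \<omega> + \<alpha> * ?L n"
        by (rule fe(2)) (auto intro: energy_le_max)
    qed
  qed
  show "vanish_prob M (\<lambda>n \<omega>. sqn n (?d n \<omega>) / sqrt (real n))"
  proof (rule vanish_prob_mono[OF v1], rule eventually_mono[OF bounds], rule ballI)
    fix n \<omega> assume "\<forall>\<omega>\<in>space (M n). sqn n (?d n \<omega>) \<le> 8 * ?B n \<omega> + 18 * ?E n \<omega> + 4 * \<alpha> * ?L n \<and>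
      \<bar>inn n (?d n \<omega>) (\<zeta> n \<omega>)\<bar> \<le> 2 * ?B n \<omega> + 5 * ?E n \<omega> + ?E' n \<omega> + \<alpha> * ?L n" "\<omega> \<in> space (M n)"
    then have "sqn n (?d n \<omega>) / sqrt n \<le> (8 * ?B n \<omega> + 18 * ?E n \<omega> + 4 * \<alpha> * ?L n) / sqrt n"
      by (intro divide_right_mono) auto
    also have "\<dots> = 8 * (?B n \<omega> / sqrt n) + 18 * (?E n \<omega> / sqrt n) + 4 * \<alpha> * (?L n / sqrt n)"
      by (simp add: add_divide_distrib)
    also have "\<dots> \<le> \<bar>\<dots>\<bar>" by (rule abs_ge_self)
    finally show "\<bar>sqn n (?d n \<omega>) / sqrt (real n)\<bar> \<le> \<bar>8 * (?B n \<omega> / sqrt n) + 18 * (?E n \<omega> / sqrt n) + 4 * \<alpha> * (?L n / sqrt n)\<bar>"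
      by simp
  qed
  show "vanish_prob M (\<lambda>n \<omega>. inn n (?d n \<omega>) (\<zeta> n \<omega>) / sqrt (real n))"
  proof (rule vanish_prob_mono[OF v2], rule eventually_mono[OF bounds], rule ballI)
    fix n \<omega> assume "\<forall>\<omega>\<in>space (M n). sqn n (?d n \<omega>) \<le> 8 * ?B n \<omega> + 18 * ?E n \<omega> + 4 * \<alpha> * ?L n \<and>
      \<bar>inn n (?d n \<omega>) (\<zeta> n \<omega>)\<bar> \<le> 2 * ?B n \<omega> + 5 * ?E n \<omega> + ?E' n \<omega> + \<alpha> * ?L n" "\<omega> \<in> space (M n)"
    then have "\<bar>inn n (?d n \<omega>) (\<zeta> n \<omega>)\<bar> / sqrt n \<le> (2 * ?B n \<omega> + 5 * ?E n \<omega> + ?E' n \<omega> + \<alpha> * ?L n) / sqrt n"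
      by (intro divide_right_mono) auto
    also have "\<dots> = 2 * (?B n \<omega> / sqrt n) + 5 * (?E n \<omega> / sqrt n) + ?E' n \<omega> / sqrt n + \<alpha> * (?L n / sqrt n)"
      by (simp add: add_divide_distrib)
    also have "\<dots> \<le> \<bar>\<dots>\<bar>" by (rule abs_ge_self)
    finally show "\<bar>inn n (?d n \<omega>) (\<zeta> n \<omega>) / sqrt (real n)\<bar> \<le> \<bar>2 * (?B n \<omega> / sqrt n) + 5 * (?E n \<omega> / sqrt n) + ?E' n \<omega> / sqrt n + \<alpha> * (?L n / sqrt n)\<bar>"
      by (simp add: abs_divide)
  qed
qed

subsection \<open>Asymptotic normality\<close>

lemma cis_lipschitz: "cmod (cis a - cis b) \<le> \<bar>a - b\<bar>"
proof -
  have "cmod (cis a - cis b) = cmod (cis b * (cis (a - b) - 1))" by (simp add: right_diff_distrib cis_mult)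
  also have "\<dots> = cmod (exp (\<i> * of_real (a - b)) - 1)" by (simp add: norm_mult cis_conv_exp)
  also have "\<dots> \<le> \<bar>a - b\<bar>" using iexp_approx1[of "a - b" 0] by (simp add: mult.commute)
  finally show ?thesis .
qed

text \<open>Slutsky's theorem at the level of characteristic functions: \<open>cis\<close> is
  1-Lipschitz and bounded, so closeness in probability transfers the limit, and \<open>X\<close>
  inherits tightness from \<open>W\<close>.\<close>

lemma conv_in_distr_slutsky:
  fixes X W :: "nat \<Rightarrow> 'a \<Rightarrow> real^'q::finite"
  assumes M: "\<And>n. prob_space (M n)" and X: "\<And>n. X n \<in> borel_measurable (M n)" and W: "\<And>n. W n \<in> borel_measurable (M n)"
    and L: "prob_space L" "sets L = sets borel"
    and char: "\<And>t. (\<lambda>n. \<integral>\<omega>. cis (t \<bullet> W n \<omega>) \<partial>M n) \<longlonglongrightarrow> (\<integral>x. cis (t \<bullet> x) \<partial>L)"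
    and diff: "vanish_prob M (\<lambda>n \<omega>. norm (X n \<omega> - W n \<omega>))" and bdd: "bounded_prob M (\<lambda>n \<omega>. norm (W n \<omega>))"
  shows "conv_in_distr M X L"
proof (rule levy_continuity_multivariate[OF M X L])
  fix t :: "real^'q"
  have "(\<lambda>n. (\<integral>\<omega>. cis (t \<bullet> X n \<omega>) \<partial>M n) - (\<integral>\<omega>. cis (t \<bullet> W n \<omega>) \<partial>M n)) \<longlonglongrightarrow> 0"
  proof (rule tendstoI)
    fix e :: real assume e: "e > 0"
    \<comment> \<open>The \<open>+ 1\<close> admits \<open>t = 0\<close>. Together with
      \<open>2 * (e / 8)\<close> from the exceptional event the total is at most
      \<open>e / 2\<close>.\<close>
    define d where "d = e / (4 * (norm t + 1))"
    have t1: "norm t + 1 > 0" by (simp add: add_nonneg_pos)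
    have d: "d > 0" using e t1 by (simp add: d_def)
    have td: "norm t * d \<le> e / 4"
    proof -
      have "norm t * d \<le> (norm t + 1) * d" using d by simp
      moreover have "a * (e / (4 * a)) = e / 4" if "a > 0" for a :: real using that by simp
      from this[OF t1] have "(norm t + 1) * d = e / 4" unfolding d_def .
      ultimately show ?thesis by simp
    qed
    have e8: "e / 8 > 0" using e by simp
    from vanish_probD[OF diff d e8, unfolded outside_small_def]
    show "\<forall>\<^sub>F n in sequentially. dist ((\<integral>\<omega>. cis (t \<bullet> X n \<omega>) \<partial>M n) - (\<integral>\<omega>. cis (t \<bullet> W n \<omega>) \<partial>M n)) 0 < e"
    proof eventually_elim
      case (elim n)
      then obtain A where A: "A \<in> sets (M n)" "measure (M n) A \<le> e / 8" "\<forall>\<omega>\<in>space (M n) - A. \<bar>norm (X n \<omega> - W n \<omega>)\<bar> \<le> d" by blast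
      have "norm ((\<integral>\<omega>. cis (t \<bullet> X n \<omega>) \<partial>M n) - (\<integral>\<omega>. cis (t \<bullet> W n \<omega>) \<partial>M n)) \<le> e / 4 + 2 * measure (M n) A"
      proof (rule integral_diff_le_off_event[OF M _ _ A(1)])
        show "integrable (M n) (\<lambda>\<omega>. cis (t \<bullet> X n \<omega>))" "integrable (M n) (\<lambda>\<omega>. cis (t \<bullet> W n \<omega>))"
          using X W by (auto intro!: norm_cis_integral_le_1 M borel_measurable_inner)
        show "norm (cis (t \<bullet> X n \<omega>) - cis (t \<bullet> W n \<omega>)) \<le> 2" for \<omega>
          using norm_triangle_ineq4[of "cis (t \<bullet> X n \<omega>)" "cis (t \<bullet> W n \<omega>)"] by simp
        show "norm (cis (t \<bullet> X n \<omega>) - cis (t \<bullet> W n \<omega>)) \<le> e / 4" if "\<omega> \<in> space (M n) - A" for \<omega>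
        proof -
          have "norm (cis (t \<bullet> X n \<omega>) - cis (t \<bullet> W n \<omega>)) \<le> \<bar>t \<bullet> X n \<omega> - t \<bullet> W n \<omega>\<bar>"
            by (rule cis_lipschitz)
          also have "\<dots> = \<bar>t \<bullet> (X n \<omega> - W n \<omega>)\<bar>" by (simp add: inner_diff_right)
          also have "\<dots> \<le> norm t * norm (X n \<omega> - W n \<omega>)" by (rule Cauchy_Schwarz_ineq2)
          also have "\<dots> \<le> norm t * d" using bspec[OF A(3) that] by (intro mult_left_mono) auto
          finally show ?thesis using td by linarith
        qed
      qed (use e in auto)
      then show ?case using A(2) e by (simp add: dist_norm)
    qed
  qed
  from tendsto_add[OF this char[of t]]
  show "(\<lambda>n. \<integral>\<omega>. cis (t \<bullet> X n \<omega>) \<partial>M n) \<longlonglongrightarrow> (\<integral>x. cis (t \<bullet> x) \<partial>L)" by simp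
next
  have "bounded_prob M (\<lambda>n \<omega>. norm (X n \<omega> - W n \<omega>) + norm (W n \<omega>))"
    by (intro bounded_prob_add vanish_prob_bounded diff bdd)
  then show "bounded_prob M (\<lambda>n \<omega>. norm (X n \<omega>))"
  proof (rule bounded_prob_mono, intro always_eventually allI ballI)
    fix n \<omega>
    show "\<bar>norm (X n \<omega>)\<bar> \<le> \<bar>norm (X n \<omega> - W n \<omega>) + norm (W n \<omega>)\<bar>"
      using norm_triangle_ineq[of "X n \<omega> - W n \<omega>" "W n \<omega>"] by simp
  qed
qed

theorem mainTheorem10:
  fixes M :: "nat \<Rightarrow> 'a measure"
    and p :: "nat \<Rightarrow> nat"
    and Z :: "nat \<Rightarrow> 'a \<Rightarrow> nat \<Rightarrow> nat \<Rightarrow> real"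
    and Y \<mu> \<epsilon> :: "nat \<Rightarrow> 'a \<Rightarrow> nat \<Rightarrow> real"
    and X N H :: "nat \<Rightarrow> 'a \<Rightarrow> nat \<Rightarrow> real^'q::finite"
    and \<beta> :: "real^'q"
    and \<sigma>\<epsilon>2 :: real and \<Sigma>H :: "real^'q^'q"
    and K\<eta> :: "'q \<Rightarrow> real" and K\<epsilon> KY :: real
    and s\<gamma> s\<theta> u\<gamma> u\<theta> :: "nat \<Rightarrow> nat"
    and s\<delta> u\<delta> :: "'q \<Rightarrow> nat \<Rightarrow> nat"
    and \<alpha>Y :: real and \<alpha>X :: "'q \<Rightarrow> real"
  assumes prob: "\<And>n. prob_space (M n)"
    \<comment> \<open>all model quantities are random variables\<close>
    and meas_Z: "\<And>n i j. (\<lambda>\<omega>. Z n \<omega> i j) \<in> borel_measurable (M n)"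
    and meas_mu: "\<And>n i. (\<lambda>\<omega>. \<mu> n \<omega> i) \<in> borel_measurable (M n)"
    and meas_eps: "\<And>n i. (\<lambda>\<omega>. \<epsilon> n \<omega> i) \<in> borel_measurable (M n)"
    and meas_N: "\<And>n i. (\<lambda>\<omega>. N n \<omega> i) \<in> borel_measurable (M n)"
    and meas_H: "\<And>n i. (\<lambda>\<omega>. H n \<omega> i) \<in> borel_measurable (M n)"
    \<comment> \<open>the model  Y = X beta + mu + eps,  X = N + H\<close>
    and model_Y: "\<And>n \<omega> i. \<omega> \<in> space (M n) \<Longrightarrow> i < n \<Longrightarrow>
                    Y n \<omega> i = X n \<omega> i \<bullet> \<beta> + \<mu> n \<omega> i + \<epsilon> n \<omega> i"
    and model_X: "\<And>n \<omega> i. \<omega> \<in> space (M n) \<Longrightarrow> i < n \<Longrightarrow> X n \<omega> i = N n \<omega> i + H n \<omega> i"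
    \<comment> \<open>(B1)\<close>
    and B1_mu: "bigOp M (\<lambda>n \<omega>. sqn n (\<mu> n \<omega>)) (\<lambda>n. real n)"
    and B1_N: "\<And>j. bigOp M (\<lambda>n \<omega>. sqn n (\<lambda>i. N n \<omega> i $ j)) (\<lambda>n. real n)"
    \<comment> \<open>(B2): rows of H i.i.d., entries of eps i.i.d.\<close>
    and B2_H_indep: "\<And>n. prob_space.indep_vars (M n) (\<lambda>_. borel) (\<lambda>i \<omega>. H n \<omega> i) {..<n}"
    and B2_H_ident: "\<And>n i. i < n \<Longrightarrow>
                       distr (M n) borel (\<lambda>\<omega>. H n \<omega> i) = distr (M n) borel (\<lambda>\<omega>. H n \<omega> 0)"
    and B2_eps_indep: "\<And>n. prob_space.indep_vars (M n) (\<lambda>_. borel) (\<lambda>i \<omega>. \<epsilon> n \<omega> i) {..<n}"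
    and B2_eps_ident: "\<And>n i. i < n \<Longrightarrow>
                       distr (M n) borel (\<lambda>\<omega>. \<epsilon> n \<omega> i) = distr (M n) borel (\<lambda>\<omega>. \<epsilon> n \<omega> 0)"
    \<comment> \<open>(B2): H, eps and (Z, mu, N) mutually independent\<close>
    and B2_indep: "\<And>n. prob_space.indep_sets (M n)
         (\<lambda>k::nat. if k = 0 then gen_sigma (M n) {(\<lambda>\<omega>. H n \<omega> i $ j) | i j. i < n}
                   else if k = 1 then gen_sigma (M n) {(\<lambda>\<omega>. \<epsilon> n \<omega> i) | i. i < n}
                   else gen_sigma (M n) ({(\<lambda>\<omega>. Z n \<omega> i j) | i j. i < n \<and> j < p n}
                                          \<union> {(\<lambda>\<omega>. \<mu> n \<omega> i) | i. i < n}
                                          \<union> {(\<lambda>\<omega>. N n \<omega> i $ j) | i j. i < n}))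
         {0, 1, 2}"
    \<comment> \<open>(B2): sub-Gaussianity\<close>
    and B2_H_subg: "\<And>n i j. i < n \<Longrightarrow> subgaussian (M n) (\<lambda>\<omega>. H n \<omega> i $ j) (K\<eta> j)"
    and B2_eps_subg: "\<And>n i. i < n \<Longrightarrow> subgaussian (M n) (\<lambda>\<omega>. \<epsilon> n \<omega> i) K\<epsilon>"
    \<comment> \<open>sigma_eps^2 = Var(eps_1), Sigma_H = Var(H^(1)) (fixed), Sigma_H invertible\<close>
    and var_eps: "\<And>n. 0 < n \<Longrightarrow> prob_space.variance (M n) (\<lambda>\<omega>. \<epsilon> n \<omega> 0) = \<sigma>\<epsilon>2"
    and var_H: "\<And>n j k. 0 < n \<Longrightarrow>
       (\<integral>\<omega>. (H n \<omega> 0 $ j - (\<integral>\<omega>'. H n \<omega>' 0 $ j \<partial>M n)) *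
             (H n \<omega> 0 $ k - (\<integral>\<omega>'. H n \<omega>' 0 $ k \<partial>M n)) \<partial>M n) = \<Sigma>H $ j $ k"
    and \<Sigma>H_inv: "invertible \<Sigma>H"
    \<comment> \<open>K_Y: a fixed sub-Gaussian parameter of the vector H beta + eps\<close>
    and KY_subg: "\<And>n. subgaussian_vec (M n) n (\<lambda>\<omega> i. H n \<omega> i \<bullet> \<beta> + \<epsilon> n \<omega> i) KY"
    \<comment> \<open>(B3)\<close>
    and B3_mu: "weakly_sparse M p Z \<mu> s\<gamma> (\<lambda>n. sqrt (real n))"
    and B3_N: "\<And>j. weakly_sparse M p Z (\<lambda>n \<omega> i. N n \<omega> i $ j) (s\<delta> j) (\<lambda>n. sqrt (real n))"
    and B3_theta: "weakly_sparse M p Z (\<lambda>n \<omega> i. N n \<omega> i \<bullet> \<beta> + \<mu> n \<omega> i) s\<theta> (\<lambda>n. sqrt (real n))"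
    and B3_u: "eventually (\<lambda>n. s\<gamma> n \<le> u\<gamma> n \<and> s\<theta> n \<le> u\<theta> n \<and> (\<forall>j. s\<delta> j n \<le> u\<delta> j n)) sequentially"
    and B3_u_le_p: "eventually (\<lambda>n. u\<theta> n \<le> p n \<and> (\<forall>j. u\<delta> j n \<le> p n)) sequentially"
    and B3_rate: "(\<lambda>n. real (max (u\<gamma> n) (max (Max (range (\<lambda>j. u\<delta> j n))) (u\<theta> n))) * ln (real (p n))
                        / sqrt (real n)) \<longlonglongrightarrow> 0"
    \<comment> \<open>tuning parameters\<close>
    and \<alpha>Y: "\<alpha>Y > 4 * KY\<^sup>2"
    and \<alpha>X: "\<And>j. \<alpha>X j > 4 * (K\<eta> j)\<^sup>2"
  shows "\<exists>L. is_mvnormal L (\<sigma>\<epsilon>2 *\<^sub>R matrix_inv \<Sigma>H) \<and>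
           conv_in_distr M
             (\<lambda>n \<omega>. sqrt (real n) *\<^sub>R
                (betahat n (p n) (Z n \<omega>) (Y n \<omega>) (X n \<omega>) (u\<theta> n) \<alpha>Y (\<lambda>j. u\<delta> j n) \<alpha>X - \<beta>)) L"
proof -

  \<comment> \<open>The three independent blocks\<close>
  define FH where "FH n = {(\<lambda>\<omega>. H n \<omega> i $ j) | i j. i < n}" for n
  define FE where "FE n = {(\<lambda>\<omega>. \<epsilon> n \<omega> i) | i. i < n}" for n
  define FD where "FD n = {(\<lambda>\<omega>. Z n \<omega> i j) | i j. i < n \<and> j < p n} \<union> {(\<lambda>\<omega>. \<mu> n \<omega> i) | i. i < n}
    \<union> {(\<lambda>\<omega>. N n \<omega> i $ j) | i j. i < n}" for n
  \<comment> \<open>The first pair is for the score; the other two freeze the design and the signal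
    in the energy bounds.\<close>
  have ind: "prob_space.indep_set (M n) (gen_sigma (M n) (FH n)) (gen_sigma (M n) (FE n))"
    "prob_space.indep_set (M n) (gen_sigma (M n) (FH n)) (gen_sigma (M n) (FD n))"
    "prob_space.indep_set (M n) (gen_sigma (M n) (FE n)) (gen_sigma (M n) (FD n))" for n
  proof -
    note pair = prob_space.indep_sets_pair[OF prob B2_indep[of n, folded FH_def FE_def FD_def]]
    show "prob_space.indep_set (M n) (gen_sigma (M n) (FH n)) (gen_sigma (M n) (FE n))"
      using pair[of 0 1] by simp
    show "prob_space.indep_set (M n) (gen_sigma (M n) (FH n)) (gen_sigma (M n) (FD n))"
      using pair[of 0 2] by simp
    show "prob_space.indep_set (M n) (gen_sigma (M n) (FE n)) (gen_sigma (M n) (FD n))"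
      using pair[of 1 2] by simp
  qed
  interpret regression_noise M H \<epsilon> \<sigma>\<epsilon>2 \<Sigma>H K\<eta> K\<epsilon>
    by (rule regression_noise.intro, rule prob, rule meas_eps, rule meas_H, rule B2_H_indep, erule B2_H_ident, rule B2_eps_indep,
        erule B2_eps_ident, rule ind(1)[unfolded FH_def FE_def], erule B2_H_subg, erule B2_eps_subg, erule var_eps, erule var_H)
  have FHm: "h \<in> borel_measurable (M n)" if "h \<in> FH n" for n h using that by (auto simp: FH_def meas_H_component)
  have FEm: "h \<in> borel_measurable (M n)" if "h \<in> FE n" for n h using that by (auto simp: FE_def meas_eps)
  have meas_N_component: "(\<lambda>\<omega>. N n \<omega> i $ j) \<in> borel_measurable (M n)" for n i j
    using meas_N by (rule borel_measurable_vec_nth)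
  have FDm: "h \<in> borel_measurable (M n)" if "h \<in> FD n" for n h
    using that by (auto simp: FD_def meas_Z meas_mu meas_N_component)

  \<comment> \<open>Signals and noises of the regressions on \<open>Z\<close>\<close>
  define f\<theta> where "f\<theta> n \<omega> i = N n \<omega> i \<bullet> \<beta> + \<mu> n \<omega> i" for n \<omega> i
  define fN where "fN j n \<omega> i = N n \<omega> i $ j" for j n \<omega> i
  define \<eta> where "\<eta> j n \<omega> i = H n \<omega> i $ j" for j n \<omega> i
  define \<xi> where "\<xi> n \<omega> i = H n \<omega> i \<bullet> \<beta> + \<epsilon> n \<omega> i" for n \<omega> i
  have ZD: "(\<lambda>\<omega>. Z n \<omega> i k) \<in> borel_measurable (sub_alg (M n) (FD n))" if "i < n" "k < p n" for n i k
    by (rule sub_alg_measurable) (use that in \<open>auto simp: FD_def\<close>)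
  have ND: "(\<lambda>\<omega>. fN j n \<omega> i) \<in> borel_measurable (sub_alg (M n) (FD n))" if "i < n" for n i j
    unfolding fN_def by (rule sub_alg_measurable) (use that in \<open>auto simp: FD_def\<close>)
  have \<mu>D: "(\<lambda>\<omega>. \<mu> n \<omega> i) \<in> borel_measurable (sub_alg (M n) (FD n))" if "i < n" for n i
    by (rule sub_alg_measurable) (use that in \<open>auto simp: FD_def\<close>)
  have \<theta>D: "(\<lambda>\<omega>. f\<theta> n \<omega> i) \<in> borel_measurable (sub_alg (M n) (FD n))" if "i < n" for n i
    unfolding f\<theta>_def inner_vec_def using ND[OF that] \<mu>D[OF that]
    by (intro borel_measurable_add borel_measurable_sum borel_measurable_inner) (auto simp: fN_def)
  have f\<theta>m: "(\<lambda>\<omega>. f\<theta> n \<omega> i) \<in> borel_measurable (M n)" for n i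
    unfolding f\<theta>_def using meas_N meas_mu by (intro borel_measurable_add borel_measurable_inner) auto
  have fNm: "(\<lambda>\<omega>. fN j n \<omega> i) \<in> borel_measurable (M n)" for n i j
    unfolding fN_def by (rule meas_N_component)

  have rate: "(\<lambda>n. real (u n) * ln (real (p n)) / sqrt (real n)) \<longlonglongrightarrow> 0"
    if "\<And>n. u n \<le> max (u\<gamma> n) (max (Max (range (\<lambda>j. u\<delta> j n))) (u\<theta> n))" for u
  proof (rule tendsto_sandwich[OF _ _ tendsto_const B3_rate]; intro always_eventually allI)
    fix n
    show "0 \<le> real (u n) * ln (real (p n)) / sqrt (real n)" by (simp add: ln_nonneg_nat)
    show "real (u n) * ln (real (p n)) / sqrt (real n) \<le>
      real (max (u\<gamma> n) (max (Max (range (\<lambda>j. u\<delta> j n))) (u\<theta> n))) * ln (real (p n)) / sqrt (real n)"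
      using that[of n] by (intro divide_right_mono mult_right_mono ln_nonneg_nat) (simp_all only: of_nat_le_iff real_sqrt_ge_zero of_nat_0_le_iff)
  qed
  have rate\<theta>: "(\<lambda>n. real (u\<theta> n) * ln (real (p n)) / sqrt (real n)) \<longlonglongrightarrow> 0" by (rule rate) simp
  have rate\<delta>: "(\<lambda>n. real (u\<delta> j n) * ln (real (p n)) / sqrt (real n)) \<longlonglongrightarrow> 0" for j
  proof (rule rate)
    fix n
    have le: "u\<delta> j n \<le> Max (range (\<lambda>j. u\<delta> j n))" by (intro Max_ge) auto
    show "u\<delta> j n \<le> max (u\<gamma> n) (max (Max (range (\<lambda>j. u\<delta> j n))) (u\<theta> n))"
      by (rule max.coboundedI2[OF max.coboundedI1[OF le]])
  qed
  have up\<theta>: "\<forall>\<^sub>F n in sequentially. u\<theta> n \<le> p n" using B3_u_le_p by (rule eventually_mono) simp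
  have up\<delta>: "\<forall>\<^sub>F n in sequentially. u\<delta> j n \<le> p n" for j using B3_u_le_p by (rule eventually_mono) simp
  have su\<theta>: "\<forall>\<^sub>F n in sequentially. s\<theta> n \<le> u\<theta> n" using B3_u by (rule eventually_mono) simp
  have su\<delta>: "\<forall>\<^sub>F n in sequentially. s\<delta> j n \<le> u\<delta> j n" for j using B3_u by (rule eventually_mono) simp

  \<comment> \<open>Energies of the noise vectors\<close>
  have \<eta>H: "(\<lambda>\<omega>. \<eta> k n \<omega> i) \<in> borel_measurable (sub_alg (M n) (FH n))" if "i < n" for k n i
    unfolding \<eta>_def FH_def using that by (rule H_sub_alg)
  have \<eta>_indep: "prob_space.indep_vars (M n) (\<lambda>_. borel) (\<lambda>i \<omega>. \<eta> k n \<omega> i) {..<n}" for k n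
    unfolding \<eta>_def by (rule H_indep_column)
  have \<eta>_subg: "subgaussian (M n) (\<lambda>\<omega>. \<eta> k n \<omega> i) (K\<eta> k)" if "i < n" for k n i
    unfolding \<eta>_def using that by (rule H_subg)
  have \<epsilon>E: "(\<lambda>\<omega>. \<epsilon> n \<omega> i) \<in> borel_measurable (sub_alg (M n) (FE n))" if "i < n" for n i
    unfolding FE_def using that by (rule eps_sub_alg)
  have en\<eta>: "vanish_prob M (\<lambda>n \<omega>. max_energy n (p n) (Z n \<omega>) (f n \<omega>) (u n) (\<eta> k n \<omega>) / sqrt (real n))"
    if "\<And>n i. i < n \<Longrightarrow> (\<lambda>\<omega>. f n \<omega> i) \<in> borel_measurable (sub_alg (M n) (FD n))" "\<forall>\<^sub>F n in sequentially. u n \<le> p n"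
      "(\<lambda>n. real (u n) * ln (real (p n)) / sqrt (real n)) \<longlonglongrightarrow> 0" for f u k
    by (rule vanish_prob_max_energy[OF prob FHm FDm ind(2) \<eta>H ZD that(1) \<eta>_indep \<eta>_subg that(2,3)])
  have en\<epsilon>: "vanish_prob M (\<lambda>n \<omega>. max_energy n (p n) (Z n \<omega>) (f n \<omega>) (u n) (\<epsilon> n \<omega>) / sqrt (real n))"
    if "\<And>n i. i < n \<Longrightarrow> (\<lambda>\<omega>. f n \<omega> i) \<in> borel_measurable (sub_alg (M n) (FD n))" "\<forall>\<^sub>F n in sequentially. u n \<le> p n"
      "(\<lambda>n. real (u n) * ln (real (p n)) / sqrt (real n)) \<longlonglongrightarrow> 0" for f u
    by (rule vanish_prob_max_energy[OF prob FEm FDm ind(3) \<epsilon>E ZD that(1) eps_indep eps_subg that(2,3)])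
  \<comment> \<open>The noise of \<open>Y\<close> mixes rows of \<open>H\<close> with
    \<open>\<epsilon>\<close>; its energy is dominated by energies of the parts for the same design
    and signal.\<close>
  have en\<xi>: "vanish_prob M (\<lambda>n \<omega>. max_energy n (p n) (Z n \<omega>) (f\<theta> n \<omega>) (u\<theta> n) (\<xi> n \<omega>) / sqrt (real n))"
  proof -
    let ?e = "\<lambda>v n \<omega>. max_energy n (p n) (Z n \<omega>) (f\<theta> n \<omega>) (u\<theta> n) v"
    let ?b = "\<lambda>n \<omega>. 2 * (real CARD('q) * (\<Sum>j\<in>UNIV. (\<beta> $ j)\<^sup>2 * (?e (\<eta> j n \<omega>) n \<omega> / sqrt n))) + 2 * (?e (\<epsilon> n \<omega>) n \<omega> / sqrt n)"
    have "vanish_prob M ?b"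
      by (intro vanish_prob_add vanish_prob_cmult vanish_prob_sum en\<eta>[OF \<theta>D up\<theta> rate\<theta>] en\<epsilon>[OF \<theta>D up\<theta> rate\<theta>]) auto
    then show ?thesis
    proof (rule vanish_prob_mono, intro always_eventually allI ballI)
      fix n \<omega>
      have \<xi>eq: "\<xi> n \<omega> = (\<lambda>i. (\<Sum>j\<in>UNIV. \<beta> $ j * \<eta> j n \<omega> i) + \<epsilon> n \<omega> i)"
        by (simp add: \<xi>_def \<eta>_def inner_vec_def mult.commute fun_eq_iff)
      have "?e (\<xi> n \<omega>) n \<omega> \<le> 2 * (real CARD('q) * (\<Sum>j\<in>UNIV. (\<beta> $ j)\<^sup>2 * ?e (\<eta> j n \<omega>) n \<omega>)) + 2 * ?e (\<epsilon> n \<omega>) n \<omega>"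
      proof (rule max_energy_le)
        show "0 \<le> 2 * (real CARD('q) * (\<Sum>j\<in>UNIV. (\<beta> $ j)\<^sup>2 * ?e (\<eta> j n \<omega>) n \<omega>)) + 2 * ?e (\<epsilon> n \<omega>) n \<omega>"
          by (intro add_nonneg_nonneg mult_nonneg_nonneg sum_nonneg) auto
        fix m assume m: "m \<in> subsets_of_size (p n) (u\<theta> n)"
        let ?g = "energy n (p n) (Z n \<omega>) (f\<theta> n \<omega>) m"
        have "?g (\<xi> n \<omega>) \<le> 2 * ?g (\<lambda>i. \<Sum>j\<in>UNIV. \<beta> $ j * \<eta> j n \<omega> i) + 2 * ?g (\<epsilon> n \<omega>)"
          unfolding \<xi>eq by (rule energy_add_le[OF subsets_of_sizeD(1)[OF m]])
        also have "\<dots> \<le> 2 * (real CARD('q) * (\<Sum>j\<in>UNIV. (\<beta> $ j)\<^sup>2 * ?g (\<eta> j n \<omega>))) + 2 * ?g (\<epsilon> n \<omega>)"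
          by (intro add_mono mult_left_mono order_refl energy_sum_le subsets_of_sizeD(1)[OF m]) auto
        also have "\<dots> \<le> 2 * (real CARD('q) * (\<Sum>j\<in>UNIV. (\<beta> $ j)\<^sup>2 * ?e (\<eta> j n \<omega>) n \<omega>)) + 2 * ?e (\<epsilon> n \<omega>) n \<omega>"
          by (intro add_mono mult_left_mono sum_mono energy_le_max[OF m]) auto
        finally show "?g (\<xi> n \<omega>) \<le> 2 * (real CARD('q) * (\<Sum>j\<in>UNIV. (\<beta> $ j)\<^sup>2 * ?e (\<eta> j n \<omega>) n \<omega>)) + 2 * ?e (\<epsilon> n \<omega>) n \<omega>" .
      qed
      then have "?e (\<xi> n \<omega>) n \<omega> / sqrt n \<le> (2 * (real CARD('q) * (\<Sum>j\<in>UNIV. (\<beta> $ j)\<^sup>2 * ?e (\<eta> j n \<omega>) n \<omega>)) + 2 * ?e (\<epsilon> n \<omega>) n \<omega>) / sqrt n"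
        by (rule divide_right_mono) simp
      also have "\<dots> = ?b n \<omega>" by (simp add: add_divide_distrib sum_divide_distrib[symmetric])
      also have "\<dots> \<le> \<bar>?b n \<omega>\<bar>" by (rule abs_ge_self)
      finally show "\<bar>?e (\<xi> n \<omega>) n \<omega> / sqrt n\<bar> \<le> \<bar>?b n \<omega>\<bar>" by simp
    qed
  qed

  \<comment> \<open>Errors of the fits\<close>
  define d where "d j n \<omega> i = fhat n (p n) (Z n \<omega>) (\<lambda>i. X n \<omega> i $ j) (u\<delta> j n) (\<alpha>X j) i - fN j n \<omega> i" for j n \<omega> i
  define e where "e n \<omega> i = fhat n (p n) (Z n \<omega>) (Y n \<omega>) (u\<theta> n) \<alpha>Y i - f\<theta> n \<omega> i" for n \<omega> i
  have \<alpha>Y0: "\<alpha>Y > 0" using \<alpha>Y zero_le_power2[of KY] by linarith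
  have \<alpha>X0: "\<alpha>X j > 0" for j using \<alpha>X[of j] zero_le_power2[of "K\<eta> j"] by linarith
  have XV: "X n \<omega> i $ j = fN j n \<omega> i + \<eta> j n \<omega> i" if "\<omega> \<in> space (M n)" "i < n" for n \<omega> i j
    by (simp add: model_X[OF that] fN_def \<eta>_def)
  have YV: "Y n \<omega> i = f\<theta> n \<omega> i + \<xi> n \<omega> i" if "\<omega> \<in> space (M n)" "i < n" for n \<omega> i
    by (simp add: model_Y[OF that] model_X[OF that] f\<theta>_def \<xi>_def inner_add_left)
  have spN: "weakly_sparse M p Z (fN j) (s\<delta> j) (\<lambda>n. sqrt (real n))" for j
    using B3_N[of j] by (simp add: fN_def[abs_def])
  have sp\<theta>: "weakly_sparse M p Z f\<theta> s\<theta> (\<lambda>n. sqrt (real n))"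
    using B3_theta by (simp add: f\<theta>_def[abs_def])
  have en\<delta>\<eta>: "vanish_prob M (\<lambda>n \<omega>. max_energy n (p n) (Z n \<omega>) (fN j n \<omega>) (u\<delta> j n) (\<eta> k n \<omega>) / sqrt (real n))" for j k
    by (rule en\<eta>[OF _ up\<delta> rate\<delta>]) (rule ND)
  have en\<delta>\<epsilon>: "vanish_prob M (\<lambda>n \<omega>. max_energy n (p n) (Z n \<omega>) (fN j n \<omega>) (u\<delta> j n) (\<epsilon> n \<omega>) / sqrt (real n))" for j
    by (rule en\<epsilon>[OF _ up\<delta> rate\<delta>]) (rule ND)
  have en\<theta>\<eta>: "vanish_prob M (\<lambda>n \<omega>. max_energy n (p n) (Z n \<omega>) (f\<theta> n \<omega>) (u\<theta> n) (\<eta> k n \<omega>) / sqrt (real n))" for k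
    by (rule en\<eta>[OF _ up\<theta> rate\<theta>]) (rule \<theta>D)
  note errX = vanish_prob_fhat_error[OF _ spN meas_Z fNm su\<delta> up\<delta> rate\<delta> \<alpha>X0 en\<delta>\<eta>]
  note errY = vanish_prob_fhat_error[OF _ sp\<theta> meas_Z f\<theta>m su\<theta> up\<theta> rate\<theta> \<alpha>Y0 en\<xi>]
  have dd: "vanish_prob M (\<lambda>n \<omega>. sqn n (d j n \<omega>) / sqrt n)" for j
    unfolding d_def[abs_def] by (rule errX(1)[OF _ en\<delta>\<eta>]) (rule XV)
  \<comment> \<open>All pairs \<open>j\<close>, \<open>k\<close> are covered, including the noise
    column that produced the fit.\<close>
  have d\<eta>: "vanish_prob M (\<lambda>n \<omega>. inn n (d j n \<omega>) (\<eta> k n \<omega>) / sqrt n)" for j k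
    unfolding d_def[abs_def] by (rule errX(2)[OF _ en\<delta>\<eta>]) (rule XV)
  have d\<epsilon>: "vanish_prob M (\<lambda>n \<omega>. inn n (d j n \<omega>) (\<epsilon> n \<omega>) / sqrt n)" for j
    unfolding d_def[abs_def] by (rule errX(2)[OF _ en\<delta>\<epsilon>]) (rule XV)
  have ee: "vanish_prob M (\<lambda>n \<omega>. sqn n (e n \<omega>) / sqrt n)"
    unfolding e_def[abs_def] by (rule errY(1)[OF _ en\<xi>]) (rule YV)
  have e\<eta>: "vanish_prob M (\<lambda>n \<omega>. inn n (e n \<omega>) (\<eta> k n \<omega>) / sqrt n)" for k
    unfolding e_def[abs_def] by (rule errY(2)[OF _ en\<theta>\<eta>]) (rule YV)
  \<comment> \<open>Here the rate of weak sparsity matters: squared norms of order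
    \<open>o(sqrt n)\<close> make products of two fitting errors negligible against
    \<open>sqrt n\<close>.\<close>
  have prod: "vanish_prob M (\<lambda>n \<omega>. inn n (a n \<omega>) (b n \<omega>) / sqrt n)"
    if "vanish_prob M (\<lambda>n \<omega>. sqn n (a n \<omega>) / sqrt n)" "vanish_prob M (\<lambda>n \<omega>. sqn n (b n \<omega>) / sqrt n)" for a b
  proof (rule vanish_prob_mono[OF vanish_prob_add[OF that]], intro always_eventually allI ballI)
    fix n \<omega>
    have "\<bar>inn n (a n \<omega>) (b n \<omega>)\<bar> \<le> sqrt (sqn n (a n \<omega>)) * sqrt (sqn n (b n \<omega>))" by (rule abs_inn_le)
    also have "\<dots> \<le> sqn n (a n \<omega>) + sqn n (b n \<omega>)"
    proof -
      have "x * y \<le> x\<^sup>2 + y\<^sup>2" for x y :: real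
      proof -
        have "2 * (x * y) \<le> x\<^sup>2 + y\<^sup>2" using sum_squares_bound[of x y] by (simp add: mult.assoc)
        moreover have "0 \<le> x\<^sup>2 + y\<^sup>2" by simp
        ultimately show ?thesis by linarith
      qed
      from this[of "sqrt (sqn n (a n \<omega>))" "sqrt (sqn n (b n \<omega>))"] show ?thesis by simp
    qed
    finally have "\<bar>inn n (a n \<omega>) (b n \<omega>)\<bar> / sqrt n \<le> (sqn n (a n \<omega>) + sqn n (b n \<omega>)) / sqrt n"
      by (rule divide_right_mono) simp
    then show "\<bar>inn n (a n \<omega>) (b n \<omega>) / sqrt n\<bar> \<le> \<bar>sqn n (a n \<omega>) / sqrt n + sqn n (b n \<omega>) / sqrt n\<bar>"
      by (simp add: abs_divide add_divide_distrib add_nonneg_nonneg)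
  qed

  \<comment> \<open>Residual regression: Gram matrix, score and remainder\<close>
  define Xt where "Xt j n \<omega> i = \<eta> j n \<omega> i - d j n \<omega> i" for j n \<omega> i
  \<comment> \<open>Since the signal of \<open>Y\<close> is \<open>N\<beta> + \<mu>\<close>, the
    residual of \<open>Y\<close> is \<open>\<xi> - e\<close>. Writing \<open>\<eta> k\<close> as
    \<open>Xt k + d k\<close> isolates the regression on the residual columns with coefficient
    \<open>\<beta>\<close>, and \<open>\<rho>\<close> is what is left.\<close>
  define \<rho> where "\<rho> n \<omega> i = \<epsilon> n \<omega> i - e n \<omega> i + (\<Sum>k\<in>UNIV. \<beta> $ k * d k n \<omega> i)" for n \<omega> i
  define G where "G n \<omega> = (\<chi> j k. inn n (Xt j n \<omega>) (Xt k n \<omega>) / n)" for n \<omega>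
  define W where "W n \<omega> = (\<chi> j. inn n (\<eta> j n \<omega>) (\<epsilon> n \<omega>) / sqrt n)" for n \<omega>
  define r where "r n \<omega> = (\<chi> j. inn n (Xt j n \<omega>) (\<rho> n \<omega>) / sqrt n - inn n (\<eta> j n \<omega>) (\<epsilon> n \<omega>) / sqrt n)" for n \<omega>
  define T where "T n \<omega> = sqrt (real n) *\<^sub>R
    (betahat n (p n) (Z n \<omega>) (Y n \<omega>) (X n \<omega>) (u\<theta> n) \<alpha>Y (\<lambda>j. u\<delta> j n) \<alpha>X - \<beta>)" for n \<omega>
  have Xt_eq: "X n \<omega> i $ j - fhat n (p n) (Z n \<omega>) (\<lambda>i. X n \<omega> i $ j) (u\<delta> j n) (\<alpha>X j) i = Xt j n \<omega> i"
    if "\<omega> \<in> space (M n)" "i < n" for n \<omega> i j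
    using XV[OF that] by (simp add: Xt_def d_def)
  have Yt_eq: "Y n \<omega> i - fhat n (p n) (Z n \<omega>) (Y n \<omega>) (u\<theta> n) \<alpha>Y i = \<rho> n \<omega> i + (\<Sum>k\<in>UNIV. \<beta> $ k * Xt k n \<omega> i)"
    if "\<omega> \<in> space (M n)" "i < n" for n \<omega> i
    using YV[OF that] by (simp add: \<rho>_def e_def Xt_def \<xi>_def \<eta>_def inner_vec_def right_diff_distrib sum_subtractf mult.commute)

  have Gvan: "vanish_prob M (\<lambda>n \<omega>. G n \<omega> $ j $ k - \<Sigma>H $ j $ k)" for j k
  proof -
    let ?t = "\<lambda>n \<omega>. inn n (d j n \<omega>) (d k n \<omega>) / sqrt n - inn n (d j n \<omega>) (\<eta> k n \<omega>) / sqrt n - inn n (d k n \<omega>) (\<eta> j n \<omega>) / sqrt n"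
    have "vanish_prob M ?t" by (intro vanish_prob_diff prod dd d\<eta>)
    \<comment> \<open>The cross terms are already negligible at scale \<open>sqrt n\<close>, and the
      Gram matrix is divided by \<open>n\<close>.\<close>
    then have "vanish_prob M (\<lambda>n \<omega>. ?t n \<omega> / sqrt n)"
    proof (rule vanish_prob_mono, intro eventually_mono[OF eventually_gt_at_top[of 0]] ballI)
      fix n :: nat and \<omega> assume "0 < n"
      then have "1 \<le> sqrt (real n)" by simp
      then show "\<bar>?t n \<omega> / sqrt n\<bar> \<le> \<bar>?t n \<omega>\<bar>"
        using mult_right_mono[of 1 "sqrt n" "\<bar>?t n \<omega>\<bar>"] by (simp add: abs_divide pos_divide_le_eq mult.commute)
    qed
    from vanish_prob_add[OF gram_lln[of j k] this] show ?thesis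
    proof (rule vanish_prob_mono, intro eventually_mono[OF eventually_gt_at_top[of 0]] ballI)
      fix n :: nat and \<omega> assume n: "0 < n"
      have "inn n (Xt j n \<omega>) (Xt k n \<omega>) = inn n (\<eta> j n \<omega>) (\<eta> k n \<omega>) +
          (inn n (d j n \<omega>) (d k n \<omega>) - inn n (d j n \<omega>) (\<eta> k n \<omega>) - inn n (d k n \<omega>) (\<eta> j n \<omega>))"
        unfolding Xt_def inn_linear inn_commute[of n "\<eta> j n \<omega>" "d k n \<omega>"] by simp
      moreover have "?t n \<omega> / sqrt n = (inn n (d j n \<omega>) (d k n \<omega>) - inn n (d j n \<omega>) (\<eta> k n \<omega>) - inn n (d k n \<omega>) (\<eta> j n \<omega>)) / n"
        by (simp add: diff_divide_distrib)
      ultimately have "G n \<omega> $ j $ k - \<Sigma>H $ j $ k = inn n (\<lambda>i. H n \<omega> i $ j) (\<lambda>i. H n \<omega> i $ k) / n - \<Sigma>H $ j $ k + ?t n \<omega> / sqrt n"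
        by (simp add: G_def \<eta>_def[abs_def] add_divide_distrib)
      then show "\<bar>G n \<omega> $ j $ k - \<Sigma>H $ j $ k\<bar> \<le> \<bar>inn n (\<lambda>i. H n \<omega> i $ j) (\<lambda>i. H n \<omega> i $ k) / n - \<Sigma>H $ j $ k + ?t n \<omega> / sqrt n\<bar>"
        by simp
    qed
  qed
  have rvan: "vanish_prob M (\<lambda>n \<omega>. r n \<omega> $ j)" for j
  proof -
    let ?t = "\<lambda>n \<omega>. (\<Sum>k\<in>UNIV. \<beta> $ k * (inn n (d k n \<omega>) (\<eta> j n \<omega>) / sqrt n)) - inn n (e n \<omega>) (\<eta> j n \<omega>) / sqrt n
      - inn n (d j n \<omega>) (\<epsilon> n \<omega>) / sqrt n + inn n (d j n \<omega>) (e n \<omega>) / sqrt n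
      - (\<Sum>k\<in>UNIV. \<beta> $ k * (inn n (d j n \<omega>) (d k n \<omega>) / sqrt n))"
    have "vanish_prob M ?t"
      by (intro vanish_prob_diff vanish_prob_add vanish_prob_sum vanish_prob_cmult prod dd d\<eta> d\<epsilon> ee e\<eta>) auto
    moreover have "r n \<omega> $ j = ?t n \<omega>" for n \<omega>
    proof -
      have "inn n (Xt j n \<omega>) (\<rho> n \<omega>) = inn n (\<eta> j n \<omega>) (\<epsilon> n \<omega>) + (\<Sum>k\<in>UNIV. \<beta> $ k * inn n (d k n \<omega>) (\<eta> j n \<omega>)) - inn n (e n \<omega>) (\<eta> j n \<omega>)
        - inn n (d j n \<omega>) (\<epsilon> n \<omega>) + inn n (d j n \<omega>) (e n \<omega>) - (\<Sum>k\<in>UNIV. \<beta> $ k * inn n (d j n \<omega>) (d k n \<omega>))"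
        unfolding Xt_def \<rho>_def inn_linear inn_commute[of n "\<eta> j n \<omega>" "e n \<omega>"] inn_commute[of n "\<eta> j n \<omega>" "d _ n \<omega>"] by simp
      then show ?thesis by (simp add: r_def diff_divide_distrib add_divide_distrib sum_divide_distrib)
    qed
    ultimately show ?thesis by simp
  qed
  have Wbdd: "bounded_prob M (\<lambda>n \<omega>. norm (W n \<omega>))"
  proof (rule bounded_prob_mono)
    have "bounded_prob M (\<lambda>n \<omega>. \<bar>W n \<omega> $ j\<bar>)" for j
      using score_bounded[of j] by (rule bounded_prob_mono) (simp add: W_def \<eta>_def[abs_def])
    then show "bounded_prob M (\<lambda>n \<omega>. \<Sum>j\<in>UNIV. \<bar>W n \<omega> $ j\<bar>)" by (intro bounded_prob_sum) auto
    show "\<forall>\<^sub>F n in sequentially. \<forall>\<omega>\<in>space (M n). \<bar>norm (W n \<omega>)\<bar> \<le> \<bar>\<Sum>j\<in>UNIV. \<bar>W n \<omega> $ j\<bar>\<bar>"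
      using norm_le_l1_cart[of "W _ _"] by (intro always_eventually allI ballI) (simp add: sum_nonneg)
  qed
  have rnorm: "vanish_prob M (\<lambda>n \<omega>. norm (r n \<omega>))"
  proof (rule vanish_prob_mono)
    show "vanish_prob M (\<lambda>n \<omega>. \<Sum>j\<in>UNIV. \<bar>r n \<omega> $ j\<bar>)" by (intro vanish_prob_sum vanish_prob_abs rvan) auto
    show "\<forall>\<^sub>F n in sequentially. \<forall>\<omega>\<in>space (M n). \<bar>norm (r n \<omega>)\<bar> \<le> \<bar>\<Sum>j\<in>UNIV. \<bar>r n \<omega> $ j\<bar>\<bar>"
      using norm_le_l1_cart[of "r _ _"] by (intro always_eventually allI ballI) (simp add: sum_nonneg)
  qed

  \<comment> \<open>Linearisation of the estimator\<close>
  let ?S = "matrix_inv \<Sigma>H"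
  define c where "c = (\<Sum>j\<in>UNIV. \<Sum>k\<in>UNIV. \<bar>?S $ j $ k\<bar>)"
  define D where "D n \<omega> = (\<Sum>j\<in>UNIV. \<Sum>k\<in>UNIV. \<bar>(\<Sigma>H - G n \<omega>) $ j $ k\<bar>)" for n \<omega>
  have c: "norm (?S *v x) \<le> c * norm x" for x unfolding c_def by (rule norm_matrix_vector_le)
  have c0: "c \<ge> 0" unfolding c_def by (intro sum_nonneg) auto
  have D0: "D n \<omega> \<ge> 0" for n \<omega> unfolding D_def by (intro sum_nonneg) auto
  have Dvan: "vanish_prob M D"
    unfolding D_def[abs_def]
  proof (intro vanish_prob_sum)
    fix j k show "vanish_prob M (\<lambda>n \<omega>. \<bar>(\<Sigma>H - G n \<omega>) $ j $ k\<bar>)"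
      using Gvan[of j k] by (rule vanish_prob_mono) (simp add: abs_minus_commute)
  qed auto

  have core: "norm (T n \<omega> - ?S *v W n \<omega>) \<le> c * (norm (r n \<omega>) + D n \<omega> * (2 * c * (norm (W n \<omega>) + norm (r n \<omega>))))"
    if n: "0 < n" and \<omega>: "\<omega> \<in> space (M n)" and small: "c * D n \<omega> \<le> 1 / 2" for n \<omega>
  proof -
    have Dn: "norm ((\<Sigma>H - G n \<omega>) *v x) \<le> D n \<omega> * norm x" for x unfolding D_def by (rule norm_matrix_vector_le)
    note ps = perturbed_system[OF \<Sigma>H_inv c c0 Dn small]
    let ?Xt = "\<lambda>j i. X n \<omega> i $ j - fhat n (p n) (Z n \<omega>) (\<lambda>i. X n \<omega> i $ j) (u\<delta> j n) (\<alpha>X j) i"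
    let ?Yt = "\<lambda>i. Y n \<omega> i - fhat n (p n) (Z n \<omega>) (Y n \<omega>) (u\<theta> n) \<alpha>Y i"
    let ?G = "\<chi> j k. inn n (?Xt j) (?Xt k)"
    let ?bh = "betahat n (p n) (Z n \<omega>) (Y n \<omega>) (X n \<omega>) (u\<theta> n) \<alpha>Y (\<lambda>j. u\<delta> j n) \<alpha>X"
    have XX: "inn n (?Xt j) (?Xt k) = inn n (Xt j n \<omega>) (Xt k n \<omega>)" for j k
      by (intro inn_cong Xt_eq \<omega>)
    have G_eq: "?G = real n *\<^sub>R G n \<omega>" unfolding XX using n by (simp add: vec_eq_iff G_def)
    have Gv: "?G *v x = real n *\<^sub>R (G n \<omega> *v x)" for x unfolding G_eq by (simp only: scaleR_matrix_vector_assoc)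
    \<comment> \<open>The unnormalised Gram matrix inside \<open>betahat\<close> is \<open>n\<close>
      times \<open>G n \<omega>\<close> and inherits its injectivity.\<close>
    have "x = 0" if "?G *v x = 0" for x
    proof -
      have "G n \<omega> *v x = 0" using that n unfolding Gv by simp
      then show ?thesis using ps(1) unfolding invertible_left_inverse matrix_left_invertible_ker by blast
    qed
    then have invG: "invertible ?G" unfolding invertible_left_inverse matrix_left_invertible_ker by blast
    have bh: "(?G *v ?bh) $ j = inn n (Xt j n \<omega>) (\<rho> n \<omega>) + (\<Sum>k\<in>UNIV. \<beta> $ k * inn n (Xt j n \<omega>) (Xt k n \<omega>))" for j
    proof -
      have "(?G *v ?bh) $ j = inn n (?Xt j) ?Yt"
        using betahat_normal_equations[OF invG] by simp
      also have "\<dots> = inn n (Xt j n \<omega>) (\<lambda>i. \<rho> n \<omega> i + (\<Sum>k\<in>UNIV. \<beta> $ k * Xt k n \<omega> i))"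
        by (intro inn_cong Xt_eq Yt_eq \<omega>)
      finally show ?thesis by (simp only: inn_linear)
    qed
    have "(?G *v (?bh - \<beta>)) $ j = inn n (Xt j n \<omega>) (\<rho> n \<omega>)" for j
    proof -
      have "(?G *v \<beta>) $ j = (\<Sum>k\<in>UNIV. \<beta> $ k * inn n (Xt j n \<omega>) (Xt k n \<omega>))"
        unfolding XX matrix_vector_mult_def by (simp add: mult.commute)
      then show ?thesis using bh[of j] by (simp add: matrix_vector_mult_diff_distrib)
    qed
    then have key: "real n * (G n \<omega> *v (?bh - \<beta>)) $ j = inn n (Xt j n \<omega>) (\<rho> n \<omega>)" for j
      unfolding Gv by simp
    have "(G n \<omega> *v T n \<omega>) $ j = (W n \<omega> + r n \<omega>) $ j" for j
    proof -
      have "(G n \<omega> *v T n \<omega>) $ j = sqrt n * (G n \<omega> *v (?bh - \<beta>)) $ j"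
        unfolding T_def by (simp add: matrix_vector_mult_scaleR)
      also have "\<dots> = (real n * (G n \<omega> *v (?bh - \<beta>)) $ j) / sqrt n"
        by (simp add: real_div_sqrt divide_simps)
      also have "\<dots> = (W n \<omega> + r n \<omega>) $ j" unfolding key by (simp add: W_def r_def)
      finally show ?thesis .
    qed
    then have "G n \<omega> *v T n \<omega> = W n \<omega> + r n \<omega>" by (simp add: vec_eq_iff)
    from ps(2)[OF this]
    have "norm (T n \<omega> - ?S *v W n \<omega>) \<le> c * (norm (r n \<omega>) + D n \<omega> * (2 * c * norm (W n \<omega> + r n \<omega>)))" .
    also have "\<dots> \<le> c * (norm (r n \<omega>) + D n \<omega> * (2 * c * (norm (W n \<omega>) + norm (r n \<omega>))))"
      using c0 D0 by (intro mult_left_mono add_mono order_refl norm_triangle_ineq) auto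
    finally show ?thesis .
  qed
  have Tvan: "vanish_prob M (\<lambda>n \<omega>. norm (T n \<omega> - ?S *v W n \<omega>))"
  \<comment> \<open>Nothing is claimed where \<open>c * D n \<omega>\<close> exceeds 1/2 and
    \<open>betahat\<close> may take its default value 0; that event is negligible.\<close>
  proof (rule vanish_prob_mono_event[where d="1 / 2"])
    show "vanish_prob M (\<lambda>n \<omega>. c * (norm (r n \<omega>) + D n \<omega> * (2 * c * (norm (W n \<omega>) + norm (r n \<omega>)))))"
      by (intro vanish_prob_cmult vanish_prob_add vanish_prob_mult rnorm Dvan bounded_prob_cmult bounded_prob_add Wbdd vanish_prob_bounded[OF rnorm])
    show "vanish_prob M (\<lambda>n \<omega>. c * D n \<omega>)" by (intro vanish_prob_cmult Dvan)
    show "\<forall>\<^sub>F n in sequentially. \<forall>\<omega>\<in>space (M n). \<bar>c * D n \<omega>\<bar> \<le> 1 / 2 \<longrightarrow>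
      \<bar>norm (T n \<omega> - ?S *v W n \<omega>)\<bar> \<le> \<bar>c * (norm (r n \<omega>) + D n \<omega> * (2 * c * (norm (W n \<omega>) + norm (r n \<omega>))))\<bar>"
    proof (intro eventually_mono[OF eventually_gt_at_top[of 0]] ballI impI)
      fix n :: nat and \<omega> assume "0 < n" "\<omega> \<in> space (M n)" "\<bar>c * D n \<omega>\<bar> \<le> 1 / 2"
      then have "norm (T n \<omega> - ?S *v W n \<omega>) \<le> c * (norm (r n \<omega>) + D n \<omega> * (2 * c * (norm (W n \<omega>) + norm (r n \<omega>))))"
        by (intro core) auto
      also have "\<dots> \<le> \<bar>\<dots>\<bar>" by (rule abs_ge_self)
      finally show "\<bar>norm (T n \<omega> - ?S *v W n \<omega>)\<bar> \<le> \<bar>c * (norm (r n \<omega>) + D n \<omega> * (2 * c * (norm (W n \<omega>) + norm (r n \<omega>))))\<bar>"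
        by simp
    qed
  qed simp

  \<comment> \<open>The limit law\<close>
  have Hsym: "\<Sigma>H $ j $ k = \<Sigma>H $ k $ j" for j k
    using H_product[of 0 1 j k] H_product[of 0 1 k j] by (simp add: mult.commute)
  have Ssym: "transpose ?S = ?S"
  proof -
    have "transpose \<Sigma>H = \<Sigma>H" using Hsym by (simp add: transpose_def vec_eq_iff)
    then have "transpose ?S ** \<Sigma>H = mat 1"
      using arg_cong[OF matrix_inv_mult(1)[OF \<Sigma>H_inv], of transpose] by (simp add: matrix_transpose_mul)
    then have "transpose ?S ** \<Sigma>H ** ?S = ?S" by simp
    then show ?thesis unfolding matrix_mul_assoc[symmetric] matrix_inv_mult[OF \<Sigma>H_inv] by simp
  qed
  have Sinner: "t \<bullet> (?S *v x) = (?S *v t) \<bullet> x" for t x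
    by (metis Ssym dot_lmul_matrix transpose_matrix_vector)
  \<comment> \<open>The sandwich of \<open>\<Sigma>H\<close> between two copies of its inverse
    collapses to the inverse, which turns the score variance into the claimed covariance.\<close>
  have Squad: "(?S *v t) \<bullet> (\<Sigma>H *v (?S *v t)) = t \<bullet> (?S *v t)" for t
    by (simp add: matrix_vector_mul_assoc matrix_inv_mult[OF \<Sigma>H_inv] inner_commute)
  have quad: "t \<bullet> ((\<sigma>\<epsilon>2 *\<^sub>R ?S) *v t) = \<sigma>\<epsilon>2 * (t \<bullet> (?S *v t))" for t
    by (simp add: scaleR_matrix_vector_assoc[symmetric])
  have "\<exists>L. is_mvnormal L (\<sigma>\<epsilon>2 *\<^sub>R ?S)"
  proof (rule mvnormal_exists)
    fix i j show "(\<sigma>\<epsilon>2 *\<^sub>R ?S) $ i $ j = (\<sigma>\<epsilon>2 *\<^sub>R ?S) $ j $ i"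
      using arg_cong[OF Ssym, of "\<lambda>A. A $ j $ i"] by (simp add: transpose_def)
  next
    fix t show "0 \<le> t \<bullet> ((\<sigma>\<epsilon>2 *\<^sub>R ?S) *v t)"
      unfolding quad Squad[symmetric] using \<sigma>2_nonneg \<Sigma>_psd by simp
  qed
  then obtain L where L: "is_mvnormal L (\<sigma>\<epsilon>2 *\<^sub>R ?S)" ..
  have Wm: "W n \<in> borel_measurable (M n)" for n
    unfolding W_def[abs_def] \<eta>_def[abs_def] using meas_H_component meas_eps
    by (intro borel_measurable_vec_lambda borel_measurable_divide measurable_inn) auto
  have conv: "conv_in_distr M T L"
  proof (rule conv_in_distr_slutsky[where W="\<lambda>n \<omega>. ?S *v W n \<omega>"])
    show "prob_space (M n)" for n by (rule prob)
    show "T n \<in> borel_measurable (M n)" for n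
    proof -
      have "(\<lambda>\<omega>. Y n \<omega> i) \<in> borel_measurable (M n)" if "i < n" for i
      proof -
        have "(\<lambda>\<omega>. f\<theta> n \<omega> i + \<xi> n \<omega> i) \<in> borel_measurable (M n)"
          unfolding \<xi>_def using f\<theta>m meas_H meas_eps by (intro borel_measurable_add borel_measurable_inner) auto
        then show ?thesis using YV[OF _ that] by (simp cong: measurable_cong)
      qed
      moreover have "(\<lambda>\<omega>. X n \<omega> i $ j) \<in> borel_measurable (M n)" if "i < n" for i j
      proof -
        have "(\<lambda>\<omega>. fN j n \<omega> i + \<eta> j n \<omega> i) \<in> borel_measurable (M n)"
          unfolding \<eta>_def using fNm meas_H_component by (intro borel_measurable_add) auto
        then show ?thesis using XV[OF _ that] by (simp cong: measurable_cong)
      qed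
      ultimately have "(\<lambda>\<omega>. betahat n (p n) (Z n \<omega>) (Y n \<omega>) (X n \<omega>) (u\<theta> n) \<alpha>Y (\<lambda>j. u\<delta> j n) \<alpha>X) \<in> borel_measurable (M n)"
        using meas_Z by (intro measurable_betahat) auto
      then show ?thesis unfolding T_def[abs_def] by (intro borel_measurable_scaleR borel_measurable_diff) auto
    qed
    show "(\<lambda>\<omega>. ?S *v W n \<omega>) \<in> borel_measurable (M n)" for n
      by (rule borel_measurable_continuous_on[OF _ Wm]) (rule matrix_vector_mult_linear_continuous_on)
    show "prob_space L" "sets L = sets borel" using L by (auto simp: is_mvnormal_def)
    fix t :: "real^'q"
    \<comment> \<open>By symmetry of \<open>?S\<close>, the linearised estimator in direction
      \<open>t\<close> is the score in direction \<open>?S *v t\<close>, so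
      \<open>score_char\<close> applies there.\<close>
    have tW: "t \<bullet> (?S *v W n \<omega>) = (\<Sum>i<n. 1 / sqrt n * ((?S *v t) \<bullet> H n \<omega> i) * \<epsilon> n \<omega> i)" for n \<omega>
    proof -
      have "t \<bullet> (?S *v W n \<omega>) = (\<Sum>j\<in>UNIV. (?S *v t) $ j * (\<Sum>i<n. H n \<omega> i $ j * \<epsilon> n \<omega> i / sqrt n))"
        unfolding Sinner by (simp add: inner_vec_def W_def inn_def \<eta>_def sum_divide_distrib)
      also have "\<dots> = (\<Sum>i<n. \<Sum>j\<in>UNIV. (?S *v t) $ j * (H n \<omega> i $ j * \<epsilon> n \<omega> i / sqrt n))"
        unfolding sum_distrib_left by (rule sum.swap)
      also have "\<dots> = (\<Sum>i<n. 1 / sqrt n * ((?S *v t) \<bullet> H n \<omega> i) * \<epsilon> n \<omega> i)"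
        by (intro sum.cong refl) (simp add: inner_vec_def sum_distrib_left sum_distrib_right sum_divide_distrib mult_ac)
      finally show ?thesis .
    qed
    have "(\<integral>x. cis (t \<bullet> x) \<partial>L) = complex_of_real (exp (- (\<sigma>\<epsilon>2 * ((?S *v t) \<bullet> (\<Sigma>H *v (?S *v t)))) / 2))"
      using L unfolding is_mvnormal_def Squad quad by simp
    then show "(\<lambda>n. \<integral>\<omega>. cis (t \<bullet> (?S *v W n \<omega>)) \<partial>M n) \<longlonglongrightarrow> (\<integral>x. cis (t \<bullet> x) \<partial>L)"
      unfolding tW using score_char[of "?S *v t"] by simp
  next
    show "vanish_prob M (\<lambda>n \<omega>. norm (T n \<omega> - ?S *v W n \<omega>))" by (rule Tvan)
    have "bounded_prob M (\<lambda>n \<omega>. c * norm (W n \<omega>))" by (intro bounded_prob_cmult Wbdd)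
    then show "bounded_prob M (\<lambda>n \<omega>. norm (?S *v W n \<omega>))"
      by (rule bounded_prob_mono) (use c c0 in \<open>auto intro!: always_eventually\<close>)
  qed
  show ?thesis using L conv unfolding T_def[abs_def] by blast
qed

end
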